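(* Let $X$ be a simplicial complex and let $Y\subseteq X$ be a subcomplex. Assume the following conditions hold: (1) The space $X\setminus Y$ is dense in $X$. (2) For each point $y\in Y$ and each open neighborhood $U\subseteq X$ containing $y$, there exists an open neighborhood $V\subseteq U$ with $y\in V$ such that $V\setminus Y$ is path connected. (3) For each point $y\in Y$, there exists a path connected open neighborhood $V$ of $y$ such that $\pi_2(V)=0$ and the natural map $\pi_1(V\setminus Y,v)\to\pi_1(V,v)$ is injective for each $v\in V\setminus Y$. Then the inclusion $X\setminus Y\hookrightarrow X$ is $2$-connected.
   Context: A simplicial complex here means a topological space equipped with a triangulation, with the weak topology; a subcomplex is a union of simplices. A map is $2$-connected if it induces isomorphisms on $\pi_0$ and on $\pi_1$ (for all basepoints) and a surjection on $\pi_2$ (for all basepoints). *)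

theory Defs
  imports "HOL-Analysis.Analysis" "HOL-Algebra.Group"
begin

subsection \<open>Triangulated spaces\<close>

definition abstract_simplicial_complex :: "'v set set \<Rightarrow> bool" where
  "abstract_simplicial_complex K \<longleftrightarrow>
     (\<forall>\<sigma>\<in>K. finite \<sigma> \<and> \<sigma> \<noteq> {}) \<and>
     (\<forall>\<sigma>\<in>K. \<forall>\<tau>. \<tau> \<noteq> {} \<and> \<tau> \<subseteq> \<sigma> \<longrightarrow> \<tau> \<in> K)"

text \<open>Points of the realization are given by their barycentric coordinates.\<close>

definition closed_simplex :: "'v set \<Rightarrow> ('v \<Rightarrow> real) set" where
  "closed_simplex \<sigma> = {b. (\<forall>v. 0 \<le> b v) \<and> (\<forall>v. v \<notin> \<sigma> \<longrightarrow> b v = 0) \<and> sum b \<sigma> = 1}"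

text \<open>
  The weak topology: a set of points is open iff its trace on every closed simplex is open there.
  The topology on \<^typ>\<open>'v \<Rightarrow> real\<close> is that of pointwise convergence; on a closed simplex with
  finitely many vertices it restricts to the Euclidean topology.
\<close>

definition realization_open :: "'v set set \<Rightarrow> ('v \<Rightarrow> real) set \<Rightarrow> bool" where
  "realization_open K U \<longleftrightarrow>
     U \<subseteq> (\<Union>\<sigma>\<in>K. closed_simplex \<sigma>) \<and>
     (\<forall>\<sigma>\<in>K. openin (top_of_set (closed_simplex \<sigma>)) (U \<inter> closed_simplex \<sigma>))"

definition realization :: "'v set set \<Rightarrow> ('v \<Rightarrow> real) topology" where
  "realization K = topology (realization_open K)"

lemma istopology_realization_open: "istopology (realization_open K)"
  unfolding istopology_def
proof (intro conjI allI impI)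
  fix S T assume S: "realization_open K S" and T: "realization_open K T"
  have "openin (top_of_set (closed_simplex \<sigma>)) (S \<inter> T \<inter> closed_simplex \<sigma>)" if "\<sigma> \<in> K" for \<sigma>
  proof -
    have "S \<inter> T \<inter> closed_simplex \<sigma> = (S \<inter> closed_simplex \<sigma>) \<inter> (T \<inter> closed_simplex \<sigma>)"
      by blast
    with S T that show ?thesis
      unfolding realization_open_def by (metis openin_Int)
  qed
  with S T show "realization_open K (S \<inter> T)"
    unfolding realization_open_def by blast
next
  fix \<U> assume *: "\<forall>U\<in>\<U>. realization_open K U"
  have "openin (top_of_set (closed_simplex \<sigma>)) (\<Union>\<U> \<inter> closed_simplex \<sigma>)" if "\<sigma> \<in> K" for \<sigma>
  proof -
    have "openin (top_of_set (closed_simplex \<sigma>)) (\<Union>U\<in>\<U>. U \<inter> closed_simplex \<sigma>)"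
      using * that by (intro openin_Union) (auto simp: realization_open_def)
    moreover have "(\<Union>U\<in>\<U>. U \<inter> closed_simplex \<sigma>) = \<Union>\<U> \<inter> closed_simplex \<sigma>"
      by blast
    ultimately show ?thesis
      by simp
  qed
  with * show "realization_open K (\<Union>\<U>)"
    unfolding realization_open_def by blast
qed

lemma openin_realization: "openin (realization K) U \<longleftrightarrow> realization_open K U"
  by (simp add: realization_def topology_inverse' istopology_realization_open)

lemma topspace_realization: "topspace (realization K) = (\<Union>\<sigma>\<in>K. closed_simplex \<sigma>)"
proof
  show "topspace (realization K) \<subseteq> (\<Union>\<sigma>\<in>K. closed_simplex \<sigma>)"
    by (metis openin_realization openin_topspace realization_open_def)
  have "realization_open K (\<Union>\<sigma>\<in>K. closed_simplex \<sigma>)"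
    unfolding realization_open_def
  proof (intro conjI ballI)
    fix \<tau> assume "\<tau> \<in> K"
    then have "(\<Union>\<sigma>\<in>K. closed_simplex \<sigma>) \<inter> closed_simplex \<tau> = closed_simplex \<tau>"
      by blast
    then show "openin (top_of_set (closed_simplex \<tau>))
                 ((\<Union>\<sigma>\<in>K. closed_simplex \<sigma>) \<inter> closed_simplex \<tau>)"
      by simp
  qed simp
  then show "(\<Union>\<sigma>\<in>K. closed_simplex \<sigma>) \<subseteq> topspace (realization K)"
    by (simp add: openin_realization openin_subset)
qed

definition triangulates :: "'v set set \<Rightarrow> (('v \<Rightarrow> real) \<Rightarrow> 'a) \<Rightarrow> 'a topology \<Rightarrow> bool" where
  "triangulates K h X \<longleftrightarrow>
     abstract_simplicial_complex K \<and> homeomorphic_map (realization K) X h"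

definition is_subcomplex :: "'v set set \<Rightarrow> (('v \<Rightarrow> real) \<Rightarrow> 'a) \<Rightarrow> 'a set \<Rightarrow> bool" where
  "is_subcomplex K h Y \<longleftrightarrow> (\<exists>L\<subseteq>K. Y = h ` (\<Union>\<sigma>\<in>L. closed_simplex \<sigma>))"

subsection \<open>Homotopy groups\<close>

definition cube :: "nat \<Rightarrow> (nat \<Rightarrow> real) topology" where
  "cube n = product_topology (\<lambda>_. top_of_set {0..1}) {..<n}"

definition cube_boundary :: "nat \<Rightarrow> (nat \<Rightarrow> real) set" where
  "cube_boundary n = {t \<in> topspace (cube n). \<exists>i<n. t i = 0 \<or> t i = 1}"

definition spheroids :: "nat \<Rightarrow> 'a topology \<Rightarrow> 'a \<Rightarrow> ((nat \<Rightarrow> real) \<Rightarrow> 'a) set" where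
  "spheroids n X x = {f. continuous_map (cube n) X f \<and> f ` cube_boundary n \<subseteq> {x}}"

text \<open>
  Values of spheroids outside the cube are unconstrained, but two spheroids that agree on the
  cube are related, so that they do not affect the set of classes.
\<close>

definition spheroid_homotopic ::
    "nat \<Rightarrow> 'a topology \<Rightarrow> 'a \<Rightarrow> (((nat \<Rightarrow> real) \<Rightarrow> 'a) \<times> ((nat \<Rightarrow> real) \<Rightarrow> 'a)) set" where
  "spheroid_homotopic n X x =
     {(f, g). f \<in> spheroids n X x \<and> g \<in> spheroids n X x \<and>
              homotopic_with (\<lambda>k. k ` cube_boundary n \<subseteq> {x}) (cube n) X f g}"

definition spheroid_concat ::
    "((nat \<Rightarrow> real) \<Rightarrow> 'a) \<Rightarrow> ((nat \<Rightarrow> real) \<Rightarrow> 'a) \<Rightarrow> (nat \<Rightarrow> real) \<Rightarrow> 'a" where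
  "spheroid_concat f g =
     (\<lambda>t. if t 0 \<le> 1/2 then f (t(0 := 2 * t 0)) else g (t(0 := 2 * t 0 - 1)))"

text \<open>To be used only for \<open>n \<ge> 1\<close> and a base point \<open>x\<close> of \<open>X\<close>.\<close>

definition homotopy_group ::
    "nat \<Rightarrow> 'a topology \<Rightarrow> 'a \<Rightarrow> ((nat \<Rightarrow> real) \<Rightarrow> 'a) set monoid" where
  "homotopy_group n X x =
     \<lparr>carrier = spheroids n X x // spheroid_homotopic n X x,
      mult = (\<lambda>A B. spheroid_homotopic n X x `` {spheroid_concat f g |f g. f \<in> A \<and> g \<in> B}),
      one = spheroid_homotopic n X x `` {\<lambda>_. x}\<rparr>"

definition homotopy_group_map ::
    "nat \<Rightarrow> 'b topology \<Rightarrow> ('a \<Rightarrow> 'b) \<Rightarrow> 'a \<Rightarrow>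
     ((nat \<Rightarrow> real) \<Rightarrow> 'a) set \<Rightarrow> ((nat \<Rightarrow> real) \<Rightarrow> 'b) set" where
  "homotopy_group_map n Y f x A = spheroid_homotopic n Y (f x) `` ((\<lambda>k. f \<circ> k) ` A)"

definition pi0_map :: "'b topology \<Rightarrow> ('a \<Rightarrow> 'b) \<Rightarrow> 'a set \<Rightarrow> 'b set" where
  "pi0_map Y f C = (THE D. D \<in> path_components_of Y \<and> f ` C \<subseteq> D)"

definition two_connected_map :: "'a topology \<Rightarrow> 'b topology \<Rightarrow> ('a \<Rightarrow> 'b) \<Rightarrow> bool" where
  "two_connected_map X Y f \<longleftrightarrow>
     continuous_map X Y f \<and>
     bij_betw (pi0_map Y f) (path_components_of X) (path_components_of Y) \<and>
     (\<forall>x\<in>topspace X.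
        homotopy_group_map 1 Y f x \<in> iso (homotopy_group 1 X x) (homotopy_group 1 Y (f x))) \<and>
     (\<forall>x\<in>topspace X.
        homotopy_group_map 2 Y f x ` carrier (homotopy_group 2 X x)
          = carrier (homotopy_group 2 Y (f x)))"

end

theory Submission
  imports Defs
begin

text \<open>
  Write \<open>A\<close> for the complement of \<open>Y\<close>. The theorem is an instance of a local-to-global principle:
  2-connectedness of a pair can be tested on the members of an open cover, provided that the pair is
  0-connected and 1-connected inside every open set, so that the pieces can be made to fit.

  The local input has three layers. Since \<open>A\<close> is dense and a triangulated space is locally
  contractible (straight-line contraction of open stars, \<open>triangulated_locally_contractible\<close>), every
  point of an open set \<open>W\<close> is joined inside \<open>W\<close> to a point of \<open>A\<close> (\<open>push_point\<close>). By the second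
  hypothesis on \<open>Y\<close>, two nearby points of \<open>A\<close> are joined inside a small part of \<open>A\<close>, and by local
  contractibility the loop formed with any other short path between them is filled nearby; so short
  paths can be pushed into \<open>A\<close> (\<open>edge_push_local\<close>). Finally, let \<open>V\<close> be as in the third hypothesis.
  If the boundary of a square in \<open>V\<close> is pushed within \<open>V\<close> into \<open>A\<close>, it becomes a loop that is
  null-homotopic in \<open>V\<close>; injectivity on \<open>\<pi>\<^sub>1\<close> fills it in \<open>A\<close>. The old square, the track of its
  boundary and the new square form a 2-sphere in \<open>V\<close>, which bounds because \<open>\<pi>\<^sub>2(V) = 0\<close>; the filling
  is a homotopy from the old square to the new one (\<open>cell_push_local\<close>).

  To globalise, subdivide the interval or the square so finely that each cell lands in one member of
  the cover. Push the vertices into \<open>A\<close>, then the edges, then the cells, keeping what is already in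
  \<open>A\<close> fixed on the boundary. The vertices and edges must be pushed inside the intersection of the
  open sets that belong to all adjacent cells; this is why points and paths have to be pushed inside
  arbitrary open sets. The outcome is that a path or a square in \<open>X\<close> whose boundary lies in \<open>A\<close> is
  homotopic relative to its boundary to one inside \<open>A\<close> (\<open>path_push_rel_ends\<close>,
  \<open>square_push_rel_boundary\<close>). The statement on paths gives injectivity on \<open>\<pi>\<^sub>0\<close> and surjectivity on
  \<open>\<pi>\<^sub>1\<close>. The statement on squares gives injectivity on \<open>\<pi>\<^sub>1\<close>, when applied to a homotopy of loops,
  and surjectivity on \<open>\<pi>\<^sub>2\<close>, when applied to a spheroid.
\<close>

section \<open>Collapsing the boundary of a cube to a point of a sphere\<close>

abbreviation cmap_on :: "'p::topological_space set \<Rightarrow> 'a topology \<Rightarrow> ('p \<Rightarrow> 'a) \<Rightarrow> bool" where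
  "cmap_on S X f \<equiv> continuous_map (top_of_set S) X f"

text \<open>
  A continuous surjection from a compact space to a Hausdorff space is a quotient map. Homotopies
  that are constant on the collapsed sets are turned into maps on balls by factoring them through
  such a surjection, which avoids continuity proofs at the collapsed points.
\<close>

lemma continuous_map_factor_through_compact:
  fixes q :: "'p::metric_space \<Rightarrow> 'q::metric_space"
  assumes "compact K" "continuous_on K q" "cmap_on K X N"
    and "\<And>x y. x \<in> K \<Longrightarrow> y \<in> K \<Longrightarrow> q x = q y \<Longrightarrow> N x = N y"
  obtains F where "cmap_on (q ` K) X F" "\<And>x. x \<in> K \<Longrightarrow> F (q x) = N x"
proof -
  have "quotient_map (top_of_set K) (top_of_set (q ` K)) q"
    using assms(1,2) Hausdorff_space_euclidean
    by (intro continuous_imp_quotient_map)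
       (auto simp: compact_space_subtopology intro!: Hausdorff_space_subtopology)
  from quotient_map_lift_exists[OF this assms(3)] assms(4) that show ?thesis
    by (metis topspace_euclidean_subtopology)
qed

text \<open>
  The cube with coordinates in \<open>[-1, 1]\<close>; the norm measures radial position, which is all that
  collapsing its boundary depends on.
\<close>

definition supball :: "'e::euclidean_space set" where
  "supball = {z. infnorm z \<le> 1}"

lemma supball_compact: "compact (supball :: 'e::euclidean_space set)"
proof -
  have "closed (supball :: 'e set)"
    unfolding supball_def by (intro closed_Collect_le continuous_intros)
  moreover have "bounded (supball :: 'e set)"
  proof -
    have "norm x \<le> sqrt DIM('e)" if "infnorm x \<le> 1" for x :: 'e
      using norm_le_infnorm[of x] that
      by (smt (verit) mult_left_le real_sqrt_ge_zero of_nat_0_le_iff)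
    then show ?thesis unfolding supball_def bounded_iff by blast
  qed
  ultimately show ?thesis by (simp add: compact_eq_bounded_closed)
qed

text \<open>
  Inverse stereographic projection applied to \<open>z / (1 - infnorm z)\<close>, which stretches the open cube
  over the whole of Euclidean space; multiplying numerator and denominator by \<open>(1 - infnorm z)\<^sup>2\<close>
  makes the formula continuous up to the boundary, where the value is the pole \<open>(0, 1)\<close>.
\<close>

definition collapse :: "'e::euclidean_space \<Rightarrow> 'e \<times> real" where
  "collapse z = (let \<beta> = 1 - infnorm z in
     (1 / ((norm z)\<^sup>2 + \<beta>\<^sup>2)) *\<^sub>R ((2 * \<beta>) *\<^sub>R z, (norm z)\<^sup>2 - \<beta>\<^sup>2))"

lemma collapse_denom_pos: "(norm z)\<^sup>2 + (1 - infnorm z)\<^sup>2 > 0" for z :: "'e::euclidean_space"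
  by (cases "z = 0") (auto simp: infnorm_0 add_pos_nonneg)

lemma continuous_on_collapse: "continuous_on S collapse"
  unfolding collapse_def Let_def
  by (intro continuous_intros) (use collapse_denom_pos in \<open>auto simp: less_le\<close>)

lemma norm_collapse: "norm (collapse z) = 1"
proof -
  define a b where "a = (norm z)\<^sup>2" and "b = (1 - infnorm z)\<^sup>2"
  have ab: "a + b > 0" using collapse_denom_pos[of z] by (simp add: a_def b_def)
  have "(norm ((2 * (1 - infnorm z)) *\<^sub>R z, (norm z)\<^sup>2 - (1 - infnorm z)\<^sup>2))\<^sup>2 = 4 * b * a + (a - b)\<^sup>2"
    by (simp add: norm_Pair a_def b_def power_mult_distrib) (simp add: power2_eq_square algebra_simps)
  also have "\<dots> = (a + b)\<^sup>2" by (simp add: power2_eq_square algebra_simps)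
  finally have "norm ((2 * (1 - infnorm z)) *\<^sub>R z, (norm z)\<^sup>2 - (1 - infnorm z)\<^sup>2) = a + b"
    using ab by (metis abs_of_pos norm_ge_zero power2_eq_iff_nonneg less_imp_le)
  then show ?thesis using ab
    unfolding collapse_def Let_def norm_scaleR a_def b_def by (simp del: scaleR_Pair add: infnorm_0)
qed

lemma collapse_boundary: "infnorm z = 1 \<Longrightarrow> collapse z = (0, 1)"
  by (auto simp: collapse_def Let_def infnorm_0)

lemma collapse_eq_pole_iff: "collapse z = (0,1) \<longleftrightarrow> infnorm z = 1"
proof
  assume "collapse z = (0,1)"
  then have "((norm z)\<^sup>2 - (1 - infnorm z)\<^sup>2) / ((norm z)\<^sup>2 + (1 - infnorm z)\<^sup>2) = 1"
    by (auto simp: collapse_def Let_def infnorm_0)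
  with collapse_denom_pos[of z] have "(1 - infnorm z)\<^sup>2 = 0"
    by (simp only: divide_eq_1_iff) (smt (verit))
  then show "infnorm z = 1" by simp
qed (rule collapse_boundary)

lemma collapse_stereographic:
  assumes "infnorm z \<noteq> 1" 
  shows "(1 / (1 - snd (collapse z))) *\<^sub>R fst (collapse z) = (1 / (1 - infnorm z)) *\<^sub>R z"
proof -
  define a b where "a = (norm z)\<^sup>2" and "b = 1 - infnorm z"
  have ab: "a + b^2 > 0" using collapse_denom_pos[of z] by (simp add: a_def b_def)
  have b: "b \<noteq> 0" using assms by (simp add: b_def)
  have "1 - snd (collapse z) = 2 * b^2 / (a + b^2)"
    using ab by (simp add: collapse_def Let_def a_def[symmetric] b_def[symmetric]) (simp add: field_simps)
  moreover have "fst (collapse z) = (2 * b / (a + b^2)) *\<^sub>R z"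
    by (simp add: collapse_def Let_def a_def b_def)
  ultimately show ?thesis using ab b
    by (simp add: b_def[symmetric]) (simp add: field_simps power2_eq_square)
qed

text \<open>
  By stereographic projection the images determine \<open>z / (1 - infnorm z)\<close>. This vector and \<open>z\<close>
  lie on the same ray, and the radial stretching is injective.
\<close>

lemma collapse_inj:
  assumes "z \<in> supball" "w \<in> supball" "collapse z = collapse w" "infnorm z \<noteq> 1"
  shows "z = w"
proof -
  have w: "infnorm w \<noteq> 1" using assms collapse_eq_pole_iff by metis
  define k l where "k = 1 / (1 - infnorm z)" and "l = 1 / (1 - infnorm w)"
  have pos: "k > 0" "l > 0" using assms w by (auto simp: k_def l_def supball_def)
  have eq: "k *\<^sub>R z = l *\<^sub>R w"
    using collapse_stereographic[OF assms(4)] collapse_stereographic[OF w] assms(3)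
    by (simp add: k_def l_def)
  then have "infnorm (k *\<^sub>R z) = infnorm (l *\<^sub>R w)" by simp
  then have "k * infnorm z = l * infnorm w" using pos by (simp add: infnorm_mul)
  moreover have "k * infnorm z = k - 1" "l * infnorm w = l - 1"
    using assms w by (auto simp: k_def l_def field_simps)
  ultimately have "k = l" by simp
  with eq pos show ?thesis by simp
qed

lemma collapse_surj:
  assumes "norm p = 1"
  obtains z :: "'e::euclidean_space" where "z \<in> supball" "collapse z = p"
proof (cases "snd p = 1")
  case True
  with assms have "p = (0,1)" 
    by (cases p) (simp add: norm_Pair)
  moreover obtain b :: 'e where b: "b \<in> Basis" using nonempty_Basis by blast
  then have "infnorm ((1 / infnorm b) *\<^sub>R b) = 1"
    using infnorm_pos_lt[of b] by (auto simp: infnorm_mul nonzero_Basis)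
  ultimately show ?thesis using that collapse_boundary by (metis (no_types, lifting) mem_Collect_eq order_refl supball_def)
next
  case False
  obtain u s where p: "p = (u, s)" by fastforce
  have us: "(norm u)^2 + s^2 = 1" using assms by (simp add: p norm_Pair)
  then have "s^2 \<le> 1" by (smt (verit) zero_le_power2)
  then have s: "s < 1" using False p by (simp add: abs_square_le_1)
  define w where "w = (1 / (1 - s)) *\<^sub>R u"
  have iw: "infnorm w \<ge> 0" by (rule infnorm_pos_le)
  \<comment> \<open>the inverse of the radial stretching\<close>
  define z where "z = (1 / (1 + infnorm w)) *\<^sub>R w"
  have iz: "infnorm z = infnorm w / (1 + infnorm w)" using iw by (simp add: z_def infnorm_mul)
  define c where "c = 1 / (1 + infnorm w)"
  have c: "c > 0" "1 - infnorm z = c" using iw by (auto simp: c_def iz field_simps)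
  have nz: "(norm z)\<^sup>2 = c^2 * (norm w)^2" using iw by (simp add: z_def c_def power_mult_distrib power_divide)
  have "(norm w)^2 = (norm u)^2 / (1-s)^2" by (simp add: w_def power_divide)
  also have "\<dots> = (1 - s^2) / (1-s)^2" using us by simp
  also have "\<dots> = (1+s)/(1-s)" using s by (simp add: divide_simps power2_eq_square) (simp add: algebra_simps)
  finally have nw: "(norm w)^2 = (1+s)/(1-s)" .
  have 1: "(norm z)\<^sup>2 + c\<^sup>2 = 2 * c^2 / (1-s)" using s by (simp add: nz nw field_simps)
  have 2: "(norm z)\<^sup>2 - c\<^sup>2 = 2 * c^2 * s / (1-s)" using s by (simp add: nz nw field_simps)
  have "collapse z = p"
    using s c(1) unfolding collapse_def Let_def c(2) 1 2 p
    by (simp add: z_def c_def[symmetric]) (simp add: w_def divide_simps power2_eq_square)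
  moreover have "z \<in> supball" using iw by (simp add: supball_def iz)
  ultimately show ?thesis using that by blast
qed

lemma ray_meets_sphere_once:
  fixes a b :: "'e::real_inner"
  assumes "norm b = 1" "norm (b + a) = 1" "norm (b + k *\<^sub>R a) = 1" "k \<noteq> 0" "a \<noteq> 0"
  shows "k = 1"
proof -
  have 1: "2 * (b \<bullet> a) + a \<bullet> a = 0" and 2: "2 * k * (b \<bullet> a) + k * k * (a \<bullet> a) = 0"
    using assms by (auto simp: norm_eq_1 inner_simps inner_commute algebra_simps)
  have "b \<bullet> a = - (a \<bullet> a) / 2" using 1 by linarith
  with 2 have "k * (k - 1) * (a \<bullet> a) = 0" by (simp add: algebra_simps)
  with assms show ?thesis by simp
qed

text \<open>
  The straight-line cone from the pole over the collapsed cube. It maps the cylinder over the cube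
  onto the ball and collapses the lid and the walls, which is where a null-homotopy relative to the
  boundary is constant.
\<close>

definition cone_collapse :: "'e::euclidean_space \<times> real \<Rightarrow> 'e \<times> real" where
  "cone_collapse = (\<lambda>(z, t). (1 - t) *\<^sub>R collapse z + t *\<^sub>R (0, 1))"

lemma continuous_on_cone_collapse: "continuous_on S cone_collapse"
proof -
  have "continuous_on S (\<lambda>x. (1 - snd x) *\<^sub>R collapse (fst x) + snd x *\<^sub>R (0, 1))"
    by (intro continuous_intros continuous_on_compose2[OF continuous_on_collapse[of UNIV]]) auto
  then show ?thesis by (simp add: cone_collapse_def case_prod_beta)
qed

text \<open>
  The ball is strictly convex, so a ray from the pole meets the sphere in only one further point. A
  point of the ball other than the pole therefore determines the sphere point on its ray and the
  cone parameter.
\<close>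

lemma cone_collapse_fibres:
  assumes "z \<in> supball" "w \<in> supball" "cone_collapse (z, t) = cone_collapse (w, s)"
  shows "(z, t) = (w, s) \<or> (t = 1 \<or> infnorm z = 1) \<and> (s = 1 \<or> infnorm w = 1)"
proof -
  define b :: "'a \<times> real" where "b = (0, 1)"
  have eq: "(1 - t) *\<^sub>R (collapse z - b) = (1 - s) *\<^sub>R (collapse w - b)"
  proof -
    have "(1 - r) *\<^sub>R (collapse v - b) = cone_collapse (v, r) - b" for v :: 'a and r
      unfolding cone_collapse_def b_def[symmetric] by (simp add: algebra_simps)
    then show ?thesis using assms(3) by simp
  qed
  have z: "(t = 1 \<or> infnorm z = 1) \<longleftrightarrow> (1 - t) *\<^sub>R (collapse z - b) = 0"
   and w: "(s = 1 \<or> infnorm w = 1) \<longleftrightarrow> (1 - s) *\<^sub>R (collapse w - b) = 0"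
    using collapse_eq_pole_iff by (auto simp: b_def)
  show ?thesis
  proof (cases "(1 - t) *\<^sub>R (collapse z - b) = 0")
    case True then show ?thesis using z w eq by auto
  next
    case False
    then have nz: "1 - t \<noteq> 0" "1 - s \<noteq> 0" "collapse z - b \<noteq> 0" using eq by auto
    define k where "k = (1 - t) / (1 - s)"
    have cw: "collapse w - b = k *\<^sub>R (collapse z - b)"
    proof -
      have "collapse w - b = (1 / (1 - s)) *\<^sub>R ((1 - s) *\<^sub>R (collapse w - b))" using nz by simp
      also have "\<dots> = k *\<^sub>R (collapse z - b)" unfolding eq[symmetric] by (simp add: k_def)
      finally show ?thesis .
    qed
    then have "b + k *\<^sub>R (collapse z - b) = collapse w" by (simp add: algebra_simps)
    moreover have "k \<noteq> 0" using nz by (simp add: k_def)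
    ultimately have "k = 1"
      using ray_meets_sphere_once[of b "collapse z - b" k] nz norm_collapse[of z] norm_collapse[of w]
      by (simp add: b_def norm_Pair)
    then have "t = s" "collapse z = collapse w" using nz cw by (auto simp: k_def field_simps)
    moreover have "infnorm z \<noteq> 1" using False z by simp
    ultimately show ?thesis using collapse_inj assms by blast
  qed
qed

lemma cone_collapse_image:
  "cone_collapse ` (supball \<times> {0..1}) = cball (0 :: 'e::euclidean_space \<times> real) 1"
proof
  have "norm ((1 - t) *\<^sub>R collapse z + t *\<^sub>R (0, 1)) \<le> 1" if "0 \<le> t" "t \<le> 1" for z :: 'e and t :: real
    using norm_triangle_ineq[of "(1 - t) *\<^sub>R collapse z" "t *\<^sub>R (0, 1)"] that
    by (simp add: norm_collapse norm_Pair del: scaleR_Pair)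
  then show "cone_collapse ` (supball \<times> {0..1}) \<subseteq> cball (0 :: 'e \<times> real) 1"
    by (auto simp: cone_collapse_def simp del: scaleR_Pair)
  show "cball (0 :: 'e \<times> real) 1 \<subseteq> cone_collapse ` (supball \<times> {0..1})"
  proof
    fix c :: "'e \<times> real" assume "c \<in> cball 0 1"
    then have c: "c \<bullet> c \<le> 1" using dot_square_norm[of c] by (simp add: power_le_one)
    define b :: "'e \<times> real" where "b = (0, 1)"
    have b: "b \<bullet> b = 1" by (simp add: b_def inner_Pair)
    show "c \<in> cone_collapse ` (supball \<times> {0..1})"
    proof (cases "c = b")
      case True
      obtain z :: 'e where "z \<in> supball" "collapse z = b" 
        using collapse_surj[of b] b norm_eq_1 by metis
      then show ?thesis
        using True by (intro image_eqI[of _ _ "(z, 1)"]) (simp_all add: cone_collapse_def b_def)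
    next
      case False
      define a where "a = c - b"
      have aa: "a \<bullet> a > 0" using False by (simp add: a_def)
      have ineq: "2 * (b \<bullet> a) + a \<bullet> a \<le> 0"
        using c b by (simp add: a_def inner_simps inner_commute algebra_simps)
      \<comment> \<open>the second intersection of the ray through \<open>c\<close> with the sphere\<close>
      define m where "m = - 2 * (b \<bullet> a) / (a \<bullet> a)"
      have m: "m \<ge> 1" using aa ineq by (simp add: m_def field_simps)
      have mm: "m * (a \<bullet> a) = - 2 * (b \<bullet> a)" using aa by (simp add: m_def)
      have "(b + m *\<^sub>R a) \<bullet> (b + m *\<^sub>R a) = 1 + 2 * m * (b \<bullet> a) + m * (m * (a \<bullet> a))"
        using b by (simp add: inner_simps inner_commute algebra_simps)
      also have "\<dots> = 1" unfolding mm by (simp add: algebra_simps)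
      finally have "norm (b + m *\<^sub>R a) = 1" by (simp add: norm_eq_1)
      then obtain z :: 'e where z: "z \<in> supball" "collapse z = b + m *\<^sub>R a" using collapse_surj by blast
      have "(1/m) *\<^sub>R (b + m *\<^sub>R a) + (1 - 1/m) *\<^sub>R b = c"
        using m by (simp add: a_def algebra_simps)
      then have "cone_collapse (z, 1 - 1/m) = c"
        by (simp add: cone_collapse_def z b_def del: scaleR_Pair)
      moreover have "(z, 1 - 1/m) \<in> supball \<times> {0..1}" using z m by auto
      ultimately show ?thesis by (metis imageI) 
    qed
  qed
qed

section \<open>Filling a map on the boundary of a convex body\<close>

lemma continuous_map_compose_eu:
  assumes "cmap_on T X f" "continuous_on S g" "g ` S \<subseteq> T"
  shows "cmap_on S X (\<lambda>x. f (g x))"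
proof -
  have "cmap_on S (top_of_set T) g" using assms by auto
  from continuous_map_compose[OF this assms(1)] show ?thesis by (simp add: o_def)
qed

text \<open>
  Stated with a target topology \<open>Z\<close>, so that the same boundary map can be filled in a small and in a
  large subspace.
\<close>

definition fillable :: "'f::euclidean_space set \<Rightarrow> 'a topology \<Rightarrow> ('f \<Rightarrow> 'a) \<Rightarrow> bool" where
  "fillable C Z \<phi> \<longleftrightarrow> (\<exists>F. cmap_on C Z F \<and> (\<forall>p\<in>frontier C. F p = \<phi> p))"

text \<open>
  The frontier of a convex body is homeomorphic to the sphere. The homeomorphism and its inverse
  extend to continuous maps between the body and the ball, because both targets are convex
  (Dugundji), and precomposition with these extensions carries fillings back and forth. The two
  extensions need not be inverse to each other.
\<close>

lemma fillable_transport: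
  fixes C :: "'f::euclidean_space set" and \<phi> :: "'f \<Rightarrow> 'a"
  assumes C: "convex C" "compact C" "interior C \<noteq> {}"
    and \<phi>: "cmap_on (frontier C) X \<phi>"
  obtains \<psi> :: "'f \<Rightarrow> 'a" where "cmap_on (sphere 0 1) X \<psi>"
    "\<And>Z :: 'a topology. fillable (cball 0 1) Z \<psi> \<longleftrightarrow> fillable C Z \<phi>"
proof -
  have "rel_frontier (cball (0::'f) 1) homeomorphic rel_frontier C"
    using C by (intro homeomorphic_rel_frontiers_convex_bounded_sets)
      (auto simp: compact_imp_bounded aff_dim_nonempty_interior)
  then have "sphere (0::'f) 1 homeomorphic frontier C"
    using C by (simp add: rel_frontier_nonempty_interior)
  then obtain f g where fg: "homeomorphism (sphere (0::'f) 1) (frontier C) f g"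
    unfolding homeomorphic_def by blast
  have clC: "closed C" using C compact_imp_closed by blast
  then have frC: "frontier C \<subseteq> C" using frontier_subset_closed by blast
  obtain f' where f': "continuous_on (cball 0 1) f'" "f' ` cball 0 1 \<subseteq> C" "\<And>x. x \<in> sphere 0 1 \<Longrightarrow> f' x = f x"
    by (rule Dugundji[of C "cball (0::'f) 1" "sphere 0 1" f])
       (use C fg frC in \<open>auto simp: homeomorphism_def closed_subset\<close>)
  obtain g' where g': "continuous_on C g'" "g' ` C \<subseteq> cball 0 1" "\<And>x. x \<in> frontier C \<Longrightarrow> g' x = g x"
    by (rule Dugundji[of "cball (0::'f) 1" C "frontier C" g])
       (use C fg frC in \<open>auto simp: homeomorphism_def closed_subset\<close>)
  let ?\<psi> = "\<lambda>x. \<phi> (f x)"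
  show ?thesis
  proof
    show "cmap_on (sphere 0 1) X ?\<psi>"
      using fg by (intro continuous_map_compose_eu[OF \<phi>]) (auto simp: homeomorphism_def)
    show "fillable (cball 0 1) Z ?\<psi> \<longleftrightarrow> fillable C Z \<phi>" for Z
    proof
      assume "fillable (cball 0 1) Z ?\<psi>"
      then obtain F where F: "cmap_on (cball 0 1) Z F" "\<And>p. p \<in> sphere 0 1 \<Longrightarrow> F p = \<phi> (f p)"
        by (auto simp: fillable_def)
      have "cmap_on C Z (\<lambda>x. F (g' x))"
        using g' by (intro continuous_map_compose_eu[OF F(1)])
      moreover have "F (g' p) = \<phi> p" if "p \<in> frontier C" for p
      proof -
        have "g p \<in> sphere 0 1" "f (g p) = p" using fg that by (auto simp: homeomorphism_def)
        then show ?thesis using F(2) g'(3) that by metis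
      qed
      ultimately show "fillable C Z \<phi>" unfolding fillable_def by blast
    next
      assume "fillable C Z \<phi>"
      then obtain F where F: "cmap_on C Z F" "\<And>p. p \<in> frontier C \<Longrightarrow> F p = \<phi> p"
        by (auto simp: fillable_def)
      have "cmap_on (cball 0 1) Z (\<lambda>x. F (f' x))"
        using f' by (intro continuous_map_compose_eu[OF F(1)])
      moreover have "F (f' p) = \<phi> (f p)" if "p \<in> sphere 0 1" for p
      proof -
        have "f p \<in> frontier C" using fg that by (auto simp: homeomorphism_def)
        then show ?thesis using F(2) f'(3) that by metis
      qed
      ultimately show "fillable (cball 0 1) Z ?\<psi>" unfolding fillable_def by auto
    qed
  qed
qed

text \<open>
  A contraction of the small space inside the large one fills every sphere: use the cone on the
  sphere, that is, polar coordinates.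
\<close>

lemma fillable_contract:
  fixes C :: "'f::euclidean_space set" and \<phi> :: "'f \<Rightarrow> 'a"
  assumes C: "convex C" "compact C" "interior C \<noteq> {}"
    and \<phi>: "cmap_on (frontier C) Z \<phi>"
    and c: "continuous_map (prod_topology Z (top_of_set {0..1})) Z' c"
      "\<And>v. v \<in> topspace Z \<Longrightarrow> c (v, 0) = v" "\<And>v. v \<in> topspace Z \<Longrightarrow> c (v, 1::real) = x0"
  shows "fillable C Z' \<phi>"
proof -
  obtain \<psi> :: "'f \<Rightarrow> 'a" where \<psi>: "cmap_on (sphere 0 1) Z \<psi>"
    and iff: "\<And>Z :: 'a topology. fillable (cball 0 1) Z \<psi> \<longleftrightarrow> fillable C Z \<phi>"
    using fillable_transport[OF C \<phi>] by metis
  define K where "K = sphere (0::'f) 1 \<times> {0..1::real}"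
  \<comment> \<open>polar coordinates; the only collapsed set is \<open>t = 1\<close>, where the contraction is constant\<close>
  define q where "q = (\<lambda>(s::'f, t::real). (1 - t) *\<^sub>R s)"
  have "cmap_on K (prod_topology Z (top_of_set {0..1})) (\<lambda>(s,t). (\<psi> s, t))"
    unfolding K_def case_prod_beta
    by (intro continuous_map_pairedI continuous_map_compose_eu[OF \<psi>])
       (auto intro!: continuous_intros simp: continuous_on_fst continuous_on_snd)
  from continuous_map_compose[OF this c(1)]
  have N: "cmap_on K Z' (\<lambda>(s,t). c (\<psi> s, t))" unfolding o_def case_prod_beta by simp
  have \<psi>Z: "\<psi> s \<in> topspace Z" if "s \<in> sphere 0 1" for s
    using continuous_map_image_subset_topspace[OF \<psi>] that by auto
  obtain F where F: "cmap_on (q ` K) Z' F" "\<And>x. x \<in> K \<Longrightarrow> F (q x) = (\<lambda>(s,t). c (\<psi> s, t)) x"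
  proof (rule continuous_map_factor_through_compact[OF _ _ N])
    show "compact K" unfolding K_def by (intro compact_Times) auto
    show "continuous_on K q" unfolding q_def case_prod_beta by (intro continuous_intros)
    fix x y assume xy: "x \<in> K" "y \<in> K" "q x = q y"
    obtain s t s' t' where [simp]: "x = (s,t)" "y = (s',t')" by fastforce
    have st: "norm s = 1" "norm s' = 1" "0 \<le> t" "t \<le> 1" "0 \<le> t'" "t' \<le> 1" "(1 - t) *\<^sub>R s = (1 - t') *\<^sub>R s'"
      using xy by (auto simp: K_def q_def)
    then have "\<bar>1 - t\<bar> * norm s = \<bar>1 - t'\<bar> * norm s'" by (metis norm_scaleR)
    then have tt: "t = t'" using st by simp
    show "(\<lambda>(s,t). c (\<psi> s, t)) x = (\<lambda>(s,t). c (\<psi> s, t)) y"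
    proof (cases "t = 1")
      case True then show ?thesis using tt st c(3) \<psi>Z by simp
    next
      case False then show ?thesis using tt st by simp
    qed
  qed auto
  have img: "cball 0 1 \<subseteq> q ` K"
  proof
    fix x :: 'f assume x: "x \<in> cball 0 1"
    show "x \<in> q ` K"
    proof (cases "x = 0")
      case True
      obtain b :: 'f where "b \<in> Basis" using nonempty_Basis by blast
      then show ?thesis using True by (intro image_eqI[of _ _ "(b, 1)"]) (auto simp: q_def K_def)
    next
      case False
      then show ?thesis using x
        by (intro image_eqI[of _ _ "((1 / norm x) *\<^sub>R x, 1 - norm x)"]) (auto simp: q_def K_def)
    qed
  qed
  have "cmap_on (cball 0 1) Z' F"
    using continuous_map_from_subtopology_mono[OF F(1) img] .
  moreover have "F p = \<psi> p" if "p \<in> sphere 0 1" for p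
    using F(2)[of "(p, 0)"] that c(2) \<psi>Z by (simp add: K_def q_def)
  ultimately have "fillable (cball 0 1) Z' \<psi>" unfolding fillable_def by auto
  then show ?thesis using iff by blast
qed

lemma cone_collapse_ends: "cone_collapse (z, 0) = collapse z" "cone_collapse (z, 1) = (0, 1)"
  by (simp_all add: cone_collapse_def flip: zero_prod_def)

abbreviation cylinder :: "nat \<Rightarrow> (real \<times> (nat \<Rightarrow> real)) topology" where
  "cylinder n \<equiv> prod_topology (top_of_set {0..1}) (cube n)"

text \<open>
  Identifies the extensional functions of the cube with a Euclidean cube in a type \<open>'e\<close>, so that
  one argument serves \<open>\<pi>\<^sub>1\<close> and \<open>\<pi>\<^sub>2\<close>.
\<close>

definition cube_chart :: "nat \<Rightarrow> ((nat \<Rightarrow> real) \<Rightarrow> 'e::euclidean_space) \<Rightarrow> ('e \<Rightarrow> nat \<Rightarrow> real) \<Rightarrow> bool" where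
  "cube_chart n j k \<longleftrightarrow>
     continuous_map (cube n) (top_of_set supball) j \<and> cmap_on supball (cube n) k \<and>
     (\<forall>z\<in>supball. j (k z) = z) \<and>
     (\<forall>t\<in>topspace (cube n). t \<in> cube_boundary n \<longleftrightarrow> infnorm (j t) = 1)"

text \<open>
  The dictionary between spheroids and spheres. A null-homotopy of the spheroid is a map on the
  cylinder that is constant on its lid and walls, hence factors through the cone onto the ball.
  Conversely a filling of the sphere is composed with the cone.
\<close>

lemma spheroid_null_iff_fillable:
  fixes j :: "(nat \<Rightarrow> real) \<Rightarrow> 'e::euclidean_space" and \<phi> :: "'e \<times> real \<Rightarrow> 'a"
  assumes jk: "cube_chart n j k" and \<phi>: "cmap_on (sphere 0 1) Z \<phi>"
  defines "\<sigma> \<equiv> \<lambda>t. \<phi> (collapse (j t))"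
  shows "\<sigma> \<in> spheroids n Z (\<phi> (0,1))"
    and "(\<sigma>, \<lambda>_. \<phi> (0,1)) \<in> spheroid_homotopic n Z (\<phi> (0,1)) \<longleftrightarrow> fillable (cball 0 1) Z \<phi>"
proof -
  let ?x = "\<phi> (0,1)"
  have j: "continuous_map (cube n) (top_of_set supball) j" and k: "cmap_on supball (cube n) k"
    and jk': "\<And>z. z \<in> supball \<Longrightarrow> j (k z) = z"
    and bd: "\<And>t. t \<in> topspace (cube n) \<Longrightarrow> t \<in> cube_boundary n \<longleftrightarrow> infnorm (j t) = 1"
    using jk by (auto simp: cube_chart_def)
  have jS: "j t \<in> supball" if "t \<in> topspace (cube n)" for t
    using continuous_map_image_subset_topspace[OF j] that by auto
  have kS: "k z \<in> topspace (cube n)" if "z \<in> supball" for z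
    using continuous_map_image_subset_topspace[OF k] that by auto
  have bdc: "cube_boundary n \<subseteq> topspace (cube n)" by (auto simp: cube_boundary_def)
  have "cmap_on supball Z (\<lambda>z. \<phi> (collapse z))"
    by (intro continuous_map_compose_eu[OF \<phi>] continuous_on_collapse) (auto simp: norm_collapse)
  from continuous_map_compose[OF j this] have \<sigma>c: "continuous_map (cube n) Z \<sigma>"
    by (simp add: \<sigma>_def o_def)
  have \<sigma>b: "\<sigma> t = ?x" if "t \<in> cube_boundary n" for t
    using that bd bdc collapse_boundary unfolding \<sigma>_def by (metis subsetD)
  show sph: "\<sigma> \<in> spheroids n Z ?x"
    using \<sigma>c \<sigma>b by (auto simp: spheroids_def)
  have xZ: "?x \<in> topspace Z"
    using continuous_map_image_subset_topspace[OF \<phi>] by (auto simp: norm_Pair image_subset_iff)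
  then have csph: "(\<lambda>_. ?x) \<in> spheroids n Z ?x" by (auto simp: spheroids_def)
  show "(\<sigma>, \<lambda>_. ?x) \<in> spheroid_homotopic n Z ?x \<longleftrightarrow> fillable (cball 0 1) Z \<phi>" (is "?L \<longleftrightarrow> ?R")
  proof
    assume ?L
    then obtain h where h: "continuous_map (cylinder n) Z h"
      and h0: "\<And>x. h (0::real, x) = \<sigma> x" and h1: "\<And>x. h (1, x) = ?x"
      and hb: "\<And>t x. t \<in> {0..1} \<Longrightarrow> x \<in> cube_boundary n \<Longrightarrow> h (t, x) = ?x"
      unfolding spheroid_homotopic_def homotopic_with_def by (auto simp: image_subset_iff)
    define K where "K = (supball :: 'e set) \<times> {0..1::real}"
    have "cmap_on K (top_of_set {0..1}) snd"
      "cmap_on K (top_of_set supball) fst"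
      by (auto simp: K_def intro!: continuous_intros)
    from continuous_map_compose[OF this(2) k] this(1)
    have "cmap_on K (cylinder n) (\<lambda>p. (snd p, k (fst p)))"
      by (intro continuous_map_pairedI) (simp_all add: o_def)
    from continuous_map_compose[OF this h]
    have N: "cmap_on K Z (\<lambda>p. h (snd p, k (fst p)))" by (simp add: o_def)
    obtain F where F: "cmap_on (cone_collapse ` K) Z F"
      "\<And>x. x \<in> K \<Longrightarrow> F (cone_collapse x) = h (snd x, k (fst x))"
    proof (rule continuous_map_factor_through_compact[OF _ _ N])
      show "compact K" unfolding K_def by (intro compact_Times supball_compact) auto
      show "continuous_on K (cone_collapse :: 'e \<times> real \<Rightarrow> _)" by (rule continuous_on_cone_collapse)
      fix p p' assume p: "p \<in> K" "p' \<in> K" "cone_collapse p = cone_collapse p'"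
      have const: "h (snd p, k (fst p)) = ?x" if "snd p = 1 \<or> infnorm (fst p) = 1" "p \<in> K" for p
      proof -
        have p: "fst p \<in> supball" "snd p \<in> {0..1}" using that(2) by (auto simp: K_def)
        then have "infnorm (fst p) = 1 \<Longrightarrow> k (fst p) \<in> cube_boundary n" using bd[OF kS[OF p(1)]] jk' by simp
        then show ?thesis using that(1) h1 hb[OF p(2)] by auto
      qed
      have "fst p \<in> supball" "fst p' \<in> supball" using p by (auto simp: K_def)
      from cone_collapse_fibres[OF this, of "snd p" "snd p'"]
      have "p = p' \<or> (snd p = 1 \<or> infnorm (fst p) = 1) \<and> (snd p' = 1 \<or> infnorm (fst p') = 1)"
        using p(3) by simp
      then show "h (snd p, k (fst p)) = h (snd p', k (fst p'))"
        using const p by metis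
    qed auto
    have "F p = \<phi> p" if p: "p \<in> sphere 0 1" for p
    proof -
      obtain z :: 'e where z: "z \<in> supball" "collapse z = p" using collapse_surj[of p] p by auto
      have "F (cone_collapse (z, 0)) = h (0, k z)" using F(2)[of "(z,0)"] z by (simp add: K_def)
      then show ?thesis using z jk' by (simp add: cone_collapse_ends h0 \<sigma>_def)
    qed
    then show ?R using F(1) unfolding fillable_def K_def cone_collapse_image by auto
  next
    assume ?R
    then obtain F where F: "cmap_on (cball 0 1) Z F" "\<And>p. p \<in> sphere 0 1 \<Longrightarrow> F p = \<phi> p"
      by (auto simp: fillable_def)
    have "cmap_on (supball \<times> {0..1}) Z (\<lambda>x. F (cone_collapse x))"
      by (intro continuous_map_compose_eu[OF F(1)] continuous_on_cone_collapse) (simp add: cone_collapse_image)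
    then have 1: "continuous_map (prod_topology (top_of_set supball) (top_of_set {0..1})) Z (\<lambda>x. F (cone_collapse x))"
      by simp
    have "continuous_map (cylinder n) (prod_topology (top_of_set supball) (top_of_set {0..1}))
       (\<lambda>p. (j (snd p), fst p))"
      by (intro continuous_map_pairedI continuous_map_fst continuous_map_compose[OF continuous_map_snd j, unfolded o_def])
    from continuous_map_compose[OF this 1]
    have c: "continuous_map (cylinder n) Z (\<lambda>p. F (cone_collapse (j (snd p), fst p)))"
      by (simp add: o_def)
    have s: "(\<lambda>_. ?x) = (\<lambda>x. F (cone_collapse (j x, 1)))" 
      by (simp add: F(2) cone_collapse_ends norm_Pair)
    have s0: "\<sigma> = (\<lambda>x. F (cone_collapse (j x, 0)))"
      unfolding \<sigma>_def by (rule ext) (simp add: F(2) cone_collapse_ends norm_collapse)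
    have "cone_collapse (j x, t) = (0, 1)" if "x \<in> cube_boundary n" for x t
    proof -
      have "infnorm (j x) = 1" using bd bdc that by auto
      then show ?thesis by (auto simp: cone_collapse_def collapse_boundary)
    qed
    then have b: "F (cone_collapse (j x, t)) = ?x" if "x \<in> cube_boundary n" for x t
      using that F(2)[of "(0,1)"] by (simp add: norm_Pair)
    have "homotopic_with (\<lambda>k. k ` cube_boundary n \<subseteq> {?x}) (cube n) Z \<sigma> (\<lambda>_. ?x)"
      unfolding homotopic_with_def
      by (rule exI[of _ "\<lambda>p. F (cone_collapse (j (snd p), fst p))"])
         (use c s s0 b in \<open>auto simp: fun_eq_iff\<close>)
    then show ?L using sph csph by (auto simp: spheroid_homotopic_def)
  qed
qed

text \<open>
  Injectivity of the map on homotopy groups in the form in which it is used: a sphere in \<open>Z'\<close> that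
  can be filled in \<open>Z\<close> can be filled in \<open>Z'\<close>.
\<close>

lemma fillable_if_null_implies_null:
  fixes j :: "(nat \<Rightarrow> real) \<Rightarrow> 'e::euclidean_space" and C :: "('e \<times> real) set" and \<phi> :: "'e \<times> real \<Rightarrow> 'a"
  assumes jk: "cube_chart n j k"
    and C: "convex C" "compact C" "interior C \<noteq> {}"
    and \<phi>: "cmap_on (frontier C) Z' \<phi>" "cmap_on (frontier C) Z \<phi>"
    and null: "\<And>v \<sigma>. v \<in> topspace Z' \<Longrightarrow> \<sigma> \<in> spheroids n Z' v \<Longrightarrow> (\<sigma>, \<lambda>_. v) \<in> spheroid_homotopic n Z v
                    \<Longrightarrow> (\<sigma>, \<lambda>_. v) \<in> spheroid_homotopic n Z' v"
    and fill: "fillable C Z \<phi>"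
  shows "fillable C Z' \<phi>"
proof -
  obtain \<psi> :: "'e \<times> real \<Rightarrow> 'a" where \<psi>': "cmap_on (sphere 0 1) Z' \<psi>"
    and iff: "\<And>Z :: 'a topology. fillable (cball 0 1) Z \<psi> \<longleftrightarrow> fillable C Z \<phi>"
    by (rule fillable_transport[OF C \<phi>(1)]) (rule that)
  obtain F where F: "cmap_on (cball 0 1) Z F" "\<And>p. p \<in> sphere 0 1 \<Longrightarrow> F p = \<psi> p"
    using fill unfolding iff[symmetric] by (auto simp: fillable_def)
  have "cmap_on (sphere 0 1) Z F"
    by (rule continuous_map_from_subtopology_mono[OF F(1)]) auto
  then have \<psi>: "cmap_on (sphere 0 1) Z \<psi>"
    using F(2) by (rule continuous_map_eq) auto
  have v: "\<psi> (0,1) \<in> topspace Z'"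
    using continuous_map_image_subset_topspace[OF \<psi>'] by (auto simp: norm_Pair image_subset_iff)
  have "fillable (cball 0 1) Z \<psi>" using fill unfolding iff .
  then have "fillable (cball 0 1) Z' \<psi>"
    unfolding spheroid_null_iff_fillable(2)[OF jk \<psi>, symmetric] spheroid_null_iff_fillable(2)[OF jk \<psi>', symmetric]
    by (rule null[OF v spheroid_null_iff_fillable(1)[OF jk \<psi>']])
  then show ?thesis unfolding iff .
qed

lemma fillable_if_trivial:
  fixes j :: "(nat \<Rightarrow> real) \<Rightarrow> 'e::euclidean_space" and C :: "('e \<times> real) set" and \<phi> :: "'e \<times> real \<Rightarrow> 'a"
  assumes jk: "cube_chart n j k"
    and C: "convex C" "compact C" "interior C \<noteq> {}"
    and \<phi>: "cmap_on (frontier C) Z \<phi>"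
    and null: "\<And>v \<sigma>. v \<in> topspace Z \<Longrightarrow> \<sigma> \<in> spheroids n Z v \<Longrightarrow> (\<sigma>, \<lambda>_. v) \<in> spheroid_homotopic n Z v"
  shows "fillable C Z \<phi>"
proof -
  show ?thesis
  proof (rule fillable_transport[OF C \<phi>])
    fix \<psi> :: "'e \<times> real \<Rightarrow> 'a"
    assume \<psi>: "cmap_on (sphere 0 1) Z \<psi>"
      and iff: "\<And>Z :: 'a topology. fillable (cball 0 1) Z \<psi> \<longleftrightarrow> fillable C Z \<phi>"
    have v: "\<psi> (0,1) \<in> topspace Z"
      using continuous_map_image_subset_topspace[OF \<psi>] by (auto simp: norm_Pair image_subset_iff)
    have "fillable (cball 0 1) Z \<psi>"
      unfolding spheroid_null_iff_fillable(2)[OF jk \<psi>, symmetric]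
      by (rule null[OF v spheroid_null_iff_fillable(1)[OF jk \<psi>]])
    then show ?thesis unfolding iff .
  qed
qed

lemma infnorm_real: "infnorm (x::real) = \<bar>x\<bar>"
  by (simp add: infnorm_Max)

lemma infnorm_real2: "infnorm (x::real \<times> real) = max \<bar>fst x\<bar> \<bar>snd x\<bar>"
  by (cases x) (simp add: infnorm_Max Basis_prod_def image_Un image_image)

lemma topspace_cube: "topspace (cube n) = {..<n} \<rightarrow>\<^sub>E {0..1}"
  by (simp add: cube_def)

lemma continuous_map_cube_coord: "i < n \<Longrightarrow> continuous_map (cube n) euclideanreal (\<lambda>t. t i)"
  unfolding cube_def
  by (rule continuous_map_into_fulltopology[of _ _ "{0..1}"], rule continuous_map_product_projection) simp

lemma continuous_map_into_cube:
  "continuous_map Z (cube n) (\<lambda>z. \<lambda>i\<in>{..<n}. f i z) \<longleftrightarrow> (\<forall>i<n. continuous_map Z (top_of_set {0..1}) (f i))"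
  unfolding cube_def continuous_map_componentwise
  by (auto simp: restrict_extensional image_subset_iff)

lemma cube_chart_1: "cube_chart 1 (\<lambda>t. 2 * t 0 - 1 :: real) (\<lambda>z. \<lambda>i\<in>{..<1}. (z + 1) / 2)"
proof -
  have "continuous_map (cube 1) euclideanreal (\<lambda>t. 2 * t 0 - 1)"
    by (intro continuous_intros continuous_map_cube_coord) auto
  then have "continuous_map (cube 1) (top_of_set supball) (\<lambda>t. 2 * t 0 - 1 :: real)"
    by (auto simp: continuous_map_in_subtopology supball_def infnorm_real topspace_cube PiE_iff abs_le_iff)
  moreover have "cmap_on supball (cube 1) (\<lambda>z::real. \<lambda>i\<in>{..<1}. (z + 1) / 2)"
    unfolding continuous_map_into_cube
    by (auto intro!: continuous_intros simp: supball_def infnorm_real)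
  moreover have "t \<in> cube_boundary 1 \<longleftrightarrow> infnorm (2 * t 0 - 1 :: real) = 1" if "t \<in> topspace (cube 1)" for t
  proof -
    have "0 \<le> t 0" "t 0 \<le> 1" using that by (auto simp: topspace_cube PiE_iff)
    then show ?thesis using that by (auto simp: cube_boundary_def infnorm_real abs_if)
  qed
  ultimately show ?thesis unfolding cube_chart_def by (simp add: add_divide_distrib)
qed

lemma cube_chart_2:
  "cube_chart 2 (\<lambda>t. (2 * t 0 - 1, 2 * t 1 - 1) :: real \<times> real)
     (\<lambda>z. \<lambda>i\<in>{..<2}. ((if i = 0 then fst z else snd z) + 1) / 2)"
proof -
  have t: "0 \<le> t i \<and> t i \<le> 1" if "t \<in> topspace (cube 2)" "i < 2" for t i
    using that by (auto simp: topspace_cube PiE_iff)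
  have box: "\<bar>2 * t 0 - 1\<bar> \<le> 1" "\<bar>2 * t 1 - 1\<bar> \<le> 1" if "t \<in> topspace (cube 2)" for t
    using t[OF that, of 0] t[OF that, of 1] by auto
  have "continuous_map (cube 2) (prod_topology euclideanreal euclideanreal) (\<lambda>t. (2 * t 0 - 1, 2 * t 1 - 1))"
    by (intro continuous_map_pairedI continuous_intros continuous_map_cube_coord) auto
  then have 1: "continuous_map (cube 2) (top_of_set supball) (\<lambda>t. (2 * t 0 - 1, 2 * t 1 - 1) :: real \<times> real)"
    using box unfolding continuous_map_in_subtopology supball_def infnorm_real2 by fastforce
  have "cmap_on supball (top_of_set {0..1})
          (\<lambda>z::real\<times>real. ((if i = 0 then fst z else snd z) + 1) / 2)" for i :: nat
  proof (cases "i = 0")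
    case True
    then show ?thesis by (simp add: supball_def infnorm_real2 image_subset_iff Pi_iff) (intro conjI continuous_intros, auto)
  next
    case False
    then show ?thesis by (simp add: supball_def infnorm_real2 image_subset_iff Pi_iff) (intro conjI continuous_intros, auto)
  qed
  then have 2: "cmap_on supball (cube 2)
     (\<lambda>z::real\<times>real. \<lambda>i\<in>{..<2}. ((if i = 0 then fst z else snd z) + 1) / 2)"
    unfolding continuous_map_into_cube by blast
  have 3: "t \<in> cube_boundary 2 \<longleftrightarrow> infnorm (2 * t 0 - 1, 2 * t 1 - 1) = 1" if "t \<in> topspace (cube 2)" for t
  proof -
    have "t \<in> cube_boundary 2 \<longleftrightarrow> t 0 = 0 \<or> t 0 = 1 \<or> t 1 = 0 \<or> t 1 = 1"
      using that by (auto simp: cube_boundary_def less_2_cases_iff)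
    also have "\<dots> \<longleftrightarrow> max \<bar>2 * t 0 - 1\<bar> \<bar>2 * t 1 - 1\<bar> = 1"
    proof -
      have "a = 0 \<or> a = 1 \<or> b = 0 \<or> b = 1 \<longleftrightarrow> max \<bar>2 * a - 1\<bar> \<bar>2 * b - 1\<bar> = 1"
        if "0 \<le> a" "a \<le> 1" "0 \<le> b" "b \<le> 1" for a b :: real
        using that by linarith
      then show ?thesis using t[OF that, of 0] t[OF that, of 1] by simp
    qed
    finally show ?thesis by (simp add: infnorm_real2)
  qed
  have 4: "(2 * (\<lambda>i\<in>{..<2::nat}. ((if i = 0 then fst z else snd z) + 1) / 2) 0 - 1,
      2 * (\<lambda>i\<in>{..<2::nat}. ((if i = 0 then fst z else snd z) + 1) / 2) 1 - 1) = z" for z :: "real \<times> real"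
    by (simp add: prod_eq_iff add_divide_distrib)
  show ?thesis unfolding cube_chart_def by (intro conjI ballI 1 2 3 4)
qed

section \<open>Gluing and subdividing\<close>

lemma continuous_map_into_larger:
  "continuous_map Z (subtopology X V) f \<Longrightarrow> V \<subseteq> W \<Longrightarrow> continuous_map Z (subtopology X W) f"
  by (auto simp: continuous_map_in_subtopology)

lemma continuous_map_on_finite_closed_Union:
  fixes T :: "'i \<Rightarrow> 'p::topological_space set"
  assumes "finite I" "\<And>i. i \<in> I \<Longrightarrow> closed (T i)" "\<And>i. i \<in> I \<Longrightarrow> cmap_on (T i) X g"
  shows "cmap_on (\<Union>i\<in>I. T i) X g"
proof (rule pasting_lemma_closed[where I = I and T = T and f = "\<lambda>_. g"])
  show "closedin (top_of_set (\<Union>i\<in>I. T i)) (T i)" if "i \<in> I" for i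
    using that assms(2) by (intro closed_subset) auto
  show "continuous_map (subtopology (top_of_set (\<Union>i\<in>I. T i)) (T i)) X g" if "i \<in> I" for i
  proof -
    have "(\<Union>i\<in>I. T i) \<inter> T i = T i" using that by blast
    then show ?thesis using assms(3)[OF that] by (simp add: subtopology_subtopology)
  qed
qed (use assms in auto)

lemma glue_finite_closed:
  fixes T :: "'i \<Rightarrow> 'p::topological_space set"
  assumes "finite I" "\<And>i. i \<in> I \<Longrightarrow> closed (T i)" "\<And>i. i \<in> I \<Longrightarrow> cmap_on (T i) X (f i)"
    and "\<And>i j x. i \<in> I \<Longrightarrow> j \<in> I \<Longrightarrow> x \<in> T i \<Longrightarrow> x \<in> T j \<Longrightarrow> f i x = f j x"
  obtains g where "cmap_on (\<Union>i\<in>I. T i) X g" "\<And>i x. i \<in> I \<Longrightarrow> x \<in> T i \<Longrightarrow> g x = f i x"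
proof -
  define g where "g x = f (SOME i. i \<in> I \<and> x \<in> T i) x" for x
  have g: "g x = f i x" if "i \<in> I" "x \<in> T i" for i x
  proof -
    have "(SOME i. i \<in> I \<and> x \<in> T i) \<in> I \<and> x \<in> T (SOME i. i \<in> I \<and> x \<in> T i)"
      by (rule someI[where P = "\<lambda>i. i \<in> I \<and> x \<in> T i"]) (use that in blast)
    then show ?thesis unfolding g_def using assms(4) that by blast
  qed
  have "cmap_on (T i) X g" if "i \<in> I" for i
    using assms(3)[OF that] by (rule continuous_map_eq) (use g that in auto)
  then have "cmap_on (\<Union>i\<in>I. T i) X g"
    by (intro continuous_map_on_finite_closed_Union assms(1,2))
  then show ?thesis using g that by blast
qed

lemma continuous_map_Un_closed:
  fixes S T :: "'p::topological_space set"
  assumes "closed S" "closed T" "cmap_on S X g" "cmap_on T X g"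
  shows "cmap_on (S \<union> T) X g"
  using continuous_map_on_finite_closed_Union[of "{True, False}" "\<lambda>b. if b then S else T" X g] assms
  by (simp add: Un_commute)

text \<open>
  A Lebesgue number for the preimages of the cover; it is stated with balls because the cells of a
  grid lie in small balls about their corners.
\<close>

lemma Lebesgue_number_of_map:
  fixes f :: "'p::metric_space \<Rightarrow> 'a"
  assumes "compact S" and f: "cmap_on S X f"
    and cov: "\<And>x. x \<in> S \<Longrightarrow> \<exists>U\<in>\<U>. openin X U \<and> f x \<in> U"
  obtains \<delta> where "\<delta> > 0" "\<And>x. x \<in> S \<Longrightarrow> \<exists>U\<in>\<U>. openin X U \<and> f ` (S \<inter> ball x \<delta>) \<subseteq> U"
proof -
  define \<G> where "\<G> = {G. open G \<and> (\<exists>U\<in>\<U>. openin X U \<and> f ` (S \<inter> G) \<subseteq> U)}"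
  have "\<exists>G\<in>\<G>. x \<in> G" if x: "x \<in> S" for x
  proof -
    obtain U where U: "U \<in> \<U>" "openin X U" "f x \<in> U" using cov[OF x] by blast
    have "openin (top_of_set S) {y \<in> S. f y \<in> U}"
      using openin_continuous_map_preimage[OF f U(2)] by simp
    then obtain G where G: "open G" "{y \<in> S. f y \<in> U} = S \<inter> G" by (auto simp: openin_open)
    then have "G \<in> \<G>" unfolding \<G>_def using U by blast
    moreover have "x \<in> G" using G(2) x U by blast
    ultimately show ?thesis by blast
  qed
  then have "S \<subseteq> \<Union>\<G>" by blast
  moreover have "\<And>G. G \<in> \<G> \<Longrightarrow> open G" by (simp add: \<G>_def)
  ultimately obtain e where e: "e > 0" "\<And>x. x \<in> S \<Longrightarrow> \<exists>G\<in>\<G>. ball x e \<subseteq> G"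
    using Heine_Borel_lemma[OF \<open>compact S\<close>, of \<G>] by metis
  show ?thesis
  proof
    show "e > 0" by fact
    fix x assume "x \<in> S"
    then obtain G where "G \<in> \<G>" "ball x e \<subseteq> G" using e by blast
    then show "\<exists>U\<in>\<U>. openin X U \<and> f ` (S \<inter> ball x e) \<subseteq> U" unfolding \<G>_def by blast
  qed
qed

lemma unit_interval_grid_cover:
  fixes x :: real
  assumes "0 < n" "x \<in> {0..1}"
  shows "\<exists>i<n. x \<in> {real i / n .. (real i + 1) / n}"
proof (cases "x = 1")
  case True
  then show ?thesis using assms by (intro exI[of _ "n - 1"]) auto
next
  case False
  then have s: "0 \<le> x * n" "x * n < n" using assms by auto
  then have "nat \<lfloor>x * n\<rfloor> < n" by linarith
  moreover have "x \<in> {real (nat \<lfloor>x * n\<rfloor>) / n .. (real (nat \<lfloor>x * n\<rfloor>) + 1) / n}"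
    using s assms(1) by (simp add: field_simps) linarith
  ultimately show ?thesis by blast
qed

section \<open>Pushing points and paths off the removed set\<close>

text \<open>
  A path \<open>p\<close> together with tracks \<open>q0\<close> and \<open>q1\<close> along which its two ends escape into \<open>A\<close>.
\<close>

definition edge_data :: "'a topology \<Rightarrow> 'a set \<Rightarrow> 'a set \<Rightarrow> real \<Rightarrow> real \<Rightarrow> (real \<Rightarrow> 'a) \<Rightarrow> (real \<Rightarrow> 'a) \<Rightarrow> (real \<Rightarrow> 'a) \<Rightarrow> bool" where
  "edge_data X A V a b p q0 q1 \<longleftrightarrow> a < b \<and>
     cmap_on {a..b} (subtopology X V) p \<and>
     cmap_on {0..1} (subtopology X V) q0 \<and>
     cmap_on {0..1} (subtopology X V) q1 \<and>
     q0 0 = p a \<and> q1 0 = p b \<and> q0 1 \<in> A \<and> q1 1 \<in> A"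

text \<open>
  A homotopy that moves the whole path into \<open>A\<close> while its ends follow the given tracks.
\<close>

definition edge_push :: "'a topology \<Rightarrow> 'a set \<Rightarrow> 'a set \<Rightarrow> real \<Rightarrow> real \<Rightarrow> (real \<Rightarrow> 'a) \<Rightarrow> (real \<Rightarrow> 'a) \<Rightarrow> (real \<Rightarrow> 'a) \<Rightarrow> (real \<times> real \<Rightarrow> 'a) \<Rightarrow> bool" where
  "edge_push X A W a b p q0 q1 H \<longleftrightarrow>
     cmap_on ({a..b} \<times> {0..1}) (subtopology X W) H \<and>
     (\<forall>s\<in>{a..b}. H (s, 0) = p s \<and> H (s, 1) \<in> A) \<and> (\<forall>t\<in>{0..1}. H (a, t) = q0 t \<and> H (b, t) = q1 t)"

lemma frontier_rectangle:
  fixes a b :: real assumes "a < b"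
  shows "frontier ({a..b} \<times> {0..1::real}) =
     ({a..b} \<times> {0} \<union> {a..b} \<times> {1}) \<union> ({a} \<times> {0..1} \<union> {b} \<times> {0..1})"
proof -
  have "{a..b} \<times> {0..1} = cbox (a, 0) (b, 1::real)" by (simp add: cbox_Pair_eq)
  then have "frontier ({a..b} \<times> {0..1::real}) = cbox (a, 0) (b, 1) - box (a, 0) (b, 1)"
    by (simp add: frontier_cbox)
  also have "\<dots> = {a..b} \<times> {0..1} - {a<..<b} \<times> {0<..<1}"
    by (auto simp: cbox_Pair_eq box_def Basis_prod_def)
  finally show ?thesis using assms by fastforce
qed

text \<open>
  The part of the hypotheses that makes the pair 0-connected and 1-connected inside every open set.
  In the last assumption the connecting path may leave \<open>V\<close>, so that it can also be verified at
  points of \<open>A\<close>, where only local contractibility is at hand.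
\<close>

locale thin_complement =
  fixes X :: "'a topology" and A :: "'a set"
  assumes A_open: "openin X A"
    and dense: "openin X W \<Longrightarrow> W \<noteq> {} \<Longrightarrow> W \<inter> A \<noteq> {}"
    and contractible: "openin X W \<Longrightarrow> x \<in> W \<Longrightarrow> \<exists>V c. openin X V \<and> x \<in> V \<and> V \<subseteq> W \<and>
        continuous_map (prod_topology (subtopology X V) (top_of_set {0..1})) (subtopology X W) c \<and>
        (\<forall>v\<in>V. c (v, 0) = v \<and> c (v, 1::real) = x)"
    and joinable: "openin X W \<Longrightarrow> x \<in> W \<Longrightarrow> \<exists>V. openin X V \<and> x \<in> V \<and> V \<subseteq> W \<and>
        (\<forall>a\<in>V \<inter> A. \<forall>b\<in>V \<inter> A. \<exists>g. pathin (subtopology X (W \<inter> A)) g \<and> g 0 = a \<and> g 1 = b)"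
begin

text \<open>
  A small neighbourhood contracts to \<open>w\<close> and, by density, meets \<open>A\<close>. The contraction, run backwards
  along such a point, leads from \<open>w\<close> to it. Points of \<open>A\<close> are kept fixed so that later homotopies
  are relative to what already lies in \<open>A\<close>.
\<close>

lemma push_point:
  assumes W: "openin X W" "w \<in> W"
  obtains r where "cmap_on {0..1::real} (subtopology X W) r" "r 0 = w" "r 1 \<in> A"
    "w \<in> A \<Longrightarrow> r = (\<lambda>_. w)"
proof (cases "w \<in> A")
  case True
  then show ?thesis using W that[of "\<lambda>_. w"] openin_subset[OF W(1)] by auto
next
  case False
  obtain V c where V: "openin X V" "w \<in> V" "V \<subseteq> W"
    and c: "continuous_map (prod_topology (subtopology X V) (top_of_set {0..1})) (subtopology X W) c"
      "\<And>v. v \<in> V \<Longrightarrow> c (v, 0) = v" "\<And>v. v \<in> V \<Longrightarrow> c (v, 1::real) = w"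
    using contractible[OF W] by metis
  obtain a where a: "a \<in> V" "a \<in> A" using dense[OF V(1)] V(2) by blast
  have VX: "V \<subseteq> topspace X" using V(1) openin_subset by blast
  have "cmap_on {0..1} (prod_topology (subtopology X V) (top_of_set {0..1::real})) (\<lambda>t. (a, 1 - t))"
    using a VX by (intro continuous_map_pairedI) (auto intro!: continuous_intros)
  from continuous_map_compose[OF this c(1)]
  have "cmap_on {0..1} (subtopology X W) (\<lambda>t. c (a, 1 - t))" by (simp add: o_def)
  then show ?thesis using that[of "\<lambda>t. c (a, 1 - t)"] a c False by simp
qed

text \<open>
  The path and the two tracks are three sides of a rectangle, and a path inside \<open>A\<close> between their
  ends is the fourth. The resulting loop stays in a set that contracts inside \<open>W\<close>, so it is filled
  there.
\<close>

lemma edge_push_local: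
  assumes W: "openin X W" "x \<in> W"
  shows "\<exists>V. openin X V \<and> x \<in> V \<and> V \<subseteq> W \<and>
           (\<forall>a b p q0 q1. edge_data X A V a b p q0 q1 \<longrightarrow> (\<exists>H. edge_push X A W a b p q0 q1 H))"
proof -
  obtain V1 c where V1: "openin X V1" "x \<in> V1" "V1 \<subseteq> W"
    and c: "continuous_map (prod_topology (subtopology X V1) (top_of_set {0..1})) (subtopology X W) c"
      "\<And>v. v \<in> V1 \<Longrightarrow> c (v, 0) = v" "\<And>v. v \<in> V1 \<Longrightarrow> c (v, 1::real) = x"
    using contractible[OF W] by metis
  obtain V where V: "openin X V" "x \<in> V" "V \<subseteq> V1" 
    and join: "\<And>a b. a \<in> V \<inter> A \<Longrightarrow> b \<in> V \<inter> A \<Longrightarrow> \<exists>g. pathin (subtopology X (V1 \<inter> A)) g \<and> g 0 = a \<and> g 1 = b"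
    using joinable[OF V1(1,2)] by metis
  have "\<exists>H. edge_push X A W a b p q0 q1 H" if data: "edge_data X A V a b p q0 q1" for a b p q0 q1
  proof -
    note d = data[unfolded edge_data_def]
    then have ab: "a < b" by blast
    have toV1: "continuous_map S (subtopology X V1) f" if "continuous_map S (subtopology X V) f" for f :: "'b \<Rightarrow> 'a" and S
      using that V(3) by (rule continuous_map_into_larger)
    have "q0 1 \<in> V" "q1 1 \<in> V" using d by (auto simp: continuous_map_in_subtopology Pi_iff)
    then obtain g where g: "pathin (subtopology X (V1 \<inter> A)) g" "g 0 = q0 1" "g 1 = q1 1"
      using join[of "q0 1" "q1 1"] d by auto
    \<comment> \<open>the fourth side of the rectangle\<close>
    define g' where "g' s = g ((s - a) / (b - a))" for s
    have g'c: "cmap_on {a..b} (subtopology X (V1 \<inter> A)) g'"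
      unfolding g'_def using ab
      by (intro continuous_map_compose_eu[OF g(1)[unfolded pathin_def]] continuous_intros) (auto simp: field_simps)
    have g'A: "g' s \<in> A" if "s \<in> {a..b}" for s
      using g'c that by (auto simp: continuous_map_in_subtopology Pi_iff)
    have g'V: "cmap_on {a..b} (subtopology X V1) g'"
      using g'c by (auto simp: continuous_map_in_subtopology)
    have g'e: "g' a = q0 1" "g' b = q1 1" using g ab by (auto simp: g'_def)
    define \<phi> where "\<phi> = (\<lambda>(s,t). if t = 0 then p s else if t = 1 then g' s else if s = a then q0 t else q1 (t::real))"
    let ?C = "{a..b} \<times> {0..1::real}"
    have "cmap_on (frontier ?C) (subtopology X V1) \<phi>"
      unfolding frontier_rectangle[OF ab]
    proof (intro continuous_map_Un_closed closed_Un closed_Times)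
      show "cmap_on ({a..b} \<times> {0}) (subtopology X V1) \<phi>"
        by (rule continuous_map_eq[OF continuous_map_compose_eu[OF toV1, of "{a..b}" p _ fst]])
           (use d in \<open>auto simp: \<phi>_def intro!: continuous_intros\<close>)
      show "cmap_on ({a..b} \<times> {1}) (subtopology X V1) \<phi>"
        by (rule continuous_map_eq[OF continuous_map_compose_eu[OF g'V, of _ fst]])
           (auto simp: \<phi>_def intro!: continuous_intros)
      show "cmap_on ({a} \<times> {0..1}) (subtopology X V1) \<phi>"
        by (rule continuous_map_eq[OF continuous_map_compose_eu[OF toV1, of "{0..1}" q0 _ snd]])
           (use d g'e ab in \<open>auto simp: \<phi>_def intro!: continuous_intros\<close>)
      show "cmap_on ({b} \<times> {0..1}) (subtopology X V1) \<phi>"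
        by (rule continuous_map_eq[OF continuous_map_compose_eu[OF toV1, of "{0..1}" q1 _ snd]])
           (use d g'e ab in \<open>auto simp: \<phi>_def intro!: continuous_intros\<close>)
    qed auto
    moreover have "convex ?C" by (intro convex_Times) auto
    moreover have "compact ?C" by (intro compact_Times) auto
    moreover have "interior ?C \<noteq> {}" using ab by (simp add: interior_Times)
    ultimately have "fillable ?C (subtopology X W) \<phi>"
      using fillable_contract[OF _ _ _ _ c(1), of ?C \<phi> x] c(2,3) by simp
    then obtain H where H: "cmap_on ?C (subtopology X W) H"
      "\<And>z. z \<in> frontier ?C \<Longrightarrow> H z = \<phi> z"
      by (auto simp: fillable_def)
    have "edge_push X A W a b p q0 q1 H"
      unfolding edge_push_def
    proof (intro conjI ballI)
      fix s assume s: "s \<in> {a..b}"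
      then have "(s, 0) \<in> frontier ?C" "(s, 1) \<in> frontier ?C" by (auto simp: frontier_rectangle[OF ab])
      then show "H (s, 0) = p s" "H (s, 1) \<in> A" using H(2) g'A s by (auto simp: \<phi>_def)
    next
      fix t :: real assume t: "t \<in> {0..1}"
      then have "(a, t) \<in> frontier ?C" "(b, t) \<in> frontier ?C" by (auto simp: frontier_rectangle[OF ab])
      then show "H (a, t) = q0 t" "H (b, t) = q1 t" using H(2) d g'e ab by (auto simp: \<phi>_def)
    qed (rule H(1))
    then show ?thesis by blast
  qed
  then show ?thesis using V V1 by (intro exI[of _ V] conjI allI impI) auto
qed

text \<open>
  Subdivide the path so that the local lemma applies to every piece. A subdivision point belongs to
  two pieces, and it is pushed inside the intersection of the two open sets, so that its track is
  admissible for both.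
\<close>

lemma path_push_rel_ends:
  assumes W: "openin X W" and p: "cmap_on {0..1} (subtopology X W) p"
    and ends: "p 0 \<in> A" "p 1 \<in> A"
  obtains H where "edge_push X A W 0 1 p (\<lambda>_. p 0) (\<lambda>_. p 1) H"
proof -
  define \<U> where "\<U> = {V. openin X V \<and> V \<subseteq> W \<and>
     (\<forall>a b p q0 q1. edge_data X A V a b p q0 q1 \<longrightarrow> (\<exists>H. edge_push X A W a b p q0 q1 H))}"
  have pX: "cmap_on {0..1} X p" and pW: "\<And>t. t \<in> {0..1} \<Longrightarrow> p t \<in> W"
    using p by (auto simp: continuous_map_in_subtopology Pi_iff)
  have "\<exists>U\<in>\<U>. openin X U \<and> p t \<in> U" if "t \<in> {0..1}" for t
    using edge_push_local[OF W pW[OF that]] unfolding \<U>_def by blast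
  then obtain \<delta> where \<delta>: "\<delta> > 0" "\<And>x. x \<in> {0..1} \<Longrightarrow> \<exists>U\<in>\<U>. openin X U \<and> p ` ({0..1} \<inter> ball x \<delta>) \<subseteq> U"
    by (rule Lebesgue_number_of_map[OF _ pX, rotated]) auto
  obtain n :: nat where n: "n > 0" "1 / real n < \<delta>"
    using reals_Archimedean[OF \<delta>(1)] by (metis inverse_eq_divide zero_less_Suc)
  define c where "c i = {real i / n .. (real i + 1) / n}" for i
  have cI: "c i \<subseteq> {0..1}" if "i < n" for i
    using that n by (auto simp: c_def field_simps)
  have "\<exists>V\<in>\<U>. p ` c i \<subseteq> V" if "i < n" for i
  proof -
    have "real i / n \<in> {0..1}" using that by auto
    moreover have "c i \<subseteq> {0..1} \<inter> ball (real i / n) \<delta>"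
      using cI[OF that] n by (auto simp: c_def dist_real_def add_divide_distrib)
    ultimately show ?thesis using \<delta>(2)[of "real i / n"] by (meson dual_order.trans image_mono)
  qed
  then obtain V where V: "\<And>i. i < n \<Longrightarrow> V i \<in> \<U>" "\<And>i. i < n \<Longrightarrow> p ` c i \<subseteq> V i" by metis
  \<comment> \<open>the room in which the point at time \<open>t\<close> may be moved; two sets meet at a subdivision point\<close>
  define N where "N t = W \<inter> \<Inter> (V ` {i. i < n \<and> t \<in> c i})" for t
  have "openin X (N t)" for t
  proof (cases "{i. i < n \<and> t \<in> c i} = {}")
    case False
    then have "openin X (\<Inter> (V ` {i. i < n \<and> t \<in> c i}))"
      using V(1) by (intro openin_Inter) (auto simp: \<U>_def)
    then show ?thesis unfolding N_def using W by blast
  next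
    case True
    show ?thesis unfolding N_def True using W by simp
  qed
  moreover have "p t \<in> N t" if "t \<in> {0..1}" for t
    using V(2) pW[OF that] by (auto simp: N_def)
  ultimately have ex: "\<forall>t. \<exists>r. t \<in> {0..1} \<longrightarrow> cmap_on {0..1::real} (subtopology X (N t)) r \<and> r 0 = p t \<and> r 1 \<in> A \<and>
        (p t \<in> A \<longrightarrow> r = (\<lambda>_. p t))"
    using push_point[of "N t" "p t" for t] by metis
  from choice[OF ex] obtain r where "\<forall>t. t \<in> {0..1} \<longrightarrow>
      cmap_on {0..1::real} (subtopology X (N t)) (r t) \<and> r t 0 = p t \<and> r t 1 \<in> A \<and>
        (p t \<in> A \<longrightarrow> r t = (\<lambda>_. p t))" ..
  then have r: "\<And>t. t \<in> {0..1} \<Longrightarrow> cmap_on {0..1::real} (subtopology X (N t)) (r t)"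
    "\<And>t. t \<in> {0..1} \<Longrightarrow> r t 0 = p t" "\<And>t. t \<in> {0..1} \<Longrightarrow> r t 1 \<in> A"
    "\<And>t. t \<in> {0..1} \<Longrightarrow> p t \<in> A \<Longrightarrow> r t = (\<lambda>_. p t)"
    by blast+
  have "\<exists>H. edge_push X A W (real i / n) ((real i + 1) / n) p (r (real i / n)) (r ((real i + 1) / n)) H"
    if i: "i < n" for i
  proof -
    let ?a = "real i / n" and ?b = "(real i + 1) / n"
    have ab: "?a \<in> c i" "?b \<in> c i" "?a < ?b" using n by (auto simp: c_def divide_simps)
    have ab': "?a \<in> {0..1}" "?b \<in> {0..1}" using ab cI[OF i] by auto
    have rV: "cmap_on {0..1::real} (subtopology X (V i)) (r t)" if "t \<in> c i" "t \<in> {0..1}" for t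
      using r(1)[OF that(2)] i that(1) by (auto simp: N_def continuous_map_in_subtopology)
    have "cmap_on (c i) (subtopology X (V i)) p"
      using V(2)[OF i] continuous_map_from_subtopology_mono[OF pX cI[OF i]]
      by (auto simp: continuous_map_in_subtopology)
    then have "edge_data X A (V i) ?a ?b p (r ?a) (r ?b)"
      unfolding edge_data_def using ab ab' rV r by (simp add: c_def)
    then show ?thesis using V(1)[OF i] unfolding \<U>_def by blast
  qed
  then have "\<forall>i. \<exists>H. i < n \<longrightarrow> edge_push X A W (real i / n) ((real i + 1) / n) p (r (real i / n)) (r ((real i + 1) / n)) H"
    by blast
  from choice[OF this] obtain H where
    H: "\<And>i. i < n \<Longrightarrow> edge_push X A W (real i / n) ((real i + 1) / n) p (r (real i / n)) (r ((real i + 1) / n)) (H i)"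
    by blast
  have agree: "H i (s, t) = r s t" if "i < n" "s \<in> c i" "s \<in> c j" "i \<noteq> j" "t \<in> {0..1}" for i j s t
  proof -
    have "real i < s * n + 1 \<and> s * n \<le> real i + 1 \<and> real i \<le> s * n" 
      "real j \<le> s * n \<and> s * n \<le> real j + 1"
      using that n by (auto simp: c_def field_simps)
    moreover have "real i + 1 \<le> real j \<or> real j + 1 \<le> real i" using that(4) by linarith
    ultimately have "s * n = real i \<or> s * n = real i + 1" by linarith
    then have "s = real i / n \<or> s = (real i + 1) / n" using n by (auto simp: field_simps)
    then show ?thesis using H[OF that(1)] that(5) by (auto simp: edge_push_def)
  qed
  obtain G where G: "cmap_on (\<Union>i\<in>{..<n}. c i \<times> {0..1}) (subtopology X W) G"
    "\<And>i x. i \<in> {..<n} \<Longrightarrow> x \<in> c i \<times> {0..1} \<Longrightarrow> G x = H i x"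
  proof (rule glue_finite_closed[of "{..<n}" "\<lambda>i. c i \<times> {0..1}" "subtopology X W" H])
    fix i j x assume "i \<in> {..<n}" "j \<in> {..<n}" "x \<in> c i \<times> {0..1::real}" "x \<in> c j \<times> {0..1::real}"
    then show "H i x = H j x" using agree[of i _ j] agree[of j _ i] by (cases "i = j") auto
  qed (use H in \<open>auto simp: edge_push_def c_def intro!: closed_Times\<close>)
  have cover: "\<exists>i<n. s \<in> c i" if "s \<in> {0..1}" for s
    using unit_interval_grid_cover[OF n(1) that] by (simp add: c_def)
  have un: "(\<Union>i\<in>{..<n}. c i \<times> {0..1::real}) = {0..1} \<times> {0..1}"
    using cover cI by fastforce
  have G': "\<exists>i<n. s \<in> c i \<and> (\<forall>t\<in>{0..1}. G (s, t) = H i (s, t))" if "s \<in> {0..1}" for s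
    using cover[OF that] G(2) by fastforce
  have e0: "G (0, t) = r 0 t" if "t \<in> {0..1}" for t
    using G(2)[of 0 "(0, t)"] H[of 0] n that by (auto simp: c_def edge_push_def)
  have e1: "G (1, t) = r 1 t" if "t \<in> {0..1}" for t
    using G(2)[of "n - 1" "(1, t)"] H[of "n - 1"] n that by (auto simp: c_def edge_push_def of_nat_diff)
  have "edge_push X A W 0 1 p (\<lambda>_. p 0) (\<lambda>_. p 1) G"
    unfolding edge_push_def
  proof (intro conjI ballI)
    fix s :: real assume "s \<in> {0..1}"
    then obtain i where "i < n" "s \<in> c i" "\<forall>t\<in>{0..1}. G (s, t) = H i (s, t)" using G' by blast
    then show "G (s, 0) = p s" "G (s, 1) \<in> A" using H[of i] by (auto simp: edge_push_def c_def)
  next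
    fix t :: real assume "t \<in> {0..1}"
    then show "G (0, t) = p 0" "G (1, t) = p 1" using e0 e1 r(4)[of 0] r(4)[of 1] ends by auto
  qed (use G(1) un in simp)
  then show ?thesis using that by blast
qed

end

context thin_complement begin

text \<open>
  Prescribed tracks of the ends are reduced to fixed ends: traverse the first track backwards, the
  path, and the second track forwards. This path has its ends in \<open>A\<close>, and a homotopy of it
  relative to its ends is reparametrised by a self-map of the rectangle that unfolds the three sides
  onto the bottom side and sends the top side to the remaining three.
\<close>

lemma edge_push_exists:
  assumes W: "openin X W" and data: "edge_data X A W a b p q0 q1"
  shows "\<exists>H. edge_push X A W a b p q0 q1 H"
proof -
  note d = data[unfolded edge_data_def]
  then have ab: "a < b" by blast
  \<comment> \<open>first track backwards, then the path during the middle half, then the second track\<close>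
  define u where "u \<tau> = (if \<tau> \<le> 1/4 then q0 (1 - 4 * \<tau>) else if \<tau> \<le> 3/4 then p (a + (4 * \<tau> - 1) * (b - a) / 2)
      else q1 (4 * \<tau> - 3))" for \<tau> :: real
  have mid: "a + (4 * \<tau> - 1) * (b - a) / 2 \<in> {a..b}" if "1/4 \<le> \<tau>" "\<tau> \<le> 3/4" for \<tau> :: real
  proof -
    have "0 \<le> (4 * \<tau> - 1) * (b - a)" "(4 * \<tau> - 1) * (b - a) \<le> 2 * (b - a)"
      using that ab mult_right_mono[of "4 * \<tau> - 1" 2 "b - a"] by (auto intro!: mult_nonneg_nonneg)
    then show ?thesis by (simp add: field_simps)
  qed
  have um: "u \<tau> = p (a + (4 * \<tau> - 1) * (b - a) / 2)" if "1/4 \<le> \<tau>" "\<tau> \<le> 3/4" for \<tau>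
  proof (cases "\<tau> = 1/4")
    case True
    show ?thesis unfolding True using d by (simp add: u_def diff_divide_distrib)
  qed (use that in \<open>auto simp: u_def\<close>)
  have ur: "u \<tau> = q1 (4 * \<tau> - 3)" if "3/4 \<le> \<tau>" for \<tau>
  proof (cases "\<tau> = 3/4")
    case True
    show ?thesis unfolding True using d by (simp add: u_def diff_divide_distrib)
  qed (use that in \<open>auto simp: u_def\<close>)
  have "cmap_on (({0..1/4} \<union> {1/4..3/4}) \<union> {3/4..1}) (subtopology X W) u"
  proof (intro continuous_map_Un_closed closed_Un)
    show "cmap_on {0..1/4} (subtopology X W) u"
      by (rule continuous_map_eq[OF continuous_map_compose_eu[of "{0..1}" _ q0 _ "\<lambda>\<tau>. 1 - 4 * \<tau>"]])
         (use d in \<open>auto simp: u_def intro!: continuous_intros\<close>)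
    show "cmap_on {1/4..3/4} (subtopology X W) u"
      by (rule continuous_map_eq[OF continuous_map_compose_eu[of "{a..b}" _ p _ "\<lambda>\<tau>. a + (4 * \<tau> - 1) * (b - a) / 2"]])
         (use d mid in \<open>auto simp: um intro!: continuous_intros\<close>)
    show "cmap_on {3/4..1} (subtopology X W) u"
      by (rule continuous_map_eq[OF continuous_map_compose_eu[of "{0..1}" _ q1 _ "\<lambda>\<tau>. 4 * \<tau> - 3"]])
         (use d in \<open>auto simp: ur intro!: continuous_intros\<close>)
  qed auto
  moreover have "({0..1/4} \<union> {1/4..3/4}) \<union> {3/4..1} = {0..1::real}" by auto
  ultimately have uc: "cmap_on {0..1} (subtopology X W) u" by simp
  have ue: "u 0 \<in> A" "u 1 \<in> A" using d by (auto simp: u_def)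
  obtain H0 where "edge_push X A W 0 1 u (\<lambda>_. u 0) (\<lambda>_. u 1) H0"
    using path_push_rel_ends[OF W uc ue] .
  then have H0: "cmap_on ({0..1} \<times> {0..1}) (subtopology X W) H0"
    "\<And>s. s \<in> {0..1} \<Longrightarrow> H0 (s, 0) = u s" "\<And>s. s \<in> {0..1} \<Longrightarrow> H0 (s, 1) \<in> A"
    "\<And>t. t \<in> {0..1} \<Longrightarrow> H0 (0, t) = u 0" "\<And>t. t \<in> {0..1} \<Longrightarrow> H0 (1, t) = u 1"
    by (auto simp: edge_push_def)
  \<comment> \<open>normalises the rectangle to \<open>[-1, 1] \<times> [0, 1]\<close>\<close>
  define x where "x s = (2 * s - a - b) / (b - a)" for s
  have x: "\<bar>x s\<bar> \<le> 1" if "s \<in> {a..b}" for s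
    using that ab by (auto simp: x_def abs_le_iff divide_simps)
  have xe: "x a = -1" "x b = 1" using ab by (auto simp: x_def divide_simps)
  \<comment> \<open>the last factor is 1 on the bottom and the lateral sides; on the top \<open>k1\<close> then reaches an end wherever \<open>k2 < 1\<close>\<close>
  define k1 where "k1 s t = max (-1) (min 1 (x s * (1 + t) / 2 * (1 + 4 * t * (1 - \<bar>x s\<bar>))))" for s t :: real
  define k2 where "k2 s t = min 1 (4 * t * (1 - \<bar>x s\<bar>))" for s t :: real
  have k1: "(k1 s t + 1) / 2 \<in> {0..1}" for s t by (auto simp: k1_def)
  have k2: "k2 s t \<in> {0..1}" if "s \<in> {a..b}" "t \<in> {0..1}" for s t
    using x[OF that(1)] that(2) by (auto simp: k2_def)
  let ?H = "\<lambda>z. H0 ((k1 (fst z) (snd z) + 1) / 2, k2 (fst z) (snd z))"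
  have "edge_push X A W a b p q0 q1 ?H"
    unfolding edge_push_def
  proof (intro conjI ballI)
    show "cmap_on ({a..b} \<times> {0..1}) (subtopology X W) ?H"
    proof (rule continuous_map_compose_eu[OF H0(1)])
      show "continuous_on ({a..b} \<times> {0..1}) (\<lambda>z. ((k1 (fst z) (snd z) + 1) / 2, k2 (fst z) (snd z)))"
        unfolding k1_def k2_def x_def using ab by (intro continuous_intros) auto
      show "(\<lambda>z. ((k1 (fst z) (snd z) + 1) / 2, k2 (fst z) (snd z))) ` ({a..b} \<times> {0..1}) \<subseteq> {0..1} \<times> {0..1}"
        using k1 k2 by auto
    qed
  next
    fix s assume s: "s \<in> {a..b}"
    have k: "k1 s 0 = x s / 2" "k2 s 0 = 0" using x[OF s] by (auto simp: k1_def k2_def)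
    have e: "(k1 s 0 + 1) / 2 = x s / 4 + 1/2" unfolding k by (simp add: add_divide_distrib)
    have "?H (s, 0) = u (x s / 4 + 1/2)"
      unfolding fst_conv snd_conv e k(2) using x[OF s] by (intro H0(2)) (auto simp: abs_le_iff)
    also have "\<dots> = p (a + (x s + 1) * (b - a) / 2)"
    proof -
      have "1/4 \<le> x s / 4 + 1/2" "x s / 4 + 1/2 \<le> 3/4" using x[OF s] by (auto simp: abs_le_iff)
      from um[OF this] show ?thesis by (simp add: algebra_simps)
    qed
    also have "a + (x s + 1) * (b - a) / 2 = s" using ab by (simp add: x_def divide_simps)
    finally show "?H (s, 0) = p s" .
    show "?H (s, 1) \<in> A"
    proof (cases "\<bar>x s\<bar> \<le> 3/4")
      case True
      then have "k2 s 1 = 1" by (simp add: k2_def)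
      then show ?thesis using H0(3) k1 by simp
    next
      case False
      define y where "y = \<bar>x s\<bar>"
      have y: "3/4 < y" "y \<le> 1" using False x[OF s] by (auto simp: y_def)
      then have "0 \<le> (1 - y) * (4 * y - 1)" by (intro mult_nonneg_nonneg) auto
      then have yy: "1 \<le> y * (1 + 4 * (1 - y))" by (simp add: algebra_simps)
      have "k1 s 1 = 1 \<or> k1 s 1 = -1"
      proof (cases "x s \<ge> 0")
        case True
        then have "1 \<le> x s * (1 + 4 * (1 - \<bar>x s\<bar>))" using yy by (simp add: y_def)
        then show ?thesis by (simp add: k1_def)
      next
        case False
        then have "x s = - y" by (simp add: y_def)
        then have "x s * (1 + 4 * (1 - \<bar>x s\<bar>)) \<le> -1" using yy y by simp
        then show ?thesis by (simp add: k1_def)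
      qed
      then show ?thesis using H0(4,5) ue k2[OF s, of 1] by auto
    qed
  next
    fix t :: real assume t: "t \<in> {0..1}"
    have k: "k1 a t = - (1 + t) / 2" "k2 a t = 0" "k1 b t = (1 + t) / 2" "k2 b t = 0"
      using t by (auto simp: k1_def k2_def xe)
    have e: "(k1 a t + 1) / 2 = (1 - t) / 4" "(k1 b t + 1) / 2 = (3 + t) / 4" unfolding k by (simp_all add: field_simps)
    have "?H (a, t) = u ((1 - t) / 4)" "?H (b, t) = u ((3 + t) / 4)"
      unfolding fst_conv snd_conv e k(2,4) using t by (auto intro!: H0(2))
    moreover have "u ((1 - t) / 4) = q0 t" using t by (simp add: u_def diff_divide_distrib)
    moreover have "u ((3 + t) / 4) = q1 t"
      using t by (subst ur) (auto simp: add_divide_distrib)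
    ultimately show "?H (a, t) = q0 t" "?H (b, t) = q1 t" by simp_all
  qed
  then show ?thesis by blast
qed

end

section \<open>Pushing one square\<close>

text \<open>
  Squares are given by centre and radius because the retraction below is radial.
\<close>

definition square :: "real \<times> real \<Rightarrow> real \<Rightarrow> (real \<times> real) set" where
  "square m \<delta> = {x. infnorm (x - m) \<le> \<delta>}"

text \<open>
  The box over a square without its lid: the floor carries the square to be pushed, the walls the
  tracks of its boundary.
\<close>

definition open_box :: "real \<times> real \<Rightarrow> real \<Rightarrow> ((real \<times> real) \<times> real) set" where
  "open_box m \<delta> = {z \<in> square m \<delta> \<times> {0..1}. snd z = 0 \<or> infnorm (fst z - m) = \<delta>}"

lemma square_eq: "square m \<delta> = {fst m - \<delta>..fst m + \<delta>} \<times> {snd m - \<delta>..snd m + \<delta>}"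
  by (auto simp: square_def infnorm_real2)

lemma square_eq_cbox: "square m \<delta> = cbox (m - (\<delta>, \<delta>)) (m + (\<delta>, \<delta>))"
  by (cases m) (simp add: square_eq cbox_Pair_eq)

lemma frontier_square:
  assumes "\<delta> > 0" shows "frontier (square m \<delta>) = {x. infnorm (x - m) = \<delta>}"
proof -
  have "x \<in> box (m - (\<delta>, \<delta>)) (m + (\<delta>, \<delta>)) \<longleftrightarrow> \<bar>fst (x - m)\<bar> < \<delta> \<and> \<bar>snd (x - m)\<bar> < \<delta>" for x
    by (cases m, cases x) (auto simp: box_def Basis_prod_def)
  moreover have "max \<bar>u\<bar> \<bar>v\<bar> \<le> \<delta> \<and> \<not> (\<bar>u\<bar> < \<delta> \<and> \<bar>v\<bar> < \<delta>) \<longleftrightarrow> max \<bar>u\<bar> \<bar>v\<bar> = \<delta>" for u v :: real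
    by linarith
  ultimately show ?thesis
    unfolding square_eq_cbox frontier_cbox unfolding square_eq_cbox[symmetric] square_def infnorm_real2
    by blast
qed

lemma frontier_box:
  assumes "\<delta> > 0" shows "frontier (square m \<delta> \<times> {0..1::real}) = open_box m \<delta> \<union> square m \<delta> \<times> {1}"
proof -
  have "square m \<delta> \<times> {0..1::real} = cbox (m - (\<delta>, \<delta>), 0) (m + (\<delta>, \<delta>), 1)"
    by (simp add: square_eq_cbox cbox_Pair_eq)
  then have "frontier (square m \<delta> \<times> {0..1::real}) = square m \<delta> \<times> {0..1::real} - box (m - (\<delta>, \<delta>), 0) (m + (\<delta>, \<delta>), 1)"
    by (metis frontier_cbox)
  also have "box (m - (\<delta>, \<delta>), 0) (m + (\<delta>, \<delta>), 1) = box (m - (\<delta>, \<delta>)) (m + (\<delta>, \<delta>)) \<times> {0<..<1::real}"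
    by (auto simp: box_def Basis_prod_def)
  also have "square m \<delta> \<times> {0..1::real} - \<dots> = open_box m \<delta> \<union> square m \<delta> \<times> {1}"
  proof -
    have "x \<in> box (m - (\<delta>, \<delta>)) (m + (\<delta>, \<delta>)) \<longleftrightarrow> infnorm (x - m) \<noteq> \<delta>" if "x \<in> square m \<delta>" for x
      using frontier_square[OF assms, of m] that unfolding square_eq_cbox frontier_cbox by blast
    then show ?thesis by (auto simp: open_box_def)
  qed
  finally show ?thesis .
qed

text \<open>
  Projection of the box to its floor and walls from the point at height 2 above the centre.
\<close>

definition box_retract :: "real \<times> real \<Rightarrow> real \<Rightarrow> (real \<times> real) \<times> real \<Rightarrow> (real \<times> real) \<times> real" where
  "box_retract m \<delta> = (\<lambda>(x, y). let M = max (infnorm (x - m) / \<delta>) ((2 - y) / 2)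
     in (m + (1 / M) *\<^sub>R (x - m), 2 - (2 - y) / M))"

lemma continuous_on_box_retract:
  assumes "\<delta> > 0" shows "continuous_on (square m \<delta> \<times> {0..1}) (box_retract m \<delta>)"
proof -
  have "max (infnorm (x - m) / \<delta>) ((2 - y) / 2) \<noteq> 0" if "y \<le> 1" for x and y :: real
    using that by (smt (verit) divide_pos_pos max.cobounded2)
  then show ?thesis using assms
    unfolding box_retract_def Let_def case_prod_beta
    by (intro continuous_intros) auto
qed

text \<open>
  The scaling factor \<open>M\<close> is chosen so that the ray leaves the box through a wall when the first
  argument of the maximum is attained and through the floor when the second one is.
\<close>

lemma box_retract_in:
  assumes "\<delta> > 0" "z \<in> square m \<delta> \<times> {0..1}" shows "box_retract m \<delta> z \<in> open_box m \<delta>"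
proof -
  obtain x y where [simp]: "z = (x, y)" by fastforce
  define M where "M = max (infnorm (x - m) / \<delta>) ((2 - y) / 2)"
  have xy: "infnorm (x - m) \<le> \<delta>" "0 \<le> y" "y \<le> 1" using assms(2) by (auto simp: square_def)
  have M: "M > 0" "infnorm (x - m) / \<delta> \<le> M" "(2 - y) / 2 \<le> M" "M \<le> 2 - y"
  proof -
    have "infnorm (x - m) / \<delta> \<le> 1" using xy(1) assms(1) by simp
    then show "M > 0" "infnorm (x - m) / \<delta> \<le> M" "(2 - y) / 2 \<le> M" "M \<le> 2 - y"
      using xy by (auto simp: M_def less_max_iff_disj)
  qed
  have "infnorm ((1 / M) *\<^sub>R (x - m)) = infnorm (x - m) / M" using M by (simp add: infnorm_mul)
  moreover have "infnorm (x - m) / M \<le> \<delta>" using M assms(1) by (simp add: field_simps)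
  moreover have "0 \<le> 2 - (2 - y) / M" "2 - (2 - y) / M \<le> 1" using M by (auto simp: field_simps)
  moreover have "2 - (2 - y) / M = 0 \<or> infnorm (x - m) / M = \<delta>"
  proof (cases "M = (2 - y) / 2")
    case True then show ?thesis using M(1) by (simp add: divide_eq_eq)
  next
    case False
    then have "M = infnorm (x - m) / \<delta>" by (auto simp: M_def max_def split: if_splits)
    then show ?thesis using M(1) assms(1) by (auto simp: field_simps)
  qed
  ultimately show ?thesis
    by (simp add: box_retract_def Let_def M_def[symmetric] open_box_def square_def)
qed

lemma box_retract_id:
  assumes "\<delta> > 0" "z \<in> open_box m \<delta>" shows "box_retract m \<delta> z = z"
proof -
  obtain x y where [simp]: "z = (x, y)" by fastforce
  have i: "infnorm (x - m) / \<delta> \<le> 1" "0 \<le> y" and d: "y = 0 \<or> infnorm (x - m) / \<delta> = 1"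
    using assms by (auto simp: open_box_def square_def)
  from d have "max (infnorm (x - m) / \<delta>) ((2 - y) / 2) = 1" using i by auto
  then show ?thesis by (simp add: box_retract_def)
qed

definition cell_data :: "'a topology \<Rightarrow> 'a set \<Rightarrow> 'a set \<Rightarrow> real \<times> real \<Rightarrow> real \<Rightarrow> ((real \<times> real) \<times> real \<Rightarrow> 'a) \<Rightarrow> bool" where
  "cell_data X A V m \<delta> \<phi> \<longleftrightarrow> \<delta> > 0 \<and> cmap_on (open_box m \<delta>) (subtopology X V) \<phi> \<and>
     (\<forall>x. infnorm (x - m) = \<delta> \<longrightarrow> \<phi> (x, 1) \<in> A)"

definition cell_push :: "'a topology \<Rightarrow> 'a set \<Rightarrow> real \<times> real \<Rightarrow> real \<Rightarrow> ((real \<times> real) \<times> real \<Rightarrow> 'a) \<Rightarrow> ((real \<times> real) \<times> real \<Rightarrow> 'a) \<Rightarrow> bool" where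
  "cell_push X A m \<delta> \<phi> F \<longleftrightarrow> cmap_on (square m \<delta> \<times> {0..1}) X F \<and>
     (\<forall>z\<in>open_box m \<delta>. F z = \<phi> z) \<and> (\<forall>x\<in>square m \<delta>. F (x, 1) \<in> A)"

text \<open>
  Where everything already lies in \<open>A\<close>, the retraction of the box to its floor and walls provides
  the homotopy.
\<close>

lemma cell_push_within:
  assumes "cell_data X A V m \<delta> \<phi>" "V \<subseteq> A"
  shows "\<exists>F. cell_push X A m \<delta> \<phi> F"
proof -
  have \<delta>: "\<delta> > 0" and \<phi>: "cmap_on (open_box m \<delta>) X \<phi>" "\<And>z. z \<in> open_box m \<delta> \<Longrightarrow> \<phi> z \<in> V"
    using assms(1) by (auto simp: cell_data_def continuous_map_in_subtopology Pi_iff)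
  have "cell_push X A m \<delta> \<phi> (\<lambda>z. \<phi> (box_retract m \<delta> z))"
    unfolding cell_push_def
  proof (intro conjI ballI)
    show "cmap_on (square m \<delta> \<times> {0..1}) X (\<lambda>z. \<phi> (box_retract m \<delta> z))"
      by (intro continuous_map_compose_eu[OF \<phi>(1)] continuous_on_box_retract \<delta> image_subsetI box_retract_in)
  next
    fix x assume "x \<in> square m \<delta>"
    then have "box_retract m \<delta> (x, 1) \<in> open_box m \<delta>" by (intro box_retract_in \<delta>) auto
    then show "\<phi> (box_retract m \<delta> (x, 1)) \<in> A" using \<phi>(2) assms(2) by blast
  qed (simp add: box_retract_id \<delta>)
  then show ?thesis by blast
qed

text \<open>
  The edge of the lid is a loop in \<open>V \<inter> A\<close>. It is filled in \<open>V\<close> by the floor and the walls, read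
  off on the lid by the retraction of the box. By injectivity on \<open>\<pi>\<^sub>1\<close> it is filled in \<open>V \<inter> A\<close>; this
  is the lid. Floor, walls and lid form a 2-sphere in \<open>V\<close>, which is filled as \<open>\<pi>\<^sub>2(V) = 0\<close>.
\<close>

lemma cell_push_local:
  assumes data: "cell_data X A V m \<delta> \<phi>" and V: "V \<subseteq> topspace X"
    and pi2: "\<And>v \<sigma>. v \<in> V \<Longrightarrow> \<sigma> \<in> spheroids 2 (subtopology X V) v \<Longrightarrow> (\<sigma>, \<lambda>_. v) \<in> spheroid_homotopic 2 (subtopology X V) v"
    and pi1: "\<And>v \<sigma>. v \<in> V \<inter> A \<Longrightarrow> \<sigma> \<in> spheroids 1 (subtopology X (V \<inter> A)) v \<Longrightarrow>
        (\<sigma>, \<lambda>_. v) \<in> spheroid_homotopic 1 (subtopology X V) v \<Longrightarrow> (\<sigma>, \<lambda>_. v) \<in> spheroid_homotopic 1 (subtopology X (V \<inter> A)) v"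
  shows "\<exists>F. cell_push X A m \<delta> \<phi> F"
proof -
  have \<delta>: "\<delta> > 0" and \<phi>: "cmap_on (open_box m \<delta>) (subtopology X V) \<phi>"
    and \<phi>A: "\<And>x. infnorm (x - m) = \<delta> \<Longrightarrow> \<phi> (x, 1) \<in> A"
    using data by (auto simp: cell_data_def)
  let ?c = "square m \<delta>" and ?C = "square m \<delta> \<times> {0..1::real}"
  have c: "convex ?c" "compact ?c" "interior ?c \<noteq> {}"
  proof -
    show "interior ?c \<noteq> {}" using \<delta> by (simp add: square_eq interior_Times)
  qed (simp_all add: square_eq_cbox)
  have C: "convex ?C" "compact ?C" "interior ?C \<noteq> {}"
    using c by (auto intro!: convex_Times compact_Times simp: interior_Times)
  let ?\<tau> = "\<lambda>x. \<phi> (x, 1)"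
  \<comment> \<open>the edge of the lid belongs to the walls\<close>
  have top_edge: "(x, 1) \<in> open_box m \<delta>" if "x \<in> frontier ?c" for x
    using that unfolding frontier_square[OF \<delta>] by (simp add: open_box_def square_def)
  have \<tau>: "cmap_on (frontier ?c) (subtopology X V) ?\<tau>"
    by (rule continuous_map_compose_eu[OF \<phi>])
       (auto intro!: continuous_intros simp: top_edge)
  then have \<tau>A: "cmap_on (frontier ?c) (subtopology X (V \<inter> A)) ?\<tau>"
    using \<phi>A by (auto simp: continuous_map_in_subtopology frontier_square[OF \<delta>])
  have "fillable ?c (subtopology X V) ?\<tau>"
    unfolding fillable_def
  proof (intro exI[of _ "\<lambda>x. \<phi> (box_retract m \<delta> (x, 1))"] conjI ballI)
    have "continuous_on ?c (\<lambda>x. box_retract m \<delta> (x, 1))"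
      by (rule continuous_on_compose2[OF continuous_on_box_retract[OF \<delta>]]) (auto intro!: continuous_intros)
    moreover have "(\<lambda>x. box_retract m \<delta> (x, 1)) ` ?c \<subseteq> open_box m \<delta>" by (intro image_subsetI box_retract_in \<delta>) auto
    ultimately show "cmap_on ?c (subtopology X V) (\<lambda>x. \<phi> (box_retract m \<delta> (x, 1)))"
      by (rule continuous_map_compose_eu[OF \<phi>])
    show "\<phi> (box_retract m \<delta> (x, 1)) = \<phi> (x, 1)" if "x \<in> frontier ?c" for x
      using box_retract_id[OF \<delta> top_edge[OF that]] by simp
  qed
  then have "fillable ?c (subtopology X (V \<inter> A)) ?\<tau>"
    by (rule fillable_if_null_implies_null[OF cube_chart_1 c \<tau>A \<tau>, rotated]) (use pi1 in auto)
  then obtain g where g: "cmap_on ?c (subtopology X (V \<inter> A)) g"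
    "\<And>x. infnorm (x - m) = \<delta> \<Longrightarrow> g x = \<phi> (x, 1)"
    by (auto simp: fillable_def frontier_square[OF \<delta>])
  have gV: "cmap_on ?c (subtopology X V) g" and gA: "\<And>x. x \<in> ?c \<Longrightarrow> g x \<in> A"
    using g(1) by (auto simp: continuous_map_in_subtopology Pi_iff)
  \<comment> \<open>the 2-sphere made of floor, walls and lid\<close>
  define \<Phi> where "\<Phi> z = (if snd z = 1 then g (fst z) else \<phi> z)" for z
  have \<Phi>J: "\<Phi> z = \<phi> z" if "z \<in> open_box m \<delta>" for z
    using that g(2) by (auto simp: \<Phi>_def open_box_def)
  have "closed (open_box m \<delta>)"
  proof -
    have "open_box m \<delta> = ?C \<inter> ({z. snd z = 0} \<union> {z. infnorm (fst z - m) = \<delta>})" by (auto simp: open_box_def)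
    also have "closed \<dots>"
      using C(2) by (intro closed_Int closed_Un closed_Collect_eq continuous_intros compact_imp_closed)
    finally show ?thesis .
  qed
  then have "cmap_on (frontier ?C) (subtopology X V) \<Phi>"
    unfolding frontier_box[OF \<delta>]
  proof (rule continuous_map_Un_closed)
    show "closed (?c \<times> {1::real})" using c(2) by (intro closed_Times compact_imp_closed) auto
    show "cmap_on (open_box m \<delta>) (subtopology X V) \<Phi>"
      by (rule continuous_map_eq[OF \<phi>]) (simp add: \<Phi>J)
    show "cmap_on (?c \<times> {1}) (subtopology X V) \<Phi>"
      by (rule continuous_map_eq[OF continuous_map_compose_eu[OF gV, of _ fst]])
         (auto simp: \<Phi>_def intro!: continuous_intros)
  qed
  from fillable_if_trivial[OF cube_chart_2 C this] pi2 V
  have "fillable ?C (subtopology X V) \<Phi>" by auto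
  then obtain F where F: "cmap_on ?C (subtopology X V) F" "\<And>z. z \<in> frontier ?C \<Longrightarrow> F z = \<Phi> z"
    by (auto simp: fillable_def)
  have "cell_push X A m \<delta> \<phi> F"
    unfolding cell_push_def
  proof (intro conjI ballI)
    show "cmap_on ?C X F" using F(1) continuous_map_into_fulltopology by blast
    show "F z = \<phi> z" if "z \<in> open_box m \<delta>" for z
      using F(2)[of z] \<Phi>J[OF that] that by (simp add: frontier_box[OF \<delta>])
    show "F (x, 1) \<in> A" if "x \<in> ?c" for x
      using F(2)[of "(x,1)"] gA[OF that] that by (simp add: frontier_box[OF \<delta>] \<Phi>_def)
  qed
  then show ?thesis by blast
qed

section \<open>Pushing a subdivided square\<close>

lemma open_box_iff:
  assumes "\<delta> > 0"
  shows "((x, y), t) \<in> open_box m \<delta> \<longleftrightarrow>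
    x \<in> {fst m - \<delta>..fst m + \<delta>} \<and> y \<in> {snd m - \<delta>..snd m + \<delta>} \<and> t \<in> {0..1} \<and>
    (t = 0 \<or> x = fst m - \<delta> \<or> x = fst m + \<delta> \<or> y = snd m - \<delta> \<or> y = snd m + \<delta>)"
proof -
  have "max \<bar>u\<bar> \<bar>v\<bar> = \<delta> \<longleftrightarrow> u = - \<delta> \<or> u = \<delta> \<or> v = - \<delta> \<or> v = \<delta>" if "\<bar>u\<bar> \<le> \<delta>" "\<bar>v\<bar> \<le> \<delta>" for u v
    using that assms by linarith
  then have "infnorm ((x, y) - m) = \<delta> \<longleftrightarrow> x = fst m - \<delta> \<or> x = fst m + \<delta> \<or> y = snd m - \<delta> \<or> y = snd m + \<delta>"
    if "x \<in> {fst m - \<delta>..fst m + \<delta>}" "y \<in> {snd m - \<delta>..snd m + \<delta>}"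
    using that unfolding infnorm_real2 fst_diff snd_diff fst_conv snd_conv
    by (smt (verit, best) atLeastAtMost_iff)
  then show ?thesis unfolding open_box_def square_eq by auto
qed

context thin_complement begin

text \<open>
  The constant homotopy is preferred when nothing has to move; this makes the homotopy of the
  square stationary on its boundary.
\<close>

lemma edge_push_exists_fixed:
  assumes W: "openin X W" and data: "edge_data X A W a b p q0 q1"
  shows "\<exists>H. edge_push X A W a b p q0 q1 H \<and>
    (p ` {a..b} \<subseteq> A \<and> (\<forall>t\<in>{0..1}. q0 t = p a \<and> q1 t = p b) \<longrightarrow> (\<forall>s\<in>{a..b}. \<forall>t\<in>{0..1}. H (s, t) = p s))"
proof (cases "p ` {a..b} \<subseteq> A \<and> (\<forall>t\<in>{0..1}. q0 t = p a \<and> q1 t = p b)")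
  case True
  have p: "cmap_on {a..b} (subtopology X W) p" and ab: "a < b"
    using data by (auto simp: edge_data_def)
  have "cmap_on ({a..b} \<times> {0..1::real}) (subtopology X W) (\<lambda>z. p (fst z))"
    by (rule continuous_map_compose_eu[OF p]) (auto intro!: continuous_intros)
  then have "edge_push X A W a b p q0 q1 (\<lambda>z. p (fst z))"
    using True ab by (auto simp: edge_push_def)
  then show ?thesis by auto
next
  case False
  then show ?thesis using edge_push_exists[OF W data] by blast
qed

text \<open>
  The square is cut into small cells, each mapped into one of the given open sets. Corners are
  pushed first, then edges, then cells. A corner or an edge is pushed inside the intersection of the
  sets of all adjacent cells, so the tracks on the boundary of a cell stay in the set of that cell.
\<close>

lemma square_push_rel_boundary:
  fixes f :: "real \<times> real \<Rightarrow> 'a"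
  assumes f: "cmap_on ({0..1} \<times> {0..1}) X f"
    and bd: "\<And>x y. x \<in> {0..1} \<Longrightarrow> y \<in> {0..1} \<Longrightarrow> x = 0 \<or> x = 1 \<or> y = 0 \<or> y = 1 \<Longrightarrow> f (x, y) \<in> A"
    and cells_pushable: "\<And>x. x \<in> topspace X \<Longrightarrow> \<exists>V. openin X V \<and> x \<in> V \<and>
                 (\<forall>m \<delta> \<phi>. cell_data X A V m \<delta> \<phi> \<longrightarrow> (\<exists>F. cell_push X A m \<delta> \<phi> F))"
  obtains F where "cmap_on (({0..1} \<times> {0..1}) \<times> {0..1::real}) X F"
    "\<And>x y. x \<in> {0..1} \<Longrightarrow> y \<in> {0..1} \<Longrightarrow> F ((x, y), 0) = f (x, y)"
    "\<And>x y. x \<in> {0..1} \<Longrightarrow> y \<in> {0..1} \<Longrightarrow> F ((x, y), 1) \<in> A"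
    "\<And>x y t. x \<in> {0..1} \<Longrightarrow> y \<in> {0..1} \<Longrightarrow> x = 0 \<or> x = 1 \<or> y = 0 \<or> y = 1 \<Longrightarrow> t \<in> {0..1} \<Longrightarrow> F ((x, y), t) = f (x, y)"
proof -
  let ?Q = "{0..1::real} \<times> {0..1::real}"
  define \<U> where "\<U> = {V. openin X V \<and> (\<forall>m \<delta> \<phi>. cell_data X A V m \<delta> \<phi> \<longrightarrow> (\<exists>F. cell_push X A m \<delta> \<phi> F))}"
  have fX: "f z \<in> topspace X" if "z \<in> ?Q" for z
    using continuous_map_image_subset_topspace[OF f] that by auto
  have "\<exists>U\<in>\<U>. openin X U \<and> f z \<in> U" if "z \<in> ?Q" for z
    using cells_pushable[OF fX[OF that]] unfolding \<U>_def by blast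
  then obtain \<epsilon> where \<epsilon>: "\<epsilon> > 0" "\<And>z. z \<in> ?Q \<Longrightarrow> \<exists>U\<in>\<U>. openin X U \<and> f ` (?Q \<inter> ball z \<epsilon>) \<subseteq> U"
    by (rule Lebesgue_number_of_map[OF _ f, rotated]) (auto intro!: compact_Times)
  obtain n :: nat where n: "n > 0" "1 / real n < \<epsilon> / 2"
    using reals_Archimedean[of "\<epsilon> / 2"] \<epsilon>(1) by (metis half_gt_zero inverse_eq_divide zero_less_Suc)
  define g where "g k = real k / n" for k :: nat
  define c where "c i = {g i..g (Suc i)}" for i
  define \<delta> where "\<delta> = 1 / (2 * real n)"
  have \<delta>: "\<delta> > 0" using n by (simp add: \<delta>_def)
  have g_less: "g i < g j \<longleftrightarrow> i < j" and g_le: "g i \<le> g j \<longleftrightarrow> i \<le> j" for i j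
    using n by (auto simp: g_def divide_less_cancel divide_le_cancel)
  have g_inj: "g i = g j \<longleftrightarrow> i = j" for i j using g_less by (metis less_irrefl linorder_cases)
  have g0: "g 0 = 0" and gn: "g n = 1" using n by (auto simp: g_def)
  have g_Suc: "g (Suc i) = g i + 2 * \<delta>" for i by (simp add: g_def \<delta>_def add_divide_distrib)
  have g01: "g i \<in> {0..1}" if "i \<le> n" for i using that n by (simp add: g_def)
  have gc: "g I \<in> c i" if "I \<in> {i, Suc i}" for I i using that g_le by (auto simp: c_def)
  have c01: "x \<in> {0..1}" if "x \<in> c i" "i < n" for x i
    using that g01[of i] g01[of "Suc i"] by (auto simp: c_def)
  have share: "\<exists>I. I \<in> {i, Suc i} \<and> I \<in> {j, Suc j} \<and> x = g I" if x: "x \<in> c i" "x \<in> c j" and "i \<noteq> j" for x i j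
    using \<open>i \<noteq> j\<close> x
  proof (induction i j rule: linorder_wlog)
    case (le i j)
    then have "x \<le> g (Suc i)" "g j \<le> x" by (auto simp: c_def)
    then have "g j \<le> g (Suc i)" by simp
    then have "j = Suc i" using le g_le by auto
    then show ?case using \<open>x \<le> g (Suc i)\<close> \<open>g j \<le> x\<close> by (intro exI[of _ j]) auto
  next
    case (sym i j)
    then show ?case by blast
  qed
  have cover: "\<exists>i<n. x \<in> c i" if "x \<in> {0..1}" for x
    using unit_interval_grid_cover[OF n(1) that] by (simp add: c_def g_def add.commute)
  have "\<exists>V\<in>\<U>. f ` (c i \<times> c j) \<subseteq> V" if "i < n" "j < n" for i j
  proof -
    have "(g i, g j) \<in> ?Q" using that g01 by auto
    moreover have "c i \<times> c j \<subseteq> ?Q \<inter> ball (g i, g j) \<epsilon>"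
    proof
      fix z assume z: "z \<in> c i \<times> c j"
      then have "\<bar>g i - fst z\<bar> \<le> 2 * \<delta>" "\<bar>g j - snd z\<bar> \<le> 2 * \<delta>" by (auto simp: c_def g_Suc)
      moreover have "dist (g i, g j) z \<le> \<bar>g i - fst z\<bar> + \<bar>g j - snd z\<bar>"
        by (cases z) (simp add: dist_Pair_Pair dist_real_def sqrt_sum_squares_le_sum_abs)
      ultimately have "dist (g i, g j) z < \<epsilon>" using n by (simp add: \<delta>_def)
      then show "z \<in> ?Q \<inter> ball (g i, g j) \<epsilon>" using z c01 that by auto
    qed
    ultimately show ?thesis using \<epsilon>(2) by (meson dual_order.trans image_mono)
  qed
  then have "\<forall>i j. \<exists>V. i < n \<and> j < n \<longrightarrow> V \<in> \<U> \<and> f ` (c i \<times> c j) \<subseteq> V" by blast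
  then obtain V where V: "\<And>i j. i < n \<Longrightarrow> j < n \<Longrightarrow> V i j \<in> \<U>"
    "\<And>i j. i < n \<Longrightarrow> j < n \<Longrightarrow> f ` (c i \<times> c j) \<subseteq> V i j" by metis
  have Vo: "openin X (V i j)" if "i < n" "j < n" for i j using V(1)[OF that] by (simp add: \<U>_def)
  \<comment> \<open>rooms for a point and for the horizontal and vertical edges: intersections over the adjacent cells\<close>
  define N where "N z = (\<Inter>(i,j)\<in>{(i,j). i < n \<and> j < n \<and> z \<in> c i \<times> c j}. V i j) \<inter> topspace X" for z
  define Eh where "Eh i j = (\<Inter>j'\<in>{j'. j' < n \<and> j \<in> {j', Suc j'}}. V i j') \<inter> topspace X" for i j
  define Ev where "Ev i j = (\<Inter>i'\<in>{i'. i' < n \<and> i \<in> {i', Suc i'}}. V i' j) \<inter> topspace X" for i j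
  have No: "openin X (N z)" for z
    unfolding N_def
  proof (rule openin_INT)
    have "{(i,j). i < n \<and> j < n \<and> z \<in> c i \<times> c j} \<subseteq> {..<n} \<times> {..<n}" by auto
    then show "finite {(i,j). i < n \<and> j < n \<and> z \<in> c i \<times> c j}" by (rule finite_subset) auto
  qed (use Vo in auto)
  have Eho: "openin X (Eh i j)" if "i < n" for i j
    unfolding Eh_def using Vo that by (intro openin_INT) auto
  have Evo: "openin X (Ev i j)" if "j < n" for i j
    unfolding Ev_def using Vo that by (intro openin_INT) auto
  have fN: "f z \<in> N z" if "z \<in> ?Q" for z
    using V(2) fX[OF that] by (fastforce simp: N_def)
  have "\<forall>z. \<exists>r. z \<in> ?Q \<longrightarrow> cmap_on {0..1::real} (subtopology X (N z)) r \<and> r 0 = f z \<and> r 1 \<in> A \<and>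
        (f z \<in> A \<longrightarrow> r = (\<lambda>_. f z))"
    using push_point[OF No fN] by metis
  from choice[OF this] obtain r where
    "\<forall>z. z \<in> ?Q \<longrightarrow> cmap_on {0..1::real} (subtopology X (N z)) (r z) \<and> r z 0 = f z \<and> r z 1 \<in> A \<and>
        (f z \<in> A \<longrightarrow> r z = (\<lambda>_. f z))" ..
  then have r: "\<And>z. z \<in> ?Q \<Longrightarrow> cmap_on {0..1::real} (subtopology X (N z)) (r z)"
    "\<And>z. z \<in> ?Q \<Longrightarrow> r z 0 = f z" "\<And>z. z \<in> ?Q \<Longrightarrow> r z 1 \<in> A"
    "\<And>z. z \<in> ?Q \<Longrightarrow> f z \<in> A \<Longrightarrow> r z = (\<lambda>_. f z)"
    by blast+
  have fline: "cmap_on S (subtopology X W) (\<lambda>s. f (h s))"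
    if "continuous_on S h" "h ` S \<subseteq> ?Q" "\<And>s. s \<in> S \<Longrightarrow> f (h s) \<in> W" for h :: "real \<Rightarrow> _" and S W
    using continuous_map_compose_eu[OF f that(1,2)] that(3) by (auto simp: continuous_map_in_subtopology)
  have rsub: "cmap_on {0..1} (subtopology X W) (r z)" if "z \<in> ?Q" "N z \<subseteq> W" for z W
    using r(1)[OF that(1)] that(2) by (auto simp: continuous_map_in_subtopology)
  define EP where "EP W k e H \<longleftrightarrow> edge_push X A W (g k) (g (Suc k)) (\<lambda>s. f (e s)) (r (e (g k))) (r (e (g (Suc k)))) H \<and>
      ((\<forall>s\<in>c k. f (e s) \<in> A) \<longrightarrow> (\<forall>s\<in>c k. \<forall>t\<in>{0..1}. H (s, t) = f (e s)))" for W k e H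
  have edge: "\<exists>H. EP W k e H"
    if W: "openin X W" and e: "continuous_on (c k) e" "\<And>s. s \<in> c k \<Longrightarrow> e s \<in> ?Q"
      "\<And>s. s \<in> c k \<Longrightarrow> f (e s) \<in> W" and NW: "\<And>I. I \<in> {k, Suc k} \<Longrightarrow> N (e (g I)) \<subseteq> W" for W k e
  proof -
    have "cmap_on (c k) (subtopology X W) (\<lambda>s. f (e s))"
      by (rule fline[OF e(1) image_subsetI[OF e(2)] e(3)])
    then have "edge_data X A W (g k) (g (Suc k)) (\<lambda>s. f (e s)) (r (e (g k))) (r (e (g (Suc k))))"
      unfolding edge_data_def using rsub[OF e(2) NW] r(2,3)[OF e(2)] gc[of _ k] g_less by (simp add: c_def)
    from edge_push_exists_fixed[OF W this] obtain H where
      H: "edge_push X A W (g k) (g (Suc k)) (\<lambda>s. f (e s)) (r (e (g k))) (r (e (g (Suc k)))) H"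
      "(\<lambda>s. f (e s)) ` c k \<subseteq> A \<and> (\<forall>t\<in>{0..1}. r (e (g k)) t = f (e (g k)) \<and> r (e (g (Suc k))) t = f (e (g (Suc k)))) \<longrightarrow>
        (\<forall>s\<in>c k. \<forall>t\<in>{0..1}. H (s, t) = f (e s))"
      by (auto simp: c_def)
    then show ?thesis unfolding EP_def using r(4)[OF e(2)] gc[of _ k] by (intro exI[of _ H]) auto
  qed
  have "\<exists>H. EP (Eh i j) i (\<lambda>s. (s, g j)) H"
    if ij: "i < n" "j \<le> n" for i j
  proof (rule edge[OF Eho[OF ij(1)]])
    show Q: "(s, g j) \<in> ?Q" if "s \<in> c i" for s using that ij c01 g01 by auto
    show "N (g I, g j) \<subseteq> Eh i j" if I: "I \<in> {i, Suc i}" for I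
      using gc[OF I] gc ij(1) unfolding N_def Eh_def by blast
    show "f (s, g j) \<in> Eh i j" if "s \<in> c i" for s
    proof -
      have "f (s, g j) \<in> V i j'" if "j' < n" "j \<in> {j', Suc j'}" for j'
        using V(2)[OF ij(1) that(1)] \<open>s \<in> c i\<close> gc[OF that(2)] by blast
      then show ?thesis using fX[OF Q[OF that]] unfolding Eh_def by blast
    qed
  qed (intro continuous_intros)
  then obtain Gh where Gh: "\<And>i j. i < n \<Longrightarrow> j \<le> n \<Longrightarrow> EP (Eh i j) i (\<lambda>s. (s, g j)) (Gh i j)"
    by metis
  have "\<exists>H. EP (Ev i j) j (\<lambda>s. (g i, s)) H"
    if ij: "i \<le> n" "j < n" for i j
  proof (rule edge[OF Evo[OF ij(2)]])
    show Q: "(g i, s) \<in> ?Q" if "s \<in> c j" for s using that ij c01 g01 by auto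
    show "N (g i, g J) \<subseteq> Ev i j" if J: "J \<in> {j, Suc j}" for J
      using gc[OF J] gc ij(2) unfolding N_def Ev_def by blast
    show "f (g i, s) \<in> Ev i j" if "s \<in> c j" for s
    proof -
      have "f (g i, s) \<in> V i' j" if "i' < n" "i \<in> {i', Suc i'}" for i'
        using V(2)[OF that(1) ij(2)] \<open>s \<in> c j\<close> gc[OF that(2)] by blast
      then show ?thesis using fX[OF Q[OF that]] unfolding Ev_def by blast
    qed
  qed (intro continuous_intros)
  then obtain Gv where Gv: "\<And>i j. i \<le> n \<Longrightarrow> j < n \<Longrightarrow> EP (Ev i j) j (\<lambda>s. (g i, s)) (Gv i j)"
    by metis
  have Gh_fixed: "Gh i j (s, t) = f (s, g j)"
    if "i < n" "j \<le> n" "\<And>s. s \<in> c i \<Longrightarrow> f (s, g j) \<in> A" "s \<in> c i" "t \<in> {0..1}" for i j s t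
    using Gh[OF that(1,2)] that(3-5) unfolding EP_def by blast
  have Gv_fixed: "Gv i j (s, t) = f (g i, s)"
    if "i \<le> n" "j < n" "\<And>s. s \<in> c j \<Longrightarrow> f (g i, s) \<in> A" "s \<in> c j" "t \<in> {0..1}" for i j s t
    using Gv[OF that(1,2)] that(3-5) unfolding EP_def by blast
  have Gh0: "Gh i j (s, 0) = f (s, g j)" "Gh i j (s, 1) \<in> A" if "i < n" "j \<le> n" "s \<in> c i" for i j s
    using Gh[OF that(1,2)] that(3) by (simp_all add: EP_def edge_push_def c_def)
  have Gv0: "Gv i j (s, 0) = f (g i, s)" "Gv i j (s, 1) \<in> A" if "i \<le> n" "j < n" "s \<in> c j" for i j s
    using Gv[OF that(1,2)] that(3) by (simp_all add: EP_def edge_push_def c_def)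
  have Ghr: "Gh i j (g I, t) = r (g I, g j) t" if "i < n" "j \<le> n" "I \<in> {i, Suc i}" "t \<in> {0..1}" for i j I t
    using Gh[OF that(1,2)] that(3,4) by (auto simp: EP_def edge_push_def)
  have Gvr: "Gv i j (g J, t) = r (g i, g J) t" if "i \<le> n" "j < n" "J \<in> {j, Suc j}" "t \<in> {0..1}" for i j J t
    using Gv[OF that(1,2)] that(3,4) by (auto simp: EP_def edge_push_def)
  have GhV: "cmap_on (c i \<times> {0..1}) (subtopology X (V i j)) (Gh i J)"
    if "i < n" "j < n" "J \<in> {j, Suc j}" for i j J
  proof -
    have sub: "Eh i J \<subseteq> V i j" using that unfolding Eh_def by blast
    have "J \<le> n" using that by auto
    then have "cmap_on (c i \<times> {0..1}) (subtopology X (Eh i J)) (Gh i J)"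
      using Gh[OF that(1)] by (simp add: EP_def edge_push_def c_def)
    then show ?thesis by (rule continuous_map_into_larger[OF _ sub])
  qed
  have GvV: "cmap_on (c j \<times> {0..1}) (subtopology X (V i j)) (Gv I j)"
    if "i < n" "j < n" "I \<in> {i, Suc i}" for i j I
  proof -
    have sub: "Ev I j \<subseteq> V i j" using that unfolding Ev_def by blast
    have "I \<le> n" using that by auto
    then have "cmap_on (c j \<times> {0..1}) (subtopology X (Ev I j)) (Gv I j)"
      using Gv[OF _ that(2)] by (simp add: EP_def edge_push_def c_def)
    then show ?thesis by (rule continuous_map_into_larger[OF _ sub])
  qed
  define m where "m i j = (g i + \<delta>, g j + \<delta>)" for i j
  have sq: "square (m i j) \<delta> = c i \<times> c j" for i j
    by (simp add: square_eq m_def c_def g_Suc add.commute)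
  have ob: "((x, y), t) \<in> open_box (m i j) \<delta> \<longleftrightarrow> x \<in> c i \<and> y \<in> c j \<and> t \<in> {0..1} \<and>
      (t = 0 \<or> (\<exists>I\<in>{i, Suc i}. x = g I) \<or> (\<exists>J\<in>{j, Suc j}. y = g J))" for x y t i j
    unfolding open_box_iff[OF \<delta>] by (auto simp: m_def c_def g_Suc)
  define CP where "CP i j F \<longleftrightarrow> cmap_on ((c i \<times> c j) \<times> {0..1}) X F \<and>
      (\<forall>x\<in>c i. \<forall>y\<in>c j. F ((x, y), 0) = f (x, y) \<and> F ((x, y), 1) \<in> A) \<and>
      (\<forall>J\<in>{j, Suc j}. \<forall>x\<in>c i. \<forall>t\<in>{0..1}. F ((x, g J), t) = Gh i J (x, t)) \<and>
      (\<forall>I\<in>{i, Suc i}. \<forall>y\<in>c j. \<forall>t\<in>{0..1}. F ((g I, y), t) = Gv I j (y, t))" for i j F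
  have "\<exists>F. CP i j F"
    if ij: "i < n" "j < n" for i j
  proof -
    \<comment> \<open>floor and walls of the box over the cell\<close>
    define \<Phi> where "\<Phi> = (\<lambda>((x, y), t). if t = 0 then f (x, y) else if y = g j then Gh i j (x, t)
       else if y = g (Suc j) then Gh i (Suc j) (x, t) else if x = g i then Gv i j (y, t) else Gv (Suc i) j (y, t::real))"
    have \<Phi>0: "\<Phi> ((x, y), 0) = f (x, y)" for x y by (simp add: \<Phi>_def)
    have \<Phi>h: "\<Phi> ((x, g J), t) = Gh i J (x, t)" if "J \<in> {j, Suc j}" "x \<in> c i" "t \<in> {0..1}" for J x t
    proof -
      have "J \<le> n" using that ij by auto
      then show ?thesis using that Gh0(1)[OF ij(1) _ that(2)] g_inj[of j "Suc j"] by (auto simp: \<Phi>_def)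
    qed
    have \<Phi>v: "\<Phi> ((g I, y), t) = Gv I j (y, t)" if "I \<in> {i, Suc i}" "y \<in> c j" "t \<in> {0..1}" for I y t
    proof -
      have In: "I \<le> n" using that ij by auto
      \<comment> \<open>horizontal and vertical edges follow the same track at a common corner\<close>
      have corner: "Gh i J (g I, t) = Gv I j (g J, t)" if "J \<in> {j, Suc j}" for J
        using Ghr[of i J I t] Gvr[of I j J t] that In ij \<open>I \<in> {i, Suc i}\<close> \<open>t \<in> {0..1}\<close> by auto
      show ?thesis
      proof (cases "t = 0")
        case True then show ?thesis using Gv0(1)[OF In ij(2) that(2)] by (simp add: \<Phi>_def)
      next
        case False
        then show ?thesis using that corner[of j] corner[of "Suc j"] g_inj[of i "Suc i"] by (auto simp: \<Phi>_def)
      qed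
    qed
    have cl: "closed (c k)" for k by (simp add: c_def)
    have hor: "cmap_on ((c i \<times> {g J}) \<times> {0..1}) (subtopology X (V i j)) \<Phi>" if "J \<in> {j, Suc j}" for J
      by (rule continuous_map_eq[OF continuous_map_compose_eu[OF GhV[OF ij that], of _ "\<lambda>z. (fst (fst z), snd z)"]])
         (use that in \<open>auto simp: \<Phi>h intro!: continuous_intros\<close>)
    have ver: "cmap_on (({g I} \<times> c j) \<times> {0..1}) (subtopology X (V i j)) \<Phi>" if "I \<in> {i, Suc i}" for I
      by (rule continuous_map_eq[OF continuous_map_compose_eu[OF GvV[OF ij that], of _ "\<lambda>z. (snd (fst z), snd z)"]])
         (use that in \<open>auto simp: \<Phi>v intro!: continuous_intros\<close>)
    have "c i \<times> c j \<subseteq> ?Q" using c01 ij by blast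
    then have "cmap_on (c i \<times> c j) (subtopology X (V i j)) f"
      using V(2)[OF ij] continuous_map_from_subtopology_mono[OF f]
      by (auto simp: continuous_map_in_subtopology)
    then have bot: "cmap_on ((c i \<times> c j) \<times> {0::real}) (subtopology X (V i j)) \<Phi>"
      by (rule continuous_map_eq[OF continuous_map_compose_eu[of _ _ f _ fst]])
         (auto simp: \<Phi>0 intro!: continuous_intros)
    have "cmap_on ((c i \<times> c j) \<times> {0} \<union>
        (((c i \<times> {g j}) \<times> {0..1} \<union> (c i \<times> {g (Suc j)}) \<times> {0..1}) \<union>
         (({g i} \<times> c j) \<times> {0..1} \<union> ({g (Suc i)} \<times> c j) \<times> {0..1}))) (subtopology X (V i j)) \<Phi>"
      by (intro continuous_map_Un_closed closed_Un closed_Times cl bot hor ver) auto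
    moreover have "open_box (m i j) \<delta> = (c i \<times> c j) \<times> {0} \<union>
        (((c i \<times> {g j}) \<times> {0..1} \<union> (c i \<times> {g (Suc j)}) \<times> {0..1}) \<union>
         (({g i} \<times> c j) \<times> {0..1} \<union> ({g (Suc i)} \<times> c j) \<times> {0..1}))"
      (is "_ = ?R")
    proof (rule Set.set_eqI)
      fix z :: "(real \<times> real) \<times> real"
      obtain x y t where z: "z = ((x, y), t)" by (metis surj_pair)
      have "g i \<in> c i" "g (Suc i) \<in> c i" "g j \<in> c j" "g (Suc j) \<in> c j" using gc by auto
      then show "z \<in> open_box (m i j) \<delta> \<longleftrightarrow> z \<in> ?R" unfolding z ob by auto
    qed
    ultimately have "cmap_on (open_box (m i j) \<delta>) (subtopology X (V i j)) \<Phi>" by simp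
    moreover have "\<Phi> (x, 1) \<in> A" if "infnorm (x - m i j) = \<delta>" for x
    proof -
      obtain x1 x2 where [simp]: "x = (x1, x2)" by fastforce
      have "((x1, x2), 1) \<in> open_box (m i j) \<delta>" using that \<delta> by (simp add: open_box_def square_def)
      then have xc: "x1 \<in> c i" "x2 \<in> c j" and "(\<exists>I\<in>{i, Suc i}. x1 = g I) \<or> (\<exists>J\<in>{j, Suc j}. x2 = g J)"
        unfolding ob by auto
      then consider I where "I \<in> {i, Suc i}" "x1 = g I" | J where "J \<in> {j, Suc j}" "x2 = g J" by blast
      then show ?thesis
      proof cases
        case 1
        then have "I \<le> n" using ij by auto
        then show ?thesis using 1 \<Phi>v[OF 1(1) xc(2), of 1] Gv0(2)[OF _ ij(2) xc(2)] by simp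
      next
        case 2
        then have "J \<le> n" using ij by auto
        then show ?thesis using 2 \<Phi>h[OF 2(1) xc(1), of 1] Gh0(2)[OF ij(1) _ xc(1)] by simp
      qed
    qed
    ultimately have "cell_data X A (V i j) (m i j) \<delta> \<Phi>" using \<delta> by (simp add: cell_data_def)
    then obtain F where F: "cell_push X A (m i j) \<delta> \<Phi> F" using V(1)[OF ij] unfolding \<U>_def by blast
    have Fob: "F ((x, y), t) = \<Phi> ((x, y), t)" if "((x, y), t) \<in> open_box (m i j) \<delta>" for x y t
      using F that by (simp add: cell_push_def)
    show ?thesis
      unfolding CP_def
    proof (intro exI[of _ F] conjI ballI)
      show "cmap_on ((c i \<times> c j) \<times> {0..1}) X F" using F by (simp add: cell_push_def sq)
      show "F ((x, y), 0) = f (x, y)" if "x \<in> c i" "y \<in> c j" for x y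
        using Fob[of x y 0] that by (simp add: ob \<Phi>0)
      show "F ((x, y), 1) \<in> A" if "x \<in> c i" "y \<in> c j" for x y
        using F that by (simp add: cell_push_def sq)
      show "F ((x, g J), t) = Gh i J (x, t)" if "J \<in> {j, Suc j}" "x \<in> c i" "t \<in> {0..1}" for J x t
      proof -
        have "((x, g J), t) \<in> open_box (m i j) \<delta>" unfolding ob using that gc[OF that(1)] by blast
        then show ?thesis using Fob \<Phi>h[OF that] by simp
      qed
      show "F ((g I, y), t) = Gv I j (y, t)" if "I \<in> {i, Suc i}" "y \<in> c j" "t \<in> {0..1}" for I y t
      proof -
        have "((g I, y), t) \<in> open_box (m i j) \<delta>" unfolding ob using that gc[OF that(1)] by blast
        then show ?thesis using Fob \<Phi>v[OF that] by simp
      qed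
    qed
  qed
  then have "\<forall>p. \<exists>F. fst p < n \<and> snd p < n \<longrightarrow> CP (fst p) (snd p) F" by blast
  from choice[OF this] obtain F where F: "\<forall>p. fst p < n \<and> snd p < n \<longrightarrow> CP (fst p) (snd p) (F p)" ..
  have CP: "CP i j (F (i, j))" if "i < n" "j < n" for i j
    using F[rule_format, of "(i, j)"] that by simp
  have Fc: "cmap_on ((c i \<times> c j) \<times> {0..1}) X (F (i, j))" if "i < n" "j < n" for i j
    using CP[OF that] unfolding CP_def by blast
  have F0: "F (i, j) ((x, y), 0) = f (x, y)" "F (i, j) ((x, y), 1) \<in> A" if "i < n" "j < n" "x \<in> c i" "y \<in> c j" for i j x y
    using CP[OF that(1,2)] that(3,4) unfolding CP_def by blast+
  have Fh: "F (i, j) ((x, g J), t) = Gh i J (x, t)" if "i < n" "j < n" "J \<in> {j, Suc j}" "x \<in> c i" "t \<in> {0..1}" for i j J x t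
    using CP[OF that(1,2)] that(3-5) unfolding CP_def by blast
  have Fv: "F (i, j) ((g I, y), t) = Gv I j (y, t)" if "i < n" "j < n" "I \<in> {i, Suc i}" "y \<in> c j" "t \<in> {0..1}" for i j I y t
    using CP[OF that(1,2)] that(3-5) unfolding CP_def by blast
  \<comment> \<open>two cells share an edge or a corner, and on either the homotopy was fixed before\<close>
  have agree: "F (i, j) ((x, y), t) = F (i', j') ((x, y), t)"
    if b: "i < n" "j < n" "i' < n" "j' < n" and x: "x \<in> c i" "x \<in> c i'" and y: "y \<in> c j" "y \<in> c j'" and t: "t \<in> {0..1}"
    for i j i' j' x y t
  proof (cases "i = i'")
    case True
    show ?thesis
    proof (cases "j = j'")
      case False
      then obtain J where J: "J \<in> {j, Suc j}" "J \<in> {j', Suc j'}" "y = g J" using share[OF y] by blast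
      then show ?thesis using Fh[OF b(1,2) J(1) x(1) t] Fh[OF b(3,4) J(2) x(2) t] True by simp
    qed (use True in simp)
  next
    case False
    then obtain I where I: "I \<in> {i, Suc i}" "I \<in> {i', Suc i'}" "x = g I" using share[OF x] by blast
    note 1 = Fv[OF b(1,2) I(1) y(1) t] and 2 = Fv[OF b(3,4) I(2) y(2) t]
    show ?thesis
    proof (cases "j = j'")
      case True
      then show ?thesis using 1 2 I by simp
    next
      case False
      then obtain J where J: "J \<in> {j, Suc j}" "J \<in> {j', Suc j'}" "y = g J" using share[OF y] by blast
      have "I \<le> n" using I(1) b by auto
      then have "Gv I j (y, t) = Gv I j' (y, t)"
        using Gvr[OF _ b(2) J(1) t] Gvr[OF _ b(4) J(2) t] J(3) by simp
      then show ?thesis using 1 2 I by simp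
    qed
  qed
  obtain G where G: "cmap_on (\<Union>p\<in>{..<n}\<times>{..<n}. (c (fst p) \<times> c (snd p)) \<times> {0..1}) X G"
    "\<And>p z. p \<in> {..<n} \<times> {..<n} \<Longrightarrow> z \<in> (c (fst p) \<times> c (snd p)) \<times> {0..1} \<Longrightarrow> G z = F p z"
  proof (rule glue_finite_closed[of "{..<n}\<times>{..<n}" "\<lambda>p. (c (fst p) \<times> c (snd p)) \<times> {0..1}" X F])
    show "cmap_on ((c (fst p) \<times> c (snd p)) \<times> {0..1}) X (F p)" if "p \<in> {..<n} \<times> {..<n}" for p
      using Fc[of "fst p" "snd p"] that by auto
    show "closed ((c (fst p) \<times> c (snd p)) \<times> {0..1::real})" for p by (intro closed_Times) (auto simp: c_def)
    fix p p' z assume "p \<in> {..<n} \<times> {..<n}" "p' \<in> {..<n} \<times> {..<n}" "z \<in> (c (fst p) \<times> c (snd p)) \<times> {0..1::real}" "z \<in> (c (fst p') \<times> c (snd p')) \<times> {0..1::real}"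
    then show "F p z = F p' z"
      using agree[of "fst p" "snd p" "fst p'" "snd p'" "fst (fst z)" "snd (fst z)" "snd z"] by auto
  qed auto
  have GF: "G ((x, y), t) = F (i, j) ((x, y), t)" if "i < n" "j < n" "x \<in> c i" "y \<in> c j" "t \<in> {0..1}" for i j x y t
    using G(2)[of "(i, j)" "((x, y), t)"] that by simp
  have "?Q \<times> {0..1::real} \<subseteq> (\<Union>p\<in>{..<n}\<times>{..<n}. (c (fst p) \<times> c (snd p)) \<times> {0..1::real})"
  proof
    fix z assume "z \<in> ?Q \<times> {0..1::real}"
    then obtain x y t :: real where z: "z = ((x, y), t)" "x \<in> {0..1::real}" "y \<in> {0..1::real}" "t \<in> {0..1::real}" by auto
    then obtain i j where "i < n" "x \<in> c i" "j < n" "y \<in> c j" using cover by blast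
    then show "z \<in> (\<Union>p\<in>{..<n}\<times>{..<n}. (c (fst p) \<times> c (snd p)) \<times> {0..1::real})"
      using z by (intro UN_I[of "(i, j)"]) auto
  qed
  from continuous_map_from_subtopology_mono[OF G(1) this]
  have Gc: "cmap_on (?Q \<times> {0..1}) X G" .
  show ?thesis
  proof (rule that[OF Gc])
    fix x y :: real assume xy: "x \<in> {0..1}" "y \<in> {0..1}"
    then obtain i j where ij: "i < n" "x \<in> c i" "j < n" "y \<in> c j" using cover by blast
    then show "G ((x, y), 0) = f (x, y)" "G ((x, y), 1) \<in> A" using GF[of i j x y] F0[of i j x y] by auto
    fix t :: real assume t: "t \<in> {0..1}" and "x = 0 \<or> x = 1 \<or> y = 0 \<or> y = 1"
    then consider "x = g 0" | "x = g n" | "y = g 0" | "y = g n" using g0 gn by auto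
    then show "G ((x, y), t) = f (x, y)"
    proof cases
      case 1
      have "f (g 0, s) \<in> A" if "s \<in> c j" for s using bd[of "g 0" s] c01[OF that ij(3)] g0 by auto
      then show ?thesis using 1 GF[of 0 j x y t] Fv[of 0 j 0 y t] Gv_fixed[of 0 j y t] gc[of 0 0] n ij t by simp
    next
      case 2
      have "f (g n, s) \<in> A" if "s \<in> c j" for s using bd[of "g n" s] c01[OF that ij(3)] gn by auto
      then show ?thesis using 2 GF[of "n - 1" j x y t] Fv[of "n - 1" j n y t] Gv_fixed[of n j y t] gc[of n "n - 1"] n ij t by simp
    next
      case 3
      have "f (s, g 0) \<in> A" if "s \<in> c i" for s using bd[of s "g 0"] c01[OF that ij(1)] g0 by auto
      then show ?thesis using 3 GF[of i 0 x y t] Fh[of i 0 0 x t] Gh_fixed[of i 0 x t] gc[of 0 0] n ij t by simp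
    next
      case 4
      have "f (s, g n) \<in> A" if "s \<in> c i" for s using bd[of s "g n"] c01[OF that ij(1)] gn by auto
      then show ?thesis using 4 GF[of i "n - 1" x y t] Fh[of i "n - 1" n x t] Gh_fixed[of i n x t] gc[of n "n - 1"] n ij t by simp
    qed
  qed
qed

end

section \<open>Triangulated spaces are locally contractible\<close>

text \<open>
  The tube lemma, in the form that projection along a compact factor is closed.
\<close>

lemma openin_forall_compact:
  assumes O: "openin (prod_topology Z (top_of_set T)) O'" and T: "compact T"
  shows "openin Z {z \<in> topspace Z. \<forall>t\<in>T. (z, t) \<in> O'}"
proof -
  have "closedin (prod_topology Z (top_of_set T)) (topspace (prod_topology Z (top_of_set T)) - O')"
    using O by blast
  moreover have "closed_map (prod_topology Z (top_of_set T)) Z fst"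
    using T by (intro Abstract_Topological_Spaces.closed_map_fst) (simp add: compact_space_subtopology)
  ultimately have "closedin Z (fst ` (topspace (prod_topology Z (top_of_set T)) - O'))"
    unfolding closed_map_def by blast
  then have "openin Z (topspace Z - fst ` (topspace (prod_topology Z (top_of_set T)) - O'))" by blast
  moreover have "topspace Z - fst ` (topspace (prod_topology Z (top_of_set T)) - O') = {z \<in> topspace Z. \<forall>t\<in>T. (z, t) \<in> O'}"
    by force
  ultimately show ?thesis by simp
qed

lemma closed_closed_simplex: "closed (closed_simplex \<sigma> :: ('v \<Rightarrow> real) set)"
proof -
  have "closed_simplex \<sigma> = {b. \<forall>v. 0 \<le> b v} \<inter> {b. \<forall>v. v \<notin> \<sigma> \<longrightarrow> b v = 0} \<inter> {b. (\<Sum>v\<in>\<sigma>. b v) = (1::real)}"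
    by (auto simp: closed_simplex_def)
  moreover have "closed {b::'v \<Rightarrow> real. v \<notin> \<sigma> \<longrightarrow> b v = 0}" for v
    by (cases "v \<in> \<sigma>") (auto intro!: closed_Collect_eq continuous_intros)
  ultimately show ?thesis
    by (auto intro!: closed_Int closed_Collect_all closed_Collect_le closed_Collect_eq continuous_intros)
qed

lemma closed_simplex_mono:
  assumes "b \<in> closed_simplex \<tau>" "finite \<tau>" "finite \<sigma>" "\<And>v. b v \<noteq> 0 \<Longrightarrow> v \<in> \<sigma>"
  shows "b \<in> closed_simplex \<sigma>"
proof -
  have "sum b \<sigma> = sum b (\<sigma> \<inter> \<tau>)"
    using assms by (intro sum.mono_neutral_right) (auto simp: closed_simplex_def)
  also have "\<dots> = sum b \<tau>"
    using assms by (intro sum.mono_neutral_left) auto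
  finally show ?thesis using assms by (auto simp: closed_simplex_def)
qed

lemma closed_simplex_combination:
  assumes "v \<in> closed_simplex \<sigma>" "b \<in> closed_simplex \<sigma>" "0 \<le> t" "t \<le> 1"
  shows "(\<lambda>u. (1 - t) * v u + t * b u) \<in> closed_simplex \<sigma>"
  using assms by (auto simp: closed_simplex_def sum.distrib simp flip: sum_distrib_left)

text \<open>
  A closed simplex meets the subcomplex in a union of its own faces, of which there are only
  finitely many.
\<close>

lemma openin_complement_subcomplex:
  assumes K: "abstract_simplicial_complex K" and L: "L \<subseteq> K"
  shows "openin (realization K) (topspace (realization K) - (\<Union>\<tau>\<in>L. closed_simplex \<tau>))"
  unfolding openin_realization realization_open_def topspace_realization
proof (intro conjI ballI)
  fix \<sigma> assume \<sigma>: "\<sigma> \<in> K"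
  have fin: "finite \<rho>" if "\<rho> \<in> K" for \<rho> using K that by (auto simp: abstract_simplicial_complex_def)
  define C where "C = (\<Union>\<rho>\<in>(\<lambda>\<tau>. \<tau> \<inter> \<sigma>) ` L. closed_simplex \<rho>)"
  have "closed C"
    unfolding C_def
  proof (intro closed_UN ballI closed_closed_simplex)
    show "finite ((\<lambda>\<tau>. \<tau> \<inter> \<sigma>) ` L)" by (rule finite_subset[of _ "Pow \<sigma>"]) (use fin[OF \<sigma>] in auto)
  qed
  moreover have "(\<Union>\<tau>\<in>L. closed_simplex \<tau>) \<inter> closed_simplex \<sigma> = C"
  proof (intro Set.equalityI subsetI)
    fix b assume "b \<in> (\<Union>\<tau>\<in>L. closed_simplex \<tau>) \<inter> closed_simplex \<sigma>"
    then obtain \<tau> where \<tau>: "\<tau> \<in> L" "b \<in> closed_simplex \<tau>" "b \<in> closed_simplex \<sigma>" by blast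
    have "b \<in> closed_simplex (\<tau> \<inter> \<sigma>)"
      by (rule closed_simplex_mono[OF \<tau>(2)]) (use \<tau> L fin \<sigma> in \<open>auto simp: closed_simplex_def\<close>)
    then show "b \<in> C" using \<tau> by (auto simp: C_def)
  next
    fix b assume "b \<in> C"
    then obtain \<tau> where \<tau>: "\<tau> \<in> L" "b \<in> closed_simplex (\<tau> \<inter> \<sigma>)" by (auto simp: C_def)
    have "b \<in> closed_simplex \<tau>"
      by (rule closed_simplex_mono[OF \<tau>(2)]) (use \<tau> L fin \<sigma> in \<open>auto simp: closed_simplex_def\<close>)
    moreover have "b \<in> closed_simplex \<sigma>"
      by (rule closed_simplex_mono[OF \<tau>(2)]) (use \<tau> L fin \<sigma> in \<open>auto simp: closed_simplex_def\<close>)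
    ultimately show "b \<in> (\<Union>\<tau>\<in>L. closed_simplex \<tau>) \<inter> closed_simplex \<sigma>" using \<tau> by blast
  qed
  ultimately have "((\<Union>\<sigma>\<in>K. closed_simplex \<sigma>) - (\<Union>\<tau>\<in>L. closed_simplex \<tau>)) \<inter> closed_simplex \<sigma> = closed_simplex \<sigma> \<inter> - C"
    using \<sigma> by blast
  then show "openin (top_of_set (closed_simplex \<sigma>)) (((\<Union>\<sigma>\<in>K. closed_simplex \<sigma>) - (\<Union>\<tau>\<in>L. closed_simplex \<tau>)) \<inter> closed_simplex \<sigma>)"
    using openin_open_Int[of "- C" "closed_simplex \<sigma>"] \<open>closed C\<close> by (simp add: open_Compl)
qed auto

context
  fixes K :: "'v set set" and b :: "'v \<Rightarrow> real" and S :: "'v set" and H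
  assumes K: "abstract_simplicial_complex K" and b: "b \<in> topspace (realization K)"
  defines "S \<equiv> {u. b u \<noteq> 0}"
    and "H \<equiv> \<lambda>(v :: 'v \<Rightarrow> real, t::real). (\<lambda>u. (1 - t) * v u + t * b u)"
begin

lemma b_in_simplex: "b \<in> closed_simplex \<sigma>" if "\<sigma> \<in> K" "S \<subseteq> \<sigma>"
proof -
  obtain \<tau> where "\<tau> \<in> K" "b \<in> closed_simplex \<tau>" using b by (auto simp: topspace_realization)
  then show ?thesis
  proof (elim closed_simplex_mono)
    show "finite \<tau>" "finite \<sigma>"
      using \<open>\<tau> \<in> K\<close> that(1) K unfolding abstract_simplicial_complex_def by blast+
    show "v \<in> \<sigma>" if "b v \<noteq> 0" for v using that \<open>S \<subseteq> \<sigma>\<close> unfolding S_def by blast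
  qed
qed

lemma finite_S: "finite S"
proof -
  obtain \<tau> where "\<tau> \<in> K" "b \<in> closed_simplex \<tau>" using b by (auto simp: topspace_realization)
  then have "S \<subseteq> \<tau>" "finite \<tau>"
    using K unfolding S_def closed_simplex_def abstract_simplicial_complex_def by blast+
  then show ?thesis using finite_subset by blast
qed

lemma star_in_simplex: "S \<subseteq> \<sigma>" if "v \<in> closed_simplex \<sigma>" "\<forall>u\<in>S. v u > 0"
proof
  fix u assume "u \<in> S"
  then have "v u > 0" using that(2) by blast
  then show "u \<in> \<sigma>" using that(1) by (auto simp: closed_simplex_def)
qed

lemma H_in_simplex: "H (v, t) \<in> closed_simplex \<sigma>" if "\<sigma> \<in> K" "v \<in> closed_simplex \<sigma>" "S \<subseteq> \<sigma>" "t \<in> {0..1}"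
  using closed_simplex_combination[OF that(2) b_in_simplex[OF that(1,3)], of t] that(4) by (simp add: H_def)

lemma continuous_on_H: "continuous_on D H"
  unfolding H_def case_prod_beta
proof (rule continuous_on_coordinatewise_then_product)
  fix u
  have "continuous_on D (\<lambda>p :: ('v \<Rightarrow> real) \<times> real. fst p u)"
    by (rule continuous_on_compose2[OF continuous_on_product_coordinates continuous_on_fst[OF continuous_on_id]]) simp
  then show "continuous_on D (\<lambda>p. (1 - snd p) * fst p u + snd p * b u)"
    by (intro continuous_on_add continuous_on_mult continuous_on_diff continuous_on_const continuous_on_snd continuous_on_id)
qed

text \<open>
  Openness may be tested on one closed simplex at a time, where the topology is metrizable and the
  straight-line homotopy is jointly continuous, so the tube lemma applies. A simplex that does not
  contain the support of \<open>b\<close> does not meet the star.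
\<close>

lemma openin_star_tube:
  assumes U: "openin (realization K) U" and T: "compact T" "T \<subseteq> {0..1}"
  shows "openin (realization K) {v \<in> topspace (realization K). (\<forall>u\<in>S. v u > 0) \<and> (\<forall>t\<in>T. H (v, t) \<in> U)}" (is "openin _ ?V")
  unfolding openin_realization realization_open_def
proof (intro conjI ballI)
  show "?V \<subseteq> (\<Union>\<sigma>\<in>K. closed_simplex \<sigma>)" by (auto simp: topspace_realization)
  fix \<sigma> assume \<sigma>: "\<sigma> \<in> K"
  let ?Z = "top_of_set (closed_simplex \<sigma>)"
  show "openin ?Z (?V \<inter> closed_simplex \<sigma>)"
  proof (cases "S \<subseteq> \<sigma>")
    case False
    then have "?V \<inter> closed_simplex \<sigma> = {}" using star_in_simplex by blast
    then show ?thesis by simp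
  next
    case True
    have "continuous_map (prod_topology ?Z (top_of_set T)) ?Z H"
      using H_in_simplex[OF \<sigma> _ True] T(2) by (auto intro!: continuous_on_H)
    moreover have "openin ?Z (U \<inter> closed_simplex \<sigma>)"
      using U \<sigma> by (simp add: openin_realization realization_open_def)
    ultimately have "openin (prod_topology ?Z (top_of_set T)) {z \<in> topspace (prod_topology ?Z (top_of_set T)). H z \<in> U \<inter> closed_simplex \<sigma>}"
      by (rule openin_continuous_map_preimage)
    from openin_forall_compact[OF this T(1)]
    have 1: "openin ?Z {v \<in> closed_simplex \<sigma>. \<forall>t\<in>T. H (v, t) \<in> U}"
    proof (rule back_subst[where P = "openin ?Z"])
      show "{z \<in> topspace ?Z. \<forall>t\<in>T. (z, t) \<in> {z \<in> topspace (prod_topology ?Z (top_of_set T)). H z \<in> U \<inter> closed_simplex \<sigma>}}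
        = {v \<in> closed_simplex \<sigma>. \<forall>t\<in>T. H (v, t) \<in> U}"
        using H_in_simplex[OF \<sigma> _ True] T(2) by (auto simp: subset_iff)
    qed
    have "open (\<Inter>u\<in>S. {v::'v \<Rightarrow> real. v u > 0})"
      using finite_S by (intro open_INT) (auto intro!: open_Collect_less continuous_intros)
    then have "openin ?Z (closed_simplex \<sigma> \<inter> (\<Inter>u\<in>S. {v. v u > 0}))" by (rule openin_open_Int)
    from openin_Int[OF this 1]
    show ?thesis
    proof (rule back_subst[where P = "openin ?Z"])
      show "closed_simplex \<sigma> \<inter> (\<Inter>u\<in>S. {v. v u > 0}) \<inter> {v \<in> closed_simplex \<sigma>. \<forall>t\<in>T. H (v, t) \<in> U} = ?V \<inter> closed_simplex \<sigma>"
        using \<sigma> by (auto simp: topspace_realization)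
    qed
  qed
qed

text \<open>
  Joint continuity does not follow from continuity on each simplex, since the weak topology need not
  be compatible with products. Shrinking the time interval to a compact neighbourhood and applying
  \<open>openin_star_tube\<close> to it yields product neighbourhoods directly.
\<close>

lemma continuous_map_H_star:
  "continuous_map (prod_topology (subtopology (realization K) {v. \<forall>u\<in>S. v u > 0}) (top_of_set {0..1})) (realization K) H"
proof -
  let ?R = "realization K"
  let ?P = "prod_topology (subtopology ?R {v. \<forall>u\<in>S. v u > 0}) (top_of_set {0..1::real})"
  have top: "topspace ?P = {v \<in> topspace ?R. \<forall>u\<in>S. v u > 0} \<times> {0..1}" by auto
  have HR: "H (v, t) \<in> topspace ?R" if v: "v \<in> topspace ?R" "\<forall>u\<in>S. v u > 0" "t \<in> {0..1}" for v t
  proof -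
    obtain \<sigma> where "\<sigma> \<in> K" "v \<in> closed_simplex \<sigma>" using v(1) by (auto simp: topspace_realization)
    then show ?thesis using H_in_simplex[of \<sigma> v t] star_in_simplex[of v \<sigma>] v by (auto simp: topspace_realization)
  qed
  have "openin ?P {z \<in> topspace ?P. H z \<in> U}" if U: "openin ?R U" for U
  proof (subst openin_subopen, intro ballI)
    fix z assume "z \<in> {z \<in> topspace ?P. H z \<in> U}"
    then obtain v0 t0 where z: "z = (v0, t0)" and v0: "v0 \<in> topspace ?R" "\<forall>u\<in>S. v0 u > 0"
      and t0: "t0 \<in> {0..1}" and HU: "H (v0, t0) \<in> U" by (auto simp: top)
    obtain \<sigma> where \<sigma>: "\<sigma> \<in> K" "v0 \<in> closed_simplex \<sigma>" using v0 by (auto simp: topspace_realization)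
    have S\<sigma>: "S \<subseteq> \<sigma>" using star_in_simplex \<sigma> v0 by blast
    have "cmap_on {0..1} (top_of_set (closed_simplex \<sigma>)) (\<lambda>t. H (v0, t))"
    proof -
      have "continuous_on {0..1} (\<lambda>t. H (v0, t))"
        by (rule continuous_on_compose2[OF continuous_on_H[of UNIV] continuous_on_Pair[OF continuous_on_const continuous_on_id]]) simp
      then show ?thesis using H_in_simplex[OF \<sigma> S\<sigma>] by auto
    qed
    moreover have "openin (top_of_set (closed_simplex \<sigma>)) (U \<inter> closed_simplex \<sigma>)"
      using U \<sigma> by (simp add: openin_realization realization_open_def)
    ultimately have "openin (top_of_set {0..1}) {t \<in> topspace (top_of_set {0..1}). H (v0, t) \<in> U \<inter> closed_simplex \<sigma>}"
      by (rule openin_continuous_map_preimage)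
    then obtain e where e: "e > 0" "cball t0 e \<inter> {0..1} \<subseteq> {t \<in> {0..1}. H (v0, t) \<in> U}"
    proof -
      assume a: "openin (top_of_set {0..1}) {t \<in> topspace (top_of_set {0..1}). H (v0, t) \<in> U \<inter> closed_simplex \<sigma>}"
        and th: "\<And>e. e > 0 \<Longrightarrow> cball t0 e \<inter> {0..1} \<subseteq> {t \<in> {0..1}. H (v0, t) \<in> U} \<Longrightarrow> thesis"
      have "t0 \<in> {t \<in> topspace (top_of_set {0..1}). H (v0, t) \<in> U \<inter> closed_simplex \<sigma>}"
        using t0 HU H_in_simplex[OF \<sigma> S\<sigma> t0] by simp
      with a obtain e where "e > 0" "cball t0 e \<inter> {0..1} \<subseteq> {t \<in> topspace (top_of_set {0..1}). H (v0, t) \<in> U \<inter> closed_simplex \<sigma>}"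
        unfolding openin_contains_cball by blast
      then show thesis by (intro th[of e]) auto
    qed
    \<comment> \<open>a compact neighbourhood of the time, as the tube lemma needs\<close>
    define T where "T = cball t0 e \<inter> {0..1}"
    have T: "compact T" "T \<subseteq> {0..1}" by (auto simp: T_def compact_Int)
    let ?V = "{v \<in> topspace ?R. (\<forall>u\<in>S. v u > 0) \<and> (\<forall>t\<in>T. H (v, t) \<in> U)}"
    have "openin (subtopology ?R {v. \<forall>u\<in>S. v u > 0}) ?V"
      using openin_star_tube[OF U T] by (auto simp: openin_subtopology)
    moreover have "openin (top_of_set {0..1}) ({0..1} \<inter> ball t0 e)" by (intro openin_open_Int) auto
    ultimately have "openin ?P (?V \<times> ({0..1} \<inter> ball t0 e))" by (simp add: openin_prod_Times_iff)
    moreover have "z \<in> ?V \<times> ({0..1} \<inter> ball t0 e)" using z v0 t0 e by (auto simp: T_def)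
    moreover have "?V \<times> ({0..1} \<inter> ball t0 e) \<subseteq> {z \<in> topspace ?P. H z \<in> U}" by (auto simp: T_def)
    ultimately show "\<exists>T. openin ?P T \<and> z \<in> T \<and> T \<subseteq> {z \<in> topspace ?P. H z \<in> U}" by blast
  qed
  moreover have "H \<in> topspace ?P \<rightarrow> topspace ?R" using HR by auto
  ultimately show ?thesis by (simp add: continuous_map_def)
qed

text \<open>
  The points whose whole segment to \<open>b\<close> stays in \<open>W\<close> form an open subset of the star, and the
  segments contract it inside \<open>W\<close>.
\<close>

lemma star_contraction:
  assumes W: "openin (realization K) W" "b \<in> W"
  shows "\<exists>V c. openin (realization K) V \<and> b \<in> V \<and> V \<subseteq> W \<and>
     continuous_map (prod_topology (subtopology (realization K) V) (top_of_set {0..1})) (subtopology (realization K) W) c \<and>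
     (\<forall>v\<in>V. c (v, 0) = v \<and> c (v, 1::real) = b)"
proof -
  let ?R = "realization K"
  let ?V = "{v \<in> topspace ?R. (\<forall>u\<in>S. v u > 0) \<and> (\<forall>t\<in>{0..1}. H (v, t) \<in> W)}"
  have "openin ?R ?V" using openin_star_tube[OF W(1), of "{0..1}"] by simp
  moreover have "b \<in> ?V"
  proof -
    have "H (b, t) = b" for t by (auto simp: H_def algebra_simps)
    moreover have "b u > 0" if "u \<in> S" for u
      using b that by (force simp: S_def topspace_realization closed_simplex_def less_le)
    ultimately show ?thesis using b W by auto
  qed
  moreover have "H (v, 0) = v \<and> H (v, 1) = b" for v by (auto simp: H_def)
  moreover have "?V \<subseteq> W"
  proof
    fix v assume "v \<in> ?V"
    then have "H (v, 0) \<in> W" by auto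
    then show "v \<in> W" by (simp add: H_def)
  qed
  moreover have "continuous_map (prod_topology (subtopology ?R ?V) (top_of_set {0..1})) (subtopology ?R W) H"
  proof -
    have "prod_topology (subtopology ?R ?V) (top_of_set {0..1::real}) =
      subtopology (prod_topology (subtopology ?R {v. \<forall>u\<in>S. v u > 0}) (top_of_set {0..1})) (?V \<times> UNIV)"
    proof -
      have "{v. \<forall>u\<in>S. v u > 0} \<inter> ?V = ?V" by blast
      then show ?thesis unfolding subtopology_Times subtopology_subtopology by simp
    qed
    then have "continuous_map (prod_topology (subtopology ?R ?V) (top_of_set {0..1})) ?R H"
      using continuous_map_from_subtopology[OF continuous_map_H_star] by simp
    then show ?thesis by (auto simp: continuous_map_in_subtopology)
  qed
  ultimately show ?thesis by (intro exI[of _ ?V] exI[of _ H]) blast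
qed

end

lemma triangulated_locally_contractible:
  assumes tri: "triangulates K h X" and W: "openin X W" "x \<in> W"
  shows "\<exists>V c. openin X V \<and> x \<in> V \<and> V \<subseteq> W \<and>
     continuous_map (prod_topology (subtopology X V) (top_of_set {0..1})) (subtopology X W) c \<and>
     (\<forall>v\<in>V. c (v, 0) = v \<and> c (v, 1::real) = x)"
proof -
  let ?R = "realization K"
  have K: "abstract_simplicial_complex K" and "homeomorphic_map ?R X h" using tri by (auto simp: triangulates_def)
  then obtain g where hg: "homeomorphic_maps ?R X h g" by (auto simp: homeomorphic_map_maps)
  then have h: "continuous_map ?R X h" and g: "continuous_map X ?R g"
    and gh: "\<And>v. v \<in> topspace ?R \<Longrightarrow> g (h v) = v" and hg': "\<And>v. v \<in> topspace X \<Longrightarrow> h (g v) = v"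
    by (auto simp: homeomorphic_maps_def)
  have WX: "W \<subseteq> topspace X" using W openin_subset by blast
  define W' where "W' = {v \<in> topspace ?R. h v \<in> W}"
  have W': "openin ?R W'" unfolding W'_def by (rule openin_continuous_map_preimage[OF h W(1)])
  have gx: "g x \<in> topspace ?R" "g x \<in> W'"
    using W WX hg' continuous_map_image_subset_topspace[OF g] by (auto simp: W'_def)
  obtain V' H where V': "openin ?R V'" "g x \<in> V'" "V' \<subseteq> W'"
    and H: "continuous_map (prod_topology (subtopology ?R V') (top_of_set {0..1})) (subtopology ?R W') H"
      "\<forall>v\<in>V'. H (v, 0) = v \<and> H (v, 1::real) = g x"
    using star_contraction[OF K gx(1) W' gx(2)] by (elim exE conjE)
  define V where "V = {v \<in> topspace X. g v \<in> V'}"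
  have V: "openin X V" unfolding V_def by (rule openin_continuous_map_preimage[OF g V'(1)])
  have VW: "V \<subseteq> W" using V'(3) hg' by (auto simp: V_def W'_def)
  have gV: "continuous_map (subtopology X V) (subtopology ?R V') g"
    using g by (auto simp: continuous_map_in_subtopology continuous_map_from_subtopology V_def)
  have hW: "continuous_map (subtopology ?R W') (subtopology X W) h"
    using h by (auto simp: continuous_map_in_subtopology continuous_map_from_subtopology W'_def)
  have "continuous_map (prod_topology (subtopology X V) (top_of_set {0..1::real})) (prod_topology (subtopology ?R V') (top_of_set {0..1})) (\<lambda>p. (g (fst p), snd p))"
    by (intro continuous_map_pairedI continuous_map_snd continuous_map_compose[OF continuous_map_fst gV, unfolded o_def])
  from continuous_map_compose[OF continuous_map_compose[OF this H(1)] hW]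
  have "continuous_map (prod_topology (subtopology X V) (top_of_set {0..1})) (subtopology X W) (\<lambda>p. h (H (g (fst p), snd p)))"
    by (simp add: o_def)
  moreover have "h (H (g v, 0)) = v" "h (H (g v, 1)) = x" if "v \<in> V" for v
    using that H(2) hg' W WX by (auto simp: V_def)
  moreover have "x \<in> V" using W WX V'(2) by (auto simp: V_def)
  ultimately show ?thesis using V VW by (intro exI[of _ V] exI[of _ "\<lambda>p. h (H (g (fst p), snd p))"]) simp
qed

lemma triangulated_subcomplex_complement_open:
  assumes tri: "triangulates K h X" and Y: "is_subcomplex K h Y"
  shows "openin X (topspace X - Y)"
proof -
  let ?R = "realization K"
  have K: "abstract_simplicial_complex K" and hom: "homeomorphic_map ?R X h" using tri by (auto simp: triangulates_def)
  obtain L where L: "L \<subseteq> K" "Y = h ` (\<Union>\<sigma>\<in>L. closed_simplex \<sigma>)" using Y by (auto simp: is_subcomplex_def)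
  have sub: "(\<Union>\<sigma>\<in>L. closed_simplex \<sigma>) \<subseteq> topspace ?R" using L by (auto simp: topspace_realization)
  have "openin X (h ` (topspace ?R - (\<Union>\<sigma>\<in>L. closed_simplex \<sigma>)))"
    using openin_complement_subcomplex[OF K L(1)] homeomorphic_imp_open_map[OF hom] by (simp add: open_map_def)
  moreover have "h ` (topspace ?R - (\<Union>\<sigma>\<in>L. closed_simplex \<sigma>)) = topspace X - Y"
    using homeomorphic_imp_injective_map[OF hom] homeomorphic_imp_surjective_map[OF hom] sub
    unfolding L(2) by (subst inj_on_image_set_diff[of h "topspace ?R"]) auto
  ultimately show ?thesis by simp
qed

section \<open>Homotopy groups and inclusions\<close>

text \<open>
  Homotopies need to be right only on the cube; outside of it they are corrected by hand, because
  the relation compares spheroids as functions on the whole type.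
\<close>

lemma spheroid_homotopicI:
  assumes f: "f \<in> spheroids n X x" and g: "g \<in> spheroids n X x"
    and h: "continuous_map (cylinder n) X h"
      "\<And>t. t \<in> topspace (cube n) \<Longrightarrow> h (0, t) = f t" "\<And>t. t \<in> topspace (cube n) \<Longrightarrow> h (1, t) = g t"
      "\<And>\<tau> t. \<tau> \<in> {0..1} \<Longrightarrow> t \<in> cube_boundary n \<Longrightarrow> h (\<tau>, t) = x"
  shows "(f, g) \<in> spheroid_homotopic n X x"
proof -
  have bd: "cube_boundary n \<subseteq> topspace (cube n)" by (auto simp: cube_boundary_def)
  have "homotopic_with (\<lambda>k. k ` cube_boundary n \<subseteq> {x}) (cube n) X f g"
    unfolding homotopic_with_def
  proof (intro exI[of _ "\<lambda>(\<tau>, t). if t \<in> topspace (cube n) then h (\<tau>, t) else if \<tau> = 0 then f t else g t"] conjI allI ballI)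
    show "continuous_map (cylinder n) X
      (\<lambda>(\<tau>, t). if t \<in> topspace (cube n) then h (\<tau>, t) else if \<tau> = 0 then f t else g t)"
      by (rule continuous_map_eq[OF h(1)]) auto
  qed (use h bd in auto)
  then show ?thesis using f g by (simp add: spheroid_homotopic_def)
qed

lemma spheroid_homotopicE:
  assumes "(f, g) \<in> spheroid_homotopic n X x"
  obtains h where "f \<in> spheroids n X x" "g \<in> spheroids n X x"
    "continuous_map (cylinder n) X h"
    "\<And>t. h (0, t) = f t" "\<And>t. h (1, t) = g t"
    "\<And>\<tau> t. \<tau> \<in> {0..1} \<Longrightarrow> t \<in> cube_boundary n \<Longrightarrow> h (\<tau>, t) = x"
proof -
  have "f \<in> spheroids n X x" "g \<in> spheroids n X x" "homotopic_with (\<lambda>k. k ` cube_boundary n \<subseteq> {x}) (cube n) X f g"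
    using assms by (auto simp: spheroid_homotopic_def)
  then show ?thesis using that unfolding homotopic_with_def by (auto simp: image_subset_iff)
qed

lemma equiv_spheroid_homotopic: "equiv (spheroids n X x) (spheroid_homotopic n X x)"
proof (rule equivI)
  show "spheroid_homotopic n X x \<subseteq> spheroids n X x \<times> spheroids n X x"
    by (auto simp: spheroid_homotopic_def)
  show "refl_on (spheroids n X x) (spheroid_homotopic n X x)"
    by (auto simp: refl_on_def spheroid_homotopic_def spheroids_def)
  show "sym (spheroid_homotopic n X x)"
    by (auto simp: sym_def spheroid_homotopic_def homotopic_with_sym)
  show "trans (spheroid_homotopic n X x)"
    unfolding trans_def spheroid_homotopic_def using homotopic_with_trans by blast
qed

lemma spheroid_homotopic_trans:
  "(f, g) \<in> spheroid_homotopic n X x \<Longrightarrow> (g, k) \<in> spheroid_homotopic n X x \<Longrightarrow> (f, k) \<in> spheroid_homotopic n X x"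
  using equiv_spheroid_homotopic[of n X x] by (auto simp: equiv_def dest: transD)

lemma spheroids_subtopology_mono: "S \<subseteq> T \<Longrightarrow> spheroids n (subtopology X S) x \<subseteq> spheroids n (subtopology X T) x"
  by (auto simp: spheroids_def intro: continuous_map_into_larger)

lemma spheroid_homotopic_subtopology_mono:
  assumes "S \<subseteq> T" shows "spheroid_homotopic n (subtopology X S) x \<subseteq> spheroid_homotopic n (subtopology X T) x"
proof (rule subrelI)
  fix f g assume fg: "(f, g) \<in> spheroid_homotopic n (subtopology X S) x"
  show "(f, g) \<in> spheroid_homotopic n (subtopology X T) x"
    using fg
  proof (rule spheroid_homotopicE)
    fix h assume "f \<in> spheroids n (subtopology X S) x" "g \<in> spheroids n (subtopology X S) x"
      and h: "continuous_map (cylinder n) (subtopology X S) h"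
      "\<And>t. h (0, t) = f t" "\<And>t. h (1, t) = g t"
      "\<And>\<tau> t. \<tau> \<in> {0..1} \<Longrightarrow> t \<in> cube_boundary n \<Longrightarrow> h (\<tau>, t) = x"
    then show ?thesis
      using subsetD[OF spheroids_subtopology_mono[OF assms]]
      by (intro spheroid_homotopicI[of f n _ x g h]) (auto intro: continuous_map_into_larger[OF _ assms])
  qed
qed

text \<open>
  The map sends a class to all spheroids that are homotopic in the larger space to one of its
  members; this is again a single class.
\<close>

lemma homotopy_group_map_class:
  assumes ST: "S \<subseteq> T" and f: "f \<in> spheroids n (subtopology X S) x"
  shows "homotopy_group_map n (subtopology X T) id x (spheroid_homotopic n (subtopology X S) x `` {f})
    = spheroid_homotopic n (subtopology X T) x `` {f}"
proof -
  let ?R = "spheroid_homotopic n (subtopology X S) x" and ?R' = "spheroid_homotopic n (subtopology X T) x"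
  have "f \<in> ?R `` {f}" by (rule equiv_class_self[OF equiv_spheroid_homotopic f])
  moreover have "?R' `` (?R `` {f}) \<subseteq> ?R' `` {f}"
  proof
    fix k assume "k \<in> ?R' `` (?R `` {f})"
    then obtain f' where "(f, f') \<in> ?R" "(f', k) \<in> ?R'" by blast
    moreover from this have "(f, f') \<in> ?R'" using spheroid_homotopic_subtopology_mono[OF ST] by blast
    ultimately show "k \<in> ?R' `` {f}" by (auto intro: spheroid_homotopic_trans)
  qed
  ultimately have "?R' `` (?R `` {f}) = ?R' `` {f}" by blast
  then show ?thesis by (simp add: homotopy_group_map_def)
qed

lemma continuous_map_cube_update:
  assumes Z: "continuous_map Z (cube n) p" and a: "continuous_map Z (top_of_set {0..1}) a" and n: "0 < n"
  shows "continuous_map Z (cube n) (\<lambda>z. (p z)(0 := a z))"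
proof -
  have pz: "p z \<in> {..<n} \<rightarrow>\<^sub>E {0..1}" if "z \<in> topspace Z" for z
    using continuous_map_image_subset_topspace[OF Z] that by (auto simp: topspace_cube)
  have "continuous_map Z (top_of_set {0..1}) (\<lambda>z. ((p z)(0 := a z)) i)" if "i < n" for i
  proof (cases "i = 0")
    case False
    have "continuous_map Z (top_of_set {0..1}) (\<lambda>z. p z i)"
      using Z that unfolding cube_def continuous_map_componentwise by blast
    then show ?thesis using False by simp
  qed (use a in simp)
  moreover have "(p z)(0 := a z) \<in> extensional {..<n}" if "z \<in> topspace Z" for z
    using pz[OF that] n by (auto simp: extensional_def PiE_iff)
  ultimately show ?thesis unfolding cube_def continuous_map_componentwise by auto
qed

text \<open>
  Carried out for homotopies; the concatenation of spheroids is the case of constant homotopies.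
  The two halves agree where they meet because both are constant on the boundary.
\<close>

lemma continuous_map_spheroid_concat:
  fixes h1 h2 :: "real \<times> (nat \<Rightarrow> real) \<Rightarrow> 'a"
  assumes n: "0 < n"
    and h1: "continuous_map (cylinder n) X h1"
    and h2: "continuous_map (cylinder n) X h2"
    and b1: "\<And>\<tau> t. \<tau> \<in> {0..1} \<Longrightarrow> t \<in> cube_boundary n \<Longrightarrow> h1 (\<tau>, t) = x"
    and b2: "\<And>\<tau> t. \<tau> \<in> {0..1} \<Longrightarrow> t \<in> cube_boundary n \<Longrightarrow> h2 (\<tau>, t) = x"
  shows "continuous_map (cylinder n) X
      (\<lambda>p. spheroid_concat (\<lambda>t. h1 (fst p, t)) (\<lambda>t. h2 (fst p, t)) (snd p))" (is "continuous_map ?P X _")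
    and "\<And>\<tau> t. \<tau> \<in> {0..1} \<Longrightarrow> t \<in> cube_boundary n \<Longrightarrow> spheroid_concat (\<lambda>t. h1 (\<tau>, t)) (\<lambda>t. h2 (\<tau>, t)) t = x"
proof -
  have coord: "continuous_map ?P euclideanreal (\<lambda>p. snd p 0)"
    using continuous_map_compose[OF continuous_map_snd continuous_map_cube_coord[OF n]] by (simp add: o_def)
  have tE: "t 0 \<in> {0..1}" if "t \<in> topspace (cube n)" for t using that n by (auto simp: topspace_cube PiE_iff)
  have sub: "continuous_map (subtopology ?P S) X (\<lambda>p. h (fst p, (snd p)(0 := a p)))"
    if "continuous_map (subtopology ?P S) (top_of_set {0..1}) a" "continuous_map ?P X h" for h a S
  proof -
    have "continuous_map (subtopology ?P S) ?P (\<lambda>p. (fst p, (snd p)(0 := a p)))"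
      by (intro continuous_map_pairedI continuous_map_cube_update[OF _ that(1) n])
         (auto intro: continuous_map_from_subtopology continuous_map_fst continuous_map_snd)
    from continuous_map_compose[OF this that(2)] show ?thesis by (simp add: o_def)
  qed
  have upd: "t(0 := c) \<in> cube_boundary n" if "t \<in> topspace (cube n)" "c = 0 \<or> c = 1" for t :: "nat \<Rightarrow> real" and c
    using that n by (auto simp: cube_boundary_def topspace_cube PiE_iff extensional_def)
  show "continuous_map ?P X (\<lambda>p. spheroid_concat (\<lambda>t. h1 (fst p, t)) (\<lambda>t. h2 (fst p, t)) (snd p))"
    unfolding spheroid_concat_def
  proof (rule continuous_map_cases_le)
    let ?S1 = "{p \<in> topspace ?P. snd p 0 \<le> 1/2}" and ?S2 = "{p \<in> topspace ?P. 1/2 \<le> snd p 0}"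
    show "continuous_map (subtopology ?P ?S1) X (\<lambda>p. h1 (fst p, (snd p)(0 := 2 * snd p 0)))"
    proof (rule sub[OF _ h1])
      have "continuous_map (subtopology ?P ?S1) euclideanreal (\<lambda>p. 2 * snd p 0)"
        by (intro continuous_map_from_subtopology continuous_intros coord)
      then show "continuous_map (subtopology ?P ?S1) (top_of_set {0..1}) (\<lambda>p. 2 * snd p 0)"
        using tE by (auto simp: continuous_map_in_subtopology)
    qed
    show "continuous_map (subtopology ?P ?S2) X (\<lambda>p. h2 (fst p, (snd p)(0 := 2 * snd p 0 - 1)))"
    proof (rule sub[OF _ h2])
      have "continuous_map (subtopology ?P ?S2) euclideanreal (\<lambda>p. 2 * snd p 0 - 1)"
        by (intro continuous_map_from_subtopology continuous_intros coord)
      then show "continuous_map (subtopology ?P ?S2) (top_of_set {0..1}) (\<lambda>p. 2 * snd p 0 - 1)"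
        using tE by (auto simp: continuous_map_in_subtopology)
    qed
    fix p assume p: "p \<in> topspace ?P" "snd p 0 = 1/2"
    then have "(snd p)(0 := 2 * snd p 0) \<in> cube_boundary n" "(snd p)(0 := 2 * snd p 0 - 1) \<in> cube_boundary n" "fst p \<in> {0..1}"
      by (auto intro!: upd)
    then show "h1 (fst p, (snd p)(0 := 2 * snd p 0)) = h2 (fst p, (snd p)(0 := 2 * snd p 0 - 1))"
      using b1 b2 by simp
  qed (auto intro: coord)
  fix \<tau> :: real and t assume \<tau>: "\<tau> \<in> {0..1}" and t: "t \<in> cube_boundary n"
  then obtain i where i: "i < n" "t i = 0 \<or> t i = 1" and tc: "t \<in> topspace (cube n)" by (auto simp: cube_boundary_def)
  have upd': "t(0 := c) \<in> cube_boundary n" if "0 \<le> c" "c \<le> 1" "i = 0 \<Longrightarrow> c = 0 \<or> c = 1" for c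
  proof -
    have "t(0 := c) \<in> topspace (cube n)" using tc that n by (auto simp: topspace_cube PiE_iff extensional_def)
    moreover have "(t(0 := c)) i = 0 \<or> (t(0 := c)) i = 1" using i that by auto
    ultimately show ?thesis using i(1) unfolding cube_boundary_def by blast
  qed
  show "spheroid_concat (\<lambda>t. h1 (\<tau>, t)) (\<lambda>t. h2 (\<tau>, t)) t = x"
  proof (cases "t 0 \<le> 1/2")
    case True
    then have "t(0 := 2 * t 0) \<in> cube_boundary n" using tE[OF tc] i(2) by (intro upd') auto
    then show ?thesis using True b1 \<tau> by (simp add: spheroid_concat_def)
  next
    case False
    then have "t(0 := 2 * t 0 - 1) \<in> cube_boundary n" using tE[OF tc] i(2) by (intro upd') auto
    then show ?thesis using False b2 \<tau> by (simp add: spheroid_concat_def)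
  qed
qed

lemma spheroid_concat_spheroid:
  assumes n: "0 < n" and f: "f \<in> spheroids n X x" and g: "g \<in> spheroids n X x"
  shows "spheroid_concat f g \<in> spheroids n X x"
proof -
  have c: "continuous_map (cylinder n) X (\<lambda>p. k (snd p))" if "k \<in> spheroids n X x" for k
    using that continuous_map_compose[OF continuous_map_snd, of "cube n" X k] by (simp add: spheroids_def o_def)
  have b: "k t = x" if "k \<in> spheroids n X x" "t \<in> cube_boundary n" for k t
    using that by (auto simp: spheroids_def)
  note cc = continuous_map_spheroid_concat[OF n c[OF f] c[OF g], of x, simplified, OF b[OF f] b[OF g]]
  have "continuous_map (cube n) (cylinder n) (\<lambda>t. (0, t))"
    by (intro continuous_map_pairedI) auto
  from continuous_map_compose[OF this cc(1)] have "continuous_map (cube n) X (spheroid_concat f g)"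
    by (simp add: o_def)
  moreover have "spheroid_concat f g t = x" if "t \<in> cube_boundary n" for t
    using cc(2)[of 0 t] that by simp
  ultimately show ?thesis by (auto simp: spheroids_def)
qed

lemma spheroid_concat_homotopic:
  assumes n: "0 < n" and f: "(f, f') \<in> spheroid_homotopic n X x" and g: "(g, g') \<in> spheroid_homotopic n X x"
  shows "(spheroid_concat f g, spheroid_concat f' g') \<in> spheroid_homotopic n X x"
  using f
proof (rule spheroid_homotopicE)
  fix h1 assume h1: "f \<in> spheroids n X x" "f' \<in> spheroids n X x"
    "continuous_map (cylinder n) X h1" "\<And>t. h1 (0, t) = f t" "\<And>t. h1 (1, t) = f' t"
    "\<And>\<tau> t. \<tau> \<in> {0..1} \<Longrightarrow> t \<in> cube_boundary n \<Longrightarrow> h1 (\<tau>, t) = x"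
  show ?thesis
    using g
  proof (rule spheroid_homotopicE)
    fix h2 assume h2: "g \<in> spheroids n X x" "g' \<in> spheroids n X x"
      "continuous_map (cylinder n) X h2" "\<And>t. h2 (0, t) = g t" "\<And>t. h2 (1, t) = g' t"
      "\<And>\<tau> t. \<tau> \<in> {0..1} \<Longrightarrow> t \<in> cube_boundary n \<Longrightarrow> h2 (\<tau>, t) = x"
    have cc: "continuous_map (cylinder n) X
        (\<lambda>p. spheroid_concat (\<lambda>t. h1 (fst p, t)) (\<lambda>t. h2 (fst p, t)) (snd p))"
      by (rule continuous_map_spheroid_concat(1)[OF n h1(3) h2(3)]) (rule h1(6) h2(6); assumption)+
    have bd: "spheroid_concat (\<lambda>t. h1 (\<tau>, t)) (\<lambda>t. h2 (\<tau>, t)) t = x"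
      if "\<tau> \<in> {0..1}" "t \<in> cube_boundary n" for \<tau> t
      by (rule continuous_map_spheroid_concat(2)[OF n h1(3) h2(3) _ _ that]) (rule h1(6) h2(6); assumption)+
    show ?thesis
    proof (rule spheroid_homotopicI[OF spheroid_concat_spheroid[OF n h1(1) h2(1)]
          spheroid_concat_spheroid[OF n h1(2) h2(2)] cc])
      show "spheroid_concat (\<lambda>s. h1 (fst (\<tau>, t), s)) (\<lambda>s. h2 (fst (\<tau>, t), s)) (snd (\<tau>, t)) = x"
        if "\<tau> \<in> {0..1}" "t \<in> cube_boundary n" for \<tau> and t :: "nat \<Rightarrow> real"
        using bd[OF that] by simp
    qed (simp_all add: spheroid_concat_def h1(4,5) h2(4,5))
  qed
qed

lemma homotopy_group_mult_class:
  assumes n: "0 < n" and f: "f \<in> spheroids n X x" and g: "g \<in> spheroids n X x"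
  defines "R \<equiv> spheroid_homotopic n X x"
  shows "mult (homotopy_group n X x) (R `` {f}) (R `` {g}) = R `` {spheroid_concat f g}"
proof -
  have eq: "equiv (spheroids n X x) R" unfolding R_def by (rule equiv_spheroid_homotopic)
  have ff: "(f, f) \<in> R" "(g, g) \<in> R" using equiv_class_self[OF eq] f g by auto
  have "R `` {spheroid_concat f' g' |f' g'. f' \<in> R `` {f} \<and> g' \<in> R `` {g}} = R `` {spheroid_concat f g}"
  proof (intro Set.equalityI subsetI)
    fix k assume "k \<in> R `` {spheroid_concat f' g' |f' g'. f' \<in> R `` {f} \<and> g' \<in> R `` {g}}"
    then obtain f' g' where k: "(f, f') \<in> R" "(g, g') \<in> R" "(spheroid_concat f' g', k) \<in> R" by blast
    have "(spheroid_concat f g, spheroid_concat f' g') \<in> R"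
      using k(1,2) unfolding R_def by (rule spheroid_concat_homotopic[OF n])
    then show "k \<in> R `` {spheroid_concat f g}" using k(3) unfolding R_def by (auto intro: spheroid_homotopic_trans)
  next
    fix k assume "k \<in> R `` {spheroid_concat f g}"
    then show "k \<in> R `` {spheroid_concat f' g' |f' g'. f' \<in> R `` {f} \<and> g' \<in> R `` {g}}"
    proof -
      have "spheroid_concat f g \<in> {spheroid_concat f' g' |f' g'. f' \<in> R `` {f} \<and> g' \<in> R `` {g}}"
        using ff by (intro CollectI exI[of _ f] exI[of _ g]) simp
      then show ?thesis using \<open>k \<in> R `` {spheroid_concat f g}\<close> by auto
    qed
  qed
  then show ?thesis by (simp add: homotopy_group_def R_def)
qed

lemma carrier_homotopy_group: "carrier (homotopy_group n X x) = (\<lambda>f. spheroid_homotopic n X x `` {f}) ` spheroids n X x"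
  by (auto simp: homotopy_group_def quotient_def)

lemma null_if_carrier_trivial:
  assumes "carrier (homotopy_group n X x) = {one (homotopy_group n X x)}" "x \<in> topspace X" "f \<in> spheroids n X x"
  shows "(f, \<lambda>_. x) \<in> spheroid_homotopic n X x"
proof -
  have c: "(\<lambda>_. x) \<in> spheroids n X x" using assms(2) by (auto simp: spheroids_def)
  have "spheroid_homotopic n X x `` {f} = spheroid_homotopic n X x `` {\<lambda>_. x}"
  proof -
    have "spheroid_homotopic n X x `` {f} \<in> carrier (homotopy_group n X x)"
      unfolding carrier_homotopy_group by (rule imageI[OF assms(3)])
    then show ?thesis unfolding assms(1) by (simp add: homotopy_group_def)
  qed
  then show ?thesis using equiv_class_self[OF equiv_spheroid_homotopic c] by blast
qed

lemma null_if_map_injective: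
  assumes inj: "inj_on (homotopy_group_map n (subtopology X T) id x) (carrier (homotopy_group n (subtopology X S) x))"
    and S: "S \<subseteq> T" "x \<in> S" "x \<in> topspace X" and f: "f \<in> spheroids n (subtopology X S) x"
    and null: "(f, \<lambda>_. x) \<in> spheroid_homotopic n (subtopology X T) x"
  shows "(f, \<lambda>_. x) \<in> spheroid_homotopic n (subtopology X S) x"
proof -
  let ?R = "spheroid_homotopic n (subtopology X S) x"
  have c: "(\<lambda>_. x) \<in> spheroids n (subtopology X S) x" using S by (auto simp: spheroids_def)
  have "?R `` {f} = ?R `` {\<lambda>_. x}"
  proof (rule inj_onD[OF inj])
    show "?R `` {f} \<in> carrier (homotopy_group n (subtopology X S) x)" 
      "?R `` {\<lambda>_. x} \<in> carrier (homotopy_group n (subtopology X S) x)"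
      using f c by (auto simp: carrier_homotopy_group)
    show "homotopy_group_map n (subtopology X T) id x (?R `` {f}) = homotopy_group_map n (subtopology X T) id x (?R `` {\<lambda>_. x})"
      unfolding homotopy_group_map_class[OF S(1) f] homotopy_group_map_class[OF S(1) c]
      by (rule equiv_class_eq[OF equiv_spheroid_homotopic null])
  qed
  then show ?thesis using equiv_class_self[OF equiv_spheroid_homotopic c] by blast
qed

lemma homotopy_group_map_inclusion_surj:
  assumes A: "A \<subseteq> topspace X"
    and push: "\<And>f. f \<in> spheroids n X x \<Longrightarrow> \<exists>f'\<in>spheroids n (subtopology X A) x. (f, f') \<in> spheroid_homotopic n X x"
  shows "homotopy_group_map n X id x ` carrier (homotopy_group n (subtopology X A) x) = carrier (homotopy_group n X x)"
proof -
  let ?R = "spheroid_homotopic n X x"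
  note cl = homotopy_group_map_class[of A "topspace X" _ n X x, simplified, OF A]
  have sub: "spheroids n (subtopology X A) x \<subseteq> spheroids n X x"
    using spheroids_subtopology_mono[of A "topspace X" n X x] A by simp
  show ?thesis
  proof (intro Set.equalityI subsetI)
    fix a assume "a \<in> homotopy_group_map n X id x ` carrier (homotopy_group n (subtopology X A) x)"
    then show "a \<in> carrier (homotopy_group n X x)" using cl sub by (auto simp: carrier_homotopy_group)
  next
    fix a assume "a \<in> carrier (homotopy_group n X x)"
    then obtain f where f: "f \<in> spheroids n X x" "a = ?R `` {f}" by (auto simp: carrier_homotopy_group)
    then obtain f' where f': "f' \<in> spheroids n (subtopology X A) x" "(f, f') \<in> ?R" using push by blast
    have "a = ?R `` {f'}" unfolding f(2) by (rule equiv_class_eq[OF equiv_spheroid_homotopic f'(2)])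
    then show "a \<in> homotopy_group_map n X id x ` carrier (homotopy_group n (subtopology X A) x)"
      using f'(1) cl[OF f'(1)] by (force simp: carrier_homotopy_group)
  qed
qed

lemma homotopy_group_map_inclusion_iso:
  assumes A: "A \<subseteq> topspace X" and n: "0 < n"
    and push: "\<And>f. f \<in> spheroids n X x \<Longrightarrow> \<exists>f'\<in>spheroids n (subtopology X A) x. (f, f') \<in> spheroid_homotopic n X x"
    and inj: "\<And>f g. f \<in> spheroids n (subtopology X A) x \<Longrightarrow> g \<in> spheroids n (subtopology X A) x \<Longrightarrow>
       (f, g) \<in> spheroid_homotopic n X x \<Longrightarrow> (f, g) \<in> spheroid_homotopic n (subtopology X A) x"
  shows "homotopy_group_map n X id x \<in> iso (homotopy_group n (subtopology X A) x) (homotopy_group n X x)"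
proof -
  let ?R = "spheroid_homotopic n X x" and ?S = "spheroid_homotopic n (subtopology X A) x"
    and ?m = "homotopy_group_map n X id x"
  let ?G = "homotopy_group n (subtopology X A) x" and ?H = "homotopy_group n X x"
  note cl = homotopy_group_map_class[of A "topspace X" _ n X x, simplified, OF A]
  have sub: "f \<in> spheroids n (subtopology X A) x \<Longrightarrow> f \<in> spheroids n X x" for f
    using spheroids_subtopology_mono[of A "topspace X" n X x] A by auto
  have surj: "?m ` carrier ?G = carrier ?H" by (rule homotopy_group_map_inclusion_surj[OF A push])
  have "inj_on ?m (carrier ?G)"
  proof (rule inj_onI)
    fix a b assume "a \<in> carrier ?G" "b \<in> carrier ?G" and eq: "?m a = ?m b"
    then obtain f g where f: "f \<in> spheroids n (subtopology X A) x" "a = ?S `` {f}"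
      and g: "g \<in> spheroids n (subtopology X A) x" "b = ?S `` {g}" by (auto simp: carrier_homotopy_group)
    have "?R `` {f} = ?R `` {g}" using eq cl[OF f(1)] cl[OF g(1)] f g by simp
    then have "(f, g) \<in> ?R" using equiv_class_self[OF equiv_spheroid_homotopic sub[OF g(1)]] by blast
    then show "a = b" unfolding f(2) g(2)
      by (intro equiv_class_eq[OF equiv_spheroid_homotopic] inj f g)
  qed
  moreover have "?m (mult ?G a b) = mult ?H (?m a) (?m b)" if ab: "a \<in> carrier ?G" "b \<in> carrier ?G" for a b
  proof -
    obtain f g where f: "f \<in> spheroids n (subtopology X A) x" "a = ?S `` {f}"
      and g: "g \<in> spheroids n (subtopology X A) x" "b = ?S `` {g}" using ab by (auto simp: carrier_homotopy_group)
    show ?thesis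
      unfolding f(2) g(2) homotopy_group_mult_class[OF n f(1) g(1)] cl[OF f(1)] cl[OF g(1)]
        homotopy_group_mult_class[OF n sub[OF f(1)] sub[OF g(1)]]
      by (rule cl[OF spheroid_concat_spheroid[OF n f(1) g(1)]])
  qed
  ultimately show ?thesis using surj by (auto simp: iso_def hom_def bij_betw_def)
qed

section \<open>Two-connectedness\<close>

text \<open>
  The point of the 1-cube with the given coordinate; values outside the index range are undefined,
  as the extensional product requires.
\<close>

definition point1 :: "real \<Rightarrow> nat \<Rightarrow> real" where "point1 s = (\<lambda>i\<in>{..<1}. s)"
definition point2 :: "real \<Rightarrow> real \<Rightarrow> nat \<Rightarrow> real" where "point2 s u = (\<lambda>i\<in>{..<2}. if i = 0 then s else u)"

lemma continuous_map_point1: 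
  assumes "continuous_map Z (top_of_set {0..1}) a" shows "continuous_map Z (cube 1) (\<lambda>z. point1 (a z))"
  unfolding point1_def continuous_map_into_cube using assms by simp

lemma continuous_map_point2:
  assumes "continuous_map Z (top_of_set {0..1}) a" "continuous_map Z (top_of_set {0..1}) b"
  shows "continuous_map Z (cube 2) (\<lambda>z. point2 (a z) (b z))"
  unfolding point2_def continuous_map_into_cube using assms by auto

lemma point1_coord: "t \<in> topspace (cube 1) \<Longrightarrow> point1 (t 0) = t"
  by (auto simp: point1_def topspace_cube PiE_iff extensional_def restrict_def fun_eq_iff)

lemma point2_coord: "t \<in> topspace (cube 2) \<Longrightarrow> point2 (t 0) (t 1) = t"
  by (auto simp: point2_def topspace_cube PiE_iff extensional_def restrict_def fun_eq_iff less_2_cases_iff)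

lemma point1_in: "s \<in> {0..1} \<Longrightarrow> point1 s \<in> topspace (cube 1)"
  by (auto simp: point1_def topspace_cube PiE_iff)

lemma point2_in: "s \<in> {0..1} \<Longrightarrow> u \<in> {0..1} \<Longrightarrow> point2 s u \<in> topspace (cube 2)"
  by (auto simp: point2_def topspace_cube PiE_iff)

lemma point1_boundary: "s \<in> {0..1} \<Longrightarrow> s = 0 \<or> s = 1 \<Longrightarrow> point1 s \<in> cube_boundary 1"
  using point1_in[of s] by (auto simp: cube_boundary_def point1_def)

lemma point2_boundary:
  assumes "s \<in> {0..1}" "u \<in> {0..1}" "s = 0 \<or> s = 1 \<or> u = 0 \<or> u = 1"
  shows "point2 s u \<in> cube_boundary 2"
proof -
  have "\<exists>i<2. point2 s u i = 0 \<or> point2 s u i = 1"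
    using assms(3) by (elim disjE) (auto intro: exI[of _ 0] exI[of _ 1] simp: point2_def)
  then show ?thesis using point2_in[OF assms(1,2)] by (simp add: cube_boundary_def)
qed

lemma cube_boundary_1: "t \<in> cube_boundary 1 \<Longrightarrow> t 0 = 0 \<or> t 0 = 1"
  by (auto simp: cube_boundary_def)

lemma cube_boundary_2: "t \<in> cube_boundary 2 \<Longrightarrow> t 0 = 0 \<or> t 0 = 1 \<or> t 1 = 0 \<or> t 1 = 1"
  by (auto simp: cube_boundary_def less_2_cases_iff)

lemma cube_coord_in: "t \<in> topspace (cube n) \<Longrightarrow> i < n \<Longrightarrow> t i \<in> {0..1}"
  by (auto simp: topspace_cube PiE_iff)

lemma cube_boundary_subset: "cube_boundary n \<subseteq> topspace (cube n)"
  by (auto simp: cube_boundary_def)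

lemma continuous_map_unit_coord:
  "i < n \<Longrightarrow> continuous_map (cylinder n) (top_of_set {0..1}) (\<lambda>p. snd p i)"
  using continuous_map_compose[OF continuous_map_snd continuous_map_cube_coord, of i n "top_of_set {0..1::real}"] cube_coord_in
  by (fastforce simp: continuous_map_in_subtopology o_def)

lemma continuous_map_from_square:
  assumes "cmap_on (S \<times> T) X F"
    and "continuous_map Z (top_of_set S) a" "continuous_map Z (top_of_set T) b"
  shows "continuous_map Z X (\<lambda>z. F (a z, b z))"
proof -
  have "continuous_map Z (prod_topology (top_of_set S) (top_of_set T)) (\<lambda>z. (a z, b z))"
    by (intro continuous_map_pairedI assms)
  then have "continuous_map Z (top_of_set (S \<times> T)) (\<lambda>z. (a z, b z))" by simp
  from continuous_map_compose[OF this assms(1)] show ?thesis by (simp add: o_def)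
qed

text \<open>
  The added assumption makes the pair 2-connected locally: the given sets admit the push of every
  square whose boundary has already been pushed.
\<close>

locale very_thin_complement = thin_complement X A for X :: "'a topology" and A +
  assumes cells_pushable: "x \<in> topspace X \<Longrightarrow> \<exists>V. openin X V \<and> x \<in> V \<and>
                 (\<forall>m \<delta> \<phi>. cell_data X A V m \<delta> \<phi> \<longrightarrow> (\<exists>F. cell_push X A m \<delta> \<phi> F))"
begin

lemma A_sub: "A \<subseteq> topspace X"
  using A_open openin_subset by blast

text \<open>
  A loop is a path with both ends in \<open>A\<close>.
\<close>

lemma spheroid1_push:
  assumes x: "x \<in> A" and f: "f \<in> spheroids 1 X x"
  shows "\<exists>f'\<in>spheroids 1 (subtopology X A) x. (f, f') \<in> spheroid_homotopic 1 X x"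
proof -
  have fc: "continuous_map (cube 1) X f" and fb: "\<And>t. t \<in> cube_boundary 1 \<Longrightarrow> f t = x"
    using f by (auto simp: spheroids_def)
  define p where "p s = f (point1 s)" for s
  have "cmap_on {0..1} X (\<lambda>s. f (point1 s))"
    using continuous_map_compose[OF continuous_map_point1 fc, of "top_of_set {0..1}" "\<lambda>s. s"] by (simp add: o_def)
  then have p: "cmap_on {0..1} (subtopology X (topspace X)) p" by (simp add: p_def[abs_def])
  have pe: "p 0 = x" "p 1 = x" using fb point1_boundary by (auto simp: p_def)
  obtain H where "edge_push X A (topspace X) 0 1 p (\<lambda>_. p 0) (\<lambda>_. p 1) H"
    using path_push_rel_ends[OF _ p] pe x by auto
  then have H: "cmap_on ({0..1} \<times> {0..1}) X H"
    "\<And>s. s \<in> {0..1} \<Longrightarrow> H (s, 0) = p s" "\<And>s. s \<in> {0..1} \<Longrightarrow> H (s, 1) \<in> A"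
    "\<And>t. t \<in> {0..1} \<Longrightarrow> H (0, t) = x" "\<And>t. t \<in> {0..1} \<Longrightarrow> H (1, t) = x"
    by (auto simp: edge_push_def pe)
  define f' where "f' t = H (t 0, 1)" for t :: "nat \<Rightarrow> real"
  have t01: "t 0 \<in> {0..1}" if "t \<in> topspace (cube 1)" for t using cube_coord_in that by auto
  have "continuous_map (cube 1) (top_of_set {0..1}) (\<lambda>t. t 0)"
    using continuous_map_cube_coord[of 0 1] t01 by (auto simp: continuous_map_in_subtopology)
  then have "continuous_map (cube 1) X f'"
    unfolding f'_def[abs_def] by (rule continuous_map_from_square[OF H(1)]) auto
  moreover have "f' t \<in> A" if "t \<in> topspace (cube 1)" for t
    unfolding f'_def by (rule H(3)[OF t01[OF that]])
  moreover have "f' t = x" if "t \<in> cube_boundary 1" for t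
    using cube_boundary_1[OF that] H(4)[of 1] H(5)[of 1] by (auto simp: f'_def)
  ultimately have f': "f' \<in> spheroids 1 (subtopology X A) x"
    by (auto simp: spheroids_def continuous_map_in_subtopology)
  moreover have "(f, f') \<in> spheroid_homotopic 1 X x"
  proof (rule spheroid_homotopicI[OF f, where h = "\<lambda>p. H (snd p 0, fst p)"])
    show "f' \<in> spheroids 1 X x" using f' by (auto simp: spheroids_def continuous_map_in_subtopology)
    show "continuous_map (cylinder 1) X (\<lambda>p. H (snd p 0, fst p))"
      by (intro continuous_map_from_square[OF H(1)] continuous_map_unit_coord continuous_map_fst) auto
    fix t :: "nat \<Rightarrow> real"
    show "H (snd (0::real, t) 0, fst (0, t)) = f t" if "t \<in> topspace (cube 1)"
      using H(2)[OF t01[OF that]] point1_coord[OF that] by (simp add: p_def)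
    show "H (snd (\<tau>, t) 0, fst (\<tau>, t)) = x" if "\<tau> \<in> {0..1}" "t \<in> cube_boundary 1" for \<tau>
      using H(4,5)[OF that(1)] cube_boundary_1[OF that(2)] by auto
  qed (simp add: f'_def)
  ultimately show ?thesis by blast
qed

text \<open>
  A homotopy between loops in \<open>A\<close> is a square whose boundary lies in \<open>A\<close>. Pushing it into \<open>A\<close>
  relative to the boundary gives a homotopy inside \<open>A\<close> between the same loops.
\<close>

lemma spheroid1_homotopic_push:
  assumes x: "x \<in> A" and f: "f \<in> spheroids 1 (subtopology X A) x" and g: "g \<in> spheroids 1 (subtopology X A) x"
    and fg: "(f, g) \<in> spheroid_homotopic 1 X x"
  shows "(f, g) \<in> spheroid_homotopic 1 (subtopology X A) x"
  using fg
proof (rule spheroid_homotopicE)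
  fix h assume h: "continuous_map (cylinder 1) X h"
    "\<And>t. h (0, t) = f t" "\<And>t. h (1, t) = g t"
    "\<And>\<tau> t. \<tau> \<in> {0..1} \<Longrightarrow> t \<in> cube_boundary 1 \<Longrightarrow> h (\<tau>, t) = x"
  define F where "F = (\<lambda>z. h (snd z, point1 (fst z)))"
  let ?Q = "{0..1::real} \<times> {0..1::real}"
  have fA: "f t \<in> A" "g t \<in> A" if "t \<in> topspace (cube 1)" for t
    using f g that by (auto simp: spheroids_def continuous_map_in_subtopology Pi_iff)
  have 1: "cmap_on ?Q (top_of_set {0..1}) snd" "cmap_on ?Q (top_of_set {0..1}) fst"
    by (auto intro!: continuous_intros)
  have "cmap_on ?Q (cylinder 1) (\<lambda>z. (snd z, point1 (fst z)))"
    by (rule continuous_map_pairedI[OF 1(1) continuous_map_point1[OF 1(2)]])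
  from continuous_map_compose[OF this h(1)] have F: "cmap_on ?Q X F" by (simp add: F_def o_def)
  have FA: "F (s, \<tau>) \<in> A" if "s \<in> {0..1}" "\<tau> \<in> {0..1}" "s = 0 \<or> s = 1 \<or> \<tau> = 0 \<or> \<tau> = 1" for s \<tau>
  proof (cases "s = 0 \<or> s = 1")
    case True
    then show ?thesis using h(4)[OF that(2) point1_boundary[OF that(1)]] x by (simp add: F_def)
  next
    case False
    then show ?thesis using that(3) h(2,3) fA[OF point1_in[OF that(1)]] by (auto simp: F_def)
  qed
  show ?thesis
  proof (rule square_push_rel_boundary[OF F FA cells_pushable])
    fix G assume G: "cmap_on (?Q \<times> {0..1::real}) X G"
      "\<And>x y. x \<in> {0..1} \<Longrightarrow> y \<in> {0..1} \<Longrightarrow> G ((x, y), 1) \<in> A"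
      "\<And>x y t. x \<in> {0..1} \<Longrightarrow> y \<in> {0..1} \<Longrightarrow> x = 0 \<or> x = 1 \<or> y = 0 \<or> y = 1 \<Longrightarrow> t \<in> {0..1} \<Longrightarrow> G ((x, y), t) = F (x, y)"
    let ?P = "cylinder 1"
    have c: "continuous_map ?P X (\<lambda>p. G ((snd p 0, fst p), 1))"
    proof (rule continuous_map_from_square[OF G(1)])
      have "continuous_map ?P (prod_topology (top_of_set {0..1}) (top_of_set {0..1})) (\<lambda>p. (snd p 0, fst p))"
        by (intro continuous_map_pairedI continuous_map_unit_coord continuous_map_fst) auto
      then show "continuous_map ?P (top_of_set ?Q) (\<lambda>p. (snd p 0, fst p))" by simp
    qed auto
    have t01: "t 0 \<in> {0..1}" if "t \<in> topspace (cube 1)" for t using cube_coord_in that by auto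
    show ?thesis
    proof (rule spheroid_homotopicI[OF f g, where h = "\<lambda>p. G ((snd p 0, fst p), 1)"])
      show "continuous_map ?P (subtopology X A) (\<lambda>p. G ((snd p 0, fst p), 1))"
        using c G(2) t01 by (auto simp: continuous_map_in_subtopology)
      fix t :: "nat \<Rightarrow> real"
      show "G ((snd (0::real, t) 0, fst (0, t)), 1) = f t" if "t \<in> topspace (cube 1)"
        using G(3)[OF t01[OF that], of 0 1] h(2) point1_coord[OF that] by (simp add: F_def)
      show "G ((snd (1::real, t) 0, fst (1, t)), 1) = g t" if "t \<in> topspace (cube 1)"
        using G(3)[OF t01[OF that], of 1 1] h(3) point1_coord[OF that] by (simp add: F_def)
      show "G ((snd (\<tau>, t) 0, fst (\<tau>, t)), 1) = x" if "\<tau> \<in> {0..1}" "t \<in> cube_boundary 1" for \<tau>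
      proof -
        have t: "t \<in> topspace (cube 1)" using that(2) cube_boundary_subset by blast
        show ?thesis
          using G(3)[OF t01[OF t] that(1), of 1] h(4)[OF that] cube_boundary_1[OF that(2)] point1_coord[OF t]
          by (auto simp: F_def)
      qed
    qed
  qed
qed

text \<open>
  A 2-spheroid is a square with constant boundary. The homotopy that pushes it into \<open>A\<close> is
  stationary on the boundary, hence a homotopy of spheroids.
\<close>

lemma spheroid2_push:
  assumes x: "x \<in> A" and f: "f \<in> spheroids 2 X x"
  shows "\<exists>f'\<in>spheroids 2 (subtopology X A) x. (f, f') \<in> spheroid_homotopic 2 X x"
proof -
  have fc: "continuous_map (cube 2) X f" and fb: "\<And>t. t \<in> cube_boundary 2 \<Longrightarrow> f t = x"
    using f by (auto simp: spheroids_def)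
  define F where "F = (\<lambda>z. f (point2 (fst z) (snd z)))"
  let ?Q = "{0..1::real} \<times> {0..1::real}"
  have 1: "cmap_on ?Q (top_of_set {0..1}) snd" "cmap_on ?Q (top_of_set {0..1}) fst"
    by (auto intro!: continuous_intros)
  from continuous_map_compose[OF continuous_map_point2[OF 1(2,1)] fc]
  have F: "cmap_on ?Q X F" by (simp add: F_def o_def)
  have Fx: "F (s, u) = x" if "s \<in> {0..1}" "u \<in> {0..1}" "s = 0 \<or> s = 1 \<or> u = 0 \<or> u = 1" for s u
    using fb[OF point2_boundary[OF that]] by (simp add: F_def)
  show ?thesis
  proof (rule square_push_rel_boundary[OF F _ cells_pushable])
    show "F (s, u) \<in> A" if "s \<in> {0..1}" "u \<in> {0..1}" "s = 0 \<or> s = 1 \<or> u = 0 \<or> u = 1" for s u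
      using Fx[OF that] x by simp
    fix G assume G: "cmap_on (?Q \<times> {0..1::real}) X G"
      "\<And>x y. x \<in> {0..1} \<Longrightarrow> y \<in> {0..1} \<Longrightarrow> G ((x, y), 0) = F (x, y)"
      "\<And>x y. x \<in> {0..1} \<Longrightarrow> y \<in> {0..1} \<Longrightarrow> G ((x, y), 1) \<in> A"
      "\<And>x y t. x \<in> {0..1} \<Longrightarrow> y \<in> {0..1} \<Longrightarrow> x = 0 \<or> x = 1 \<or> y = 0 \<or> y = 1 \<Longrightarrow> t \<in> {0..1} \<Longrightarrow> G ((x, y), t) = F (x, y)"
    let ?P = "cylinder 2"
    have c: "continuous_map ?P X (\<lambda>p. G ((snd p 0, snd p 1), fst p))"
    proof (rule continuous_map_from_square[OF G(1)])
      have "continuous_map ?P (prod_topology (top_of_set {0..1}) (top_of_set {0..1})) (\<lambda>p. (snd p 0, snd p 1))"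
        by (intro continuous_map_pairedI continuous_map_unit_coord) auto
      then show "continuous_map ?P (top_of_set ?Q) (\<lambda>p. (snd p 0, snd p 1))" by simp
    qed (rule continuous_map_fst)
    have t01: "t 0 \<in> {0..1}" "t 1 \<in> {0..1}" if "t \<in> topspace (cube 2)" for t using cube_coord_in that by auto
    define f' where "f' t = G ((t 0, t 1), 1)" for t :: "nat \<Rightarrow> real"
    have Gb: "G ((t 0, t 1), \<tau>) = x" if "\<tau> \<in> {0..1}" "t \<in> cube_boundary 2" for \<tau> t
    proof -
      have t: "t \<in> topspace (cube 2)" using that(2) cube_boundary_subset by blast
      show ?thesis
        using G(4)[OF t01[OF t] cube_boundary_2[OF that(2)] that(1)] Fx[OF t01[OF t] cube_boundary_2[OF that(2)]] by simp
    qed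
    have "continuous_map (cube 2) ?P (\<lambda>t. (1, t))" by (intro continuous_map_pairedI) auto
    from continuous_map_compose[OF this c] have "continuous_map (cube 2) X f'" by (simp add: f'_def[abs_def] o_def)
    moreover have "f' t \<in> A" if "t \<in> topspace (cube 2)" for t
      unfolding f'_def by (rule G(3)[OF t01[OF that]])
    moreover have "f' t = x" if "t \<in> cube_boundary 2" for t
      unfolding f'_def using Gb[OF _ that] by simp
    ultimately have f': "f' \<in> spheroids 2 (subtopology X A) x"
      by (auto simp: spheroids_def continuous_map_in_subtopology)
    moreover have "(f, f') \<in> spheroid_homotopic 2 X x"
    proof (rule spheroid_homotopicI[OF f, where h = "\<lambda>p. G ((snd p 0, snd p 1), fst p)"])
      show "f' \<in> spheroids 2 X x" using f' by (auto simp: spheroids_def continuous_map_in_subtopology)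
      fix t :: "nat \<Rightarrow> real"
      show "G ((snd (0::real, t) 0, snd (0::real, t) 1), fst (0, t)) = f t" if "t \<in> topspace (cube 2)"
        using G(2)[OF t01[OF that]] point2_coord[OF that] by (simp add: F_def)
      show "G ((snd (\<tau>, t) 0, snd (\<tau>, t) 1), fst (\<tau>, t)) = x" if "\<tau> \<in> {0..1}" "t \<in> cube_boundary 2" for \<tau>
        using Gb[OF that] by simp
    qed (rule c, simp add: f'_def)
    ultimately show ?thesis by blast
  qed
qed

lemma path_component_push:
  assumes "a \<in> A" "b \<in> A" "path_component_of X a b"
  shows "path_component_of (subtopology X A) a b"
proof -
  obtain p where p: "cmap_on {0..1::real} X p" "p 0 = a" "p 1 = b"
    using assms(3) unfolding path_component_of_def pathin_def by blast
  then have "cmap_on {0..1} (subtopology X (topspace X)) p" by simp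
  then obtain H where "edge_push X A (topspace X) 0 1 p (\<lambda>_. p 0) (\<lambda>_. p 1) H"
    using path_push_rel_ends[of "topspace X" p] assms(1,2) p by auto
  then have H: "cmap_on ({0..1} \<times> {0..1}) X H" "\<And>s. s \<in> {0..1} \<Longrightarrow> H (s, 1) \<in> A"
    "H (0, 1) = a" "H (1, 1) = b"
    by (auto simp: edge_push_def p)
  have "cmap_on {0..1} X (\<lambda>s. H (s, 1))"
    by (intro continuous_map_from_square[OF H(1)]) auto
  then have "pathin (subtopology X A) (\<lambda>s. H (s, 1))"
    using H(2) by (auto simp: pathin_def continuous_map_in_subtopology)
  then show ?thesis using H(3,4) unfolding path_component_of_def by blast
qed

lemma pi0_map_inclusion:
  assumes "a \<in> A"
  shows "pi0_map X id (path_component_of_set (subtopology X A) a) = path_component_of_set X a"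
  unfolding pi0_map_def
proof (rule the_equality)
  have aX: "a \<in> topspace X" using assms A_sub by blast
  show "path_component_of_set X a \<in> path_components_of X \<and> id ` path_component_of_set (subtopology X A) a \<subseteq> path_component_of_set X a"
    using aX by (auto simp: path_components_of_def path_component_of_def pathin_def continuous_map_in_subtopology)
  fix D assume D: "D \<in> path_components_of X \<and> id ` path_component_of_set (subtopology X A) a \<subseteq> D"
  then obtain d where d: "d \<in> topspace X" "D = path_component_of_set X d" by (auto simp: path_components_of_def)
  have "path_component_of (subtopology X A) a a" using assms aX by (simp add: path_component_of_refl)
  then have "path_component_of X d a" using D d by auto
  then have "path_component_of X d = path_component_of X a" using path_component_of_equiv by metis
  then show "D = path_component_of_set X a" using d by simp
qed

text \<open>
  Surjective because every point can be pushed into \<open>A\<close>, injective because every path with ends in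
  \<open>A\<close> can.
\<close>

lemma pi0_map_bij: "bij_betw (pi0_map X id) (path_components_of (subtopology X A)) (path_components_of X)"
  unfolding bij_betw_def
proof
  have comps: "path_components_of (subtopology X A) = path_component_of_set (subtopology X A) ` A"
    using A_sub by (simp add: path_components_of_def inf.absorb2)
  show "inj_on (pi0_map X id) (path_components_of (subtopology X A))"
    unfolding comps
  proof (rule inj_onI)
    fix C C' assume "C \<in> path_component_of_set (subtopology X A) ` A" "C' \<in> path_component_of_set (subtopology X A) ` A"
      and eq: "pi0_map X id C = pi0_map X id C'"
    then obtain a b where a: "a \<in> A" "C = path_component_of_set (subtopology X A) a"
      and b: "b \<in> A" "C' = path_component_of_set (subtopology X A) b" by blast
    have "path_component_of_set X a = path_component_of_set X b" using eq pi0_map_inclusion a b by simp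
    moreover have "path_component_of X b b" using b(1) A_sub by (auto simp: path_component_of_refl)
    ultimately have "path_component_of X a b" by blast
    then have "path_component_of (subtopology X A) a b" using path_component_push a b by blast
    then have "path_component_of (subtopology X A) a = path_component_of (subtopology X A) b"
      using path_component_of_equiv by metis
    then show "C = C'" using a b by simp
  qed
  show "pi0_map X id ` path_components_of (subtopology X A) = path_components_of X"
  proof (intro Set.equalityI subsetI)
    fix D assume "D \<in> pi0_map X id ` path_components_of (subtopology X A)"
    then obtain a where "a \<in> A" "D = path_component_of_set X a" unfolding comps using pi0_map_inclusion by auto
    then show "D \<in> path_components_of X" using A_sub by (auto simp: path_components_of_def)
  next
    fix D assume "D \<in> path_components_of X"
    then obtain d where d: "d \<in> topspace X" "D = path_component_of_set X d" by (auto simp: path_components_of_def)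
    obtain r where r: "cmap_on {0..1::real} (subtopology X (topspace X)) r" "r 0 = d" "r 1 \<in> A"
      using push_point[of "topspace X" d] d by auto
    then have "path_component_of X d (r 1)" unfolding path_component_of_def pathin_def by auto
    then have "path_component_of X d = path_component_of X (r 1)" using path_component_of_equiv by metis
    then have "D = pi0_map X id (path_component_of_set (subtopology X A) (r 1))"
      using d pi0_map_inclusion[OF r(3)] by simp
    then show "D \<in> pi0_map X id ` path_components_of (subtopology X A)" unfolding comps using r(3) by blast
  qed
qed

lemma two_connected_inclusion: "two_connected_map (subtopology X A) X id"
proof -
  have "homotopy_group_map 1 X id x \<in> iso (homotopy_group 1 (subtopology X A) x) (homotopy_group 1 X x)" if "x \<in> A" for x
    by (rule homotopy_group_map_inclusion_iso[OF A_sub _ spheroid1_push[OF that] spheroid1_homotopic_push[OF that]]) auto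
  moreover have "homotopy_group_map 2 X id x ` carrier (homotopy_group 2 (subtopology X A) x) = carrier (homotopy_group 2 X x)"
    if "x \<in> A" for x
    by (rule homotopy_group_map_inclusion_surj[OF A_sub spheroid2_push[OF that]])
  moreover have "continuous_map (subtopology X A) X id" by (simp add: continuous_map_from_subtopology)
  ultimately show ?thesis unfolding two_connected_map_def using pi0_map_bij by simp
qed

end

theorem theorem5p9:
  fixes X :: "'a topology" and Y :: "'a set"
    and K :: "'v set set" and h :: "('v \<Rightarrow> real) \<Rightarrow> 'a"
  assumes "triangulates K h X"
    and "is_subcomplex K h Y"
    and "X closure_of (topspace X - Y) = topspace X"
    and "\<forall>y\<in>Y. \<forall>U. openin X U \<and> y \<in> U \<longrightarrow>
           (\<exists>V. openin X V \<and> V \<subseteq> U \<and> y \<in> V \<and> path_connectedin X (V - Y))"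
    and "\<forall>y\<in>Y. \<exists>V. openin X V \<and> y \<in> V \<and> path_connectedin X V \<and>
           (\<forall>v\<in>V. carrier (homotopy_group 2 (subtopology X V) v)
                    = {one (homotopy_group 2 (subtopology X V) v)}) \<and>
           (\<forall>v\<in>V - Y. inj_on (homotopy_group_map 1 (subtopology X V) id v)
                          (carrier (homotopy_group 1 (subtopology X (V - Y)) v)))"
  shows "two_connected_map (subtopology X (topspace X - Y)) X id"
proof -
  let ?A = "topspace X - Y"
  have Aop: "openin X ?A" by (rule triangulated_subcomplex_complement_open[OF assms(1,2)])
  note contr = triangulated_locally_contractible[OF assms(1)]
  have VA: "V \<inter> ?A = V - Y" if "openin X V" for V using openin_subset[OF that] by blast
  have join: "\<exists>V. openin X V \<and> x \<in> V \<and> V \<subseteq> W \<and>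
        (\<forall>a\<in>V \<inter> ?A. \<forall>b\<in>V \<inter> ?A. \<exists>g. pathin (subtopology X (W \<inter> ?A)) g \<and> g 0 = a \<and> g 1 = b)"
    if W: "openin X W" "x \<in> W" for W x
  proof (cases "x \<in> Y")
    case True
    then obtain V where V: "openin X V" "V \<subseteq> W" "x \<in> V" "path_connectedin X (V - Y)"
      using assms(4) W by blast
    have "\<exists>g. pathin (subtopology X (W \<inter> ?A)) g \<and> g 0 = a \<and> g 1 = b" if "a \<in> V \<inter> ?A" "b \<in> V \<inter> ?A" for a b
    proof -
      have "a \<in> V - Y" "b \<in> V - Y" using that by auto
      moreover have "\<forall>a\<in>V - Y. \<forall>b\<in>V - Y. \<exists>g. pathin X g \<and> g \<in> {0..1} \<rightarrow> V - Y \<and> g 0 = a \<and> g 1 = b"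
        using V(4) unfolding path_connectedin by (rule conjunct2)
      ultimately obtain g where g: "pathin X g" "g \<in> {0..1} \<rightarrow> V - Y" "g 0 = a" "g 1 = b"
        by blast
      moreover have "V - Y \<subseteq> W \<inter> ?A" using VA[OF V(1)] V(2) by blast
      ultimately have "pathin (subtopology X (W \<inter> ?A)) g"
        by (auto simp: pathin_def continuous_map_in_subtopology Pi_iff)
      then show ?thesis using g by blast
    qed
    then show ?thesis using V by blast
  next
    case False
    \<comment> \<open>at a point of the complement, connect through the centre of a contraction inside the complement\<close>
    have WA: "openin X (W \<inter> ?A)" "x \<in> W \<inter> ?A" using W Aop False openin_subset[OF W(1)] by auto
    obtain V c where V: "openin X V" "x \<in> V" "V \<subseteq> W \<inter> ?A"
      and c: "continuous_map (prod_topology (subtopology X V) (top_of_set {0..1})) (subtopology X (W \<inter> ?A)) c"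
        "\<forall>v\<in>V. c (v, 0) = v \<and> c (v, 1::real) = x"
      using contr[OF WA] by (elim exE conjE)
    have "path_component_of (subtopology X (W \<inter> ?A)) a x" if "a \<in> V" for a
    proof -
      have "a \<in> topspace X" using that V(1) openin_subset by blast
      then have "cmap_on {0..1} (prod_topology (subtopology X V) (top_of_set {0..1::real})) (\<lambda>t. (a, t))"
        using that by (intro continuous_map_pairedI) auto
      from continuous_map_compose[OF this c(1)] have "pathin (subtopology X (W \<inter> ?A)) (\<lambda>t. c (a, t))"
        by (simp add: pathin_def o_def)
      then show ?thesis using c(2) that unfolding path_component_of_def by (intro exI[of _ "\<lambda>t. c (a, t)"]) simp
    qed
    then have "path_component_of (subtopology X (W \<inter> ?A)) a b" if "a \<in> V" "b \<in> V" for a b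
      using that path_component_of_trans path_component_of_sym by metis
    then show ?thesis using V unfolding path_component_of_def by blast
  qed
  have cells_pushable: "\<exists>V. openin X V \<and> x \<in> V \<and> (\<forall>m \<delta> \<phi>. cell_data X ?A V m \<delta> \<phi> \<longrightarrow> (\<exists>F. cell_push X ?A m \<delta> \<phi> F))"
    if x: "x \<in> topspace X" for x
  proof (cases "x \<in> Y")
    case False
    then show ?thesis using x Aop cell_push_within[where A = ?A and V = ?A] by (intro exI[of _ ?A]) blast
  next
    case True
    from bspec[OF assms(5) True] obtain V where V: "openin X V" "x \<in> V" and "path_connectedin X V"
      and pi2: "\<forall>v\<in>V. carrier (homotopy_group 2 (subtopology X V) v) = {one (homotopy_group 2 (subtopology X V) v)}"
      and pi1: "\<forall>v\<in>V - Y. inj_on (homotopy_group_map 1 (subtopology X V) id v)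
                          (carrier (homotopy_group 1 (subtopology X (V - Y)) v))"
      by (elim exE conjE)
    have VX: "V \<subseteq> topspace X" using V(1) openin_subset by blast
    have "\<exists>F. cell_push X ?A m \<delta> \<phi> F" if "cell_data X ?A V m \<delta> \<phi>" for m \<delta> \<phi>
    proof (rule cell_push_local[OF that VX], unfold VA[OF V(1)])
      fix v \<sigma> assume v: "v \<in> V" "\<sigma> \<in> spheroids 2 (subtopology X V) v"
      then show "(\<sigma>, \<lambda>_. v) \<in> spheroid_homotopic 2 (subtopology X V) v"
        using pi2 VX by (intro null_if_carrier_trivial) auto
    next
      fix v \<sigma> assume v: "v \<in> V - Y" "\<sigma> \<in> spheroids 1 (subtopology X (V - Y)) v"
        "(\<sigma>, \<lambda>_. v) \<in> spheroid_homotopic 1 (subtopology X V) v"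
      show "(\<sigma>, \<lambda>_. v) \<in> spheroid_homotopic 1 (subtopology X (V - Y)) v"
        by (rule null_if_map_injective[OF bspec[OF pi1 v(1)] _ v(1) _ v(2,3)]) (use v(1) VX in auto)
    qed
    then show ?thesis using V by blast
  qed
  interpret very_thin_complement X ?A
  proof
    show "W \<inter> ?A \<noteq> {}" if "openin X W" "W \<noteq> {}" for W
      using assms(3) that unfolding dense_intersects_open by blast
  qed (fact Aop contr join cells_pushable)+
  show ?thesis by (rule two_connected_inclusion)
qed

end
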